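(* Let $T$ be a complete first-order theory, let $S$ be a product of sorts (possibly with an unbounded number of factors, repetitions allowed), and let $X$ be a $\emptyset$-type-definable subset of $S$. (i) Whether a minimal left ideal of the Ellis semigroup of the $\mathrm{Aut}(\mathfrak C)$-flow $S_X(\mathfrak C)$ is of bounded size does not depend on the choice of the monster model $\mathfrak C$ of $T$: for any two monster models $\mathfrak C_1,\mathfrak C_2$ of $T$, the minimal left ideals of $EL(S_X(\mathfrak C_1))$ are bounded (relative to $\mathfrak C_1$) if and only if the minimal left ideals of $EL(S_X(\mathfrak C_2))$ are bounded (relative to $\mathfrak C_2$). (ii) Assume that a minimal left ideal of the Ellis semigroup of $S_X(\mathfrak C)$ is of bounded size. Let $\mathfrak C_1$ and $\mathfrak C_2$ be two monster models of $T$. Then for every minimal left ideal $\mathcal M_1$ of the Ellis semigroup of $S_X(\mathfrak C_1)$ there exists a minimal left ideal $\mathcal M_2$ of the Ellis semigroup of $S_X(\mathfrak C_2)$ which is isomorphic to $\mathcal M_1$ as a semigroup.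
   Context: A monster model $\mathfrak C$ of $T$ is a $\kappa$-saturated, strongly $\kappa$-homogeneous model for a large strong limit cardinal $\kappa$; a cardinal is bounded if it is $<\kappa$. For $S=\prod_{i\in I}S_i$ with variables $\bar x=(x_i)_{i\in I}$, a $\emptyset$-type-definable subset $X$ is a partial type over $\emptyset$ in $\bar x$, and $S_X(\mathfrak C)$ is the Stone space of complete types over $\mathfrak C$ in $\bar x$ containing $X$, an $\mathrm{Aut}(\mathfrak C)$-flow via $\sigma(p)=\{\varphi(\bar x,\sigma(\bar a)):\varphi(\bar x,\bar a)\in p\}$. The Ellis semigroup $EL(S_X(\mathfrak C))$ is the closure in $S_X(\mathfrak C)^{S_X(\mathfrak C)}$ (product topology) of the maps induced by automorphisms, with composition as the semigroup operation; minimal left ideals are minimal nonempty subsets $\mathcal M$ with $EL\,\mathcal M\subseteq \mathcal M$ (all minimal left ideals have the same cardinality). *)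

theory Defs
  imports "HOL-Analysis.Function_Topology"
begin

unbundle cardinal_syntax

section \<open>Many-sorted first-order logic\<close>

text \<open>
  The sorts are the elements of the type \<open>'s\<close>. Bound variables are de Bruijn indices;
  \<open>Free v\<close> stands for a free variable or for a parameter named \<open>v\<close>.
\<close>

record ('f, 'r, 's) lang =
  funs :: "'f set"
  rels :: "'r set"
  fun_args :: "'f \<Rightarrow> 's list"
  fun_res :: "'f \<Rightarrow> 's"
  rel_args :: "'r \<Rightarrow> 's list"

datatype (dead 'f, 'v) tm =
    Free 'v
  | Bnd nat
  | Fun 'f "('f, 'v) tm list"

datatype (dead 'f, dead 'r, dead 's, 'v) fm =
    Eq "('f, 'v) tm" "('f, 'v) tm"
  | Rel 'r "('f, 'v) tm list"
  | Neg "('f, 'r, 's, 'v) fm"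
  | Conj "('f, 'r, 's, 'v) fm" "('f, 'r, 's, 'v) fm"
  | Ex 's "('f, 'r, 's, 'v) fm"

text \<open>
  Well-sortedness: \<open>S v = Some s\<close> says that the free name \<open>v\<close> may be used and has sort \<open>s\<close>;
  the list \<open>\<Gamma>\<close> holds the sorts of the bound variables in scope.
\<close>

primrec tm_sort :: "('f, 'r, 's) lang \<Rightarrow> ('v \<rightharpoonup> 's) \<Rightarrow> 's list \<Rightarrow> ('f, 'v) tm \<Rightarrow> 's option" where
  "tm_sort L S \<Gamma> (Free v) = S v"
| "tm_sort L S \<Gamma> (Bnd n) = (if n < length \<Gamma> then Some (\<Gamma> ! n) else None)"
| "tm_sort L S \<Gamma> (Fun f ts) =
     (if f \<in> funs L \<and> map (tm_sort L S \<Gamma>) ts = map Some (fun_args L f)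
      then Some (fun_res L f) else None)"

primrec fm_wf :: "('f, 'r, 's) lang \<Rightarrow> ('v \<rightharpoonup> 's) \<Rightarrow> 's list \<Rightarrow> ('f, 'r, 's, 'v) fm \<Rightarrow> bool" where
  "fm_wf L S \<Gamma> (Eq t u) \<longleftrightarrow> (\<exists>s. tm_sort L S \<Gamma> t = Some s \<and> tm_sort L S \<Gamma> u = Some s)"
| "fm_wf L S \<Gamma> (Rel r ts) \<longleftrightarrow>
     r \<in> rels L \<and> map (tm_sort L S \<Gamma>) ts = map Some (rel_args L r)"
| "fm_wf L S \<Gamma> (Neg \<phi>) \<longleftrightarrow> fm_wf L S \<Gamma> \<phi>"
| "fm_wf L S \<Gamma> (Conj \<phi> \<psi>) \<longleftrightarrow> fm_wf L S \<Gamma> \<phi> \<and> fm_wf L S \<Gamma> \<psi>"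
| "fm_wf L S \<Gamma> (Ex s \<phi>) \<longleftrightarrow> fm_wf L S (s # \<Gamma>) \<phi>"

definition formulas :: "('f, 'r, 's) lang \<Rightarrow> ('v \<rightharpoonup> 's) \<Rightarrow> ('f, 'r, 's, 'v) fm set" where
  "formulas L S = {\<phi>. fm_wf L S [] \<phi>}"

text \<open>The type \<open>unit\<close> is a dummy here: no free name is allowed in a sentence.\<close>

definition sentences :: "('f, 'r, 's) lang \<Rightarrow> ('f, 'r, 's, unit) fm set" where
  "sentences L = formulas L Map.empty"

text \<open>
  The universe of a structure is the domain of \<open>sort_of\<close>, so distinct sorts are interpreted by
  disjoint sets.
\<close>

record ('f, 'r, 's, 'a) struct =
  sort_of :: "'a \<rightharpoonup> 's"
  fun_int :: "'f \<Rightarrow> 'a list \<Rightarrow> 'a"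
  rel_int :: "'r \<Rightarrow> 'a list \<Rightarrow> bool"

abbreviation univ :: "('f, 'r, 's, 'a) struct \<Rightarrow> 'a set" where
  "univ M \<equiv> dom (sort_of M)"

definition is_struct :: "('f, 'r, 's) lang \<Rightarrow> ('f, 'r, 's, 'a) struct \<Rightarrow> bool" where
  "is_struct L M \<longleftrightarrow>
     (\<forall>s. \<exists>a. sort_of M a = Some s) \<and>
     (\<forall>f\<in>funs L. \<forall>as. map (sort_of M) as = map Some (fun_args L f) \<longrightarrow>
        sort_of M (fun_int M f as) = Some (fun_res L f))"

primrec tm_val :: "('f, 'r, 's, 'a) struct \<Rightarrow> ('v \<Rightarrow> 'a) \<Rightarrow> 'a list \<Rightarrow> ('f, 'v) tm \<Rightarrow> 'a" where
  "tm_val M v e (Free x) = v x"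
| "tm_val M v e (Bnd n) = e ! n"
| "tm_val M v e (Fun f ts) = fun_int M f (map (tm_val M v e) ts)"

primrec sat :: "('f, 'r, 's, 'a) struct \<Rightarrow> ('v \<Rightarrow> 'a) \<Rightarrow> 'a list \<Rightarrow> ('f, 'r, 's, 'v) fm \<Rightarrow> bool" where
  "sat M v e (Eq t u) \<longleftrightarrow> tm_val M v e t = tm_val M v e u"
| "sat M v e (Rel r ts) \<longleftrightarrow> rel_int M r (map (tm_val M v e) ts)"
| "sat M v e (Neg \<phi>) \<longleftrightarrow> \<not> sat M v e \<phi>"
| "sat M v e (Conj \<phi> \<psi>) \<longleftrightarrow> sat M v e \<phi> \<and> sat M v e \<psi>"
| "sat M v e (Ex s \<phi>) \<longleftrightarrow> (\<exists>a. sort_of M a = Some s \<and> sat M v (a # e) \<phi>)"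

text \<open>
  Theories are taken to be deductively closed, so a complete theory decides every sentence by
  membership. Consistency is not required separately: it is witnessed by any model.
\<close>

definition complete_theory :: "('f, 'r, 's) lang \<Rightarrow> ('f, 'r, 's, unit) fm set \<Rightarrow> bool" where
  "complete_theory L T \<longleftrightarrow>
     T \<subseteq> sentences L \<and> (\<forall>\<phi>\<in>sentences L. \<phi> \<in> T \<longleftrightarrow> Neg \<phi> \<notin> T)"

definition is_model ::
  "('f, 'r, 's) lang \<Rightarrow> ('f, 'r, 's, unit) fm set \<Rightarrow> ('f, 'r, 's, 'a) struct \<Rightarrow> bool" where
  "is_model L T M \<longleftrightarrow> is_struct L M \<and> (\<forall>\<phi>\<in>T. \<forall>v. sat M v [] \<phi>)"

definition assigns :: "('f, 'r, 's, 'a) struct \<Rightarrow> ('v \<rightharpoonup> 's) \<Rightarrow> ('v \<Rightarrow> 'a) set" where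
  "assigns M S = {v. \<forall>x\<in>dom S. sort_of M (v x) = S x}"

definition automorphisms ::
  "('f, 'r, 's) lang \<Rightarrow> ('f, 'r, 's, 'a) struct \<Rightarrow> ('a \<Rightarrow> 'a) set" where
  "automorphisms L M = {\<sigma>.
     bij_betw \<sigma> (univ M) (univ M) \<and>
     (\<forall>a\<in>univ M. sort_of M (\<sigma> a) = sort_of M a) \<and>
     (\<forall>f\<in>funs L. \<forall>as. map (sort_of M) as = map Some (fun_args L f) \<longrightarrow>
        \<sigma> (fun_int M f as) = fun_int M f (map \<sigma> as)) \<and>
     (\<forall>r\<in>rels L. \<forall>as. map (sort_of M) as = map Some (rel_args L r) \<longrightarrow>
        rel_int M r (map \<sigma> as) = rel_int M r as)}"


section \<open>Types and monster models\<close>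

text \<open>
  In a formula \<open>\<phi>(x, a)\<close> over \<open>A \<subseteq> univ M\<close>, the variable \<open>x\<^sub>i\<close> is \<open>Free (Inl i)\<close> and the
  parameter \<open>a\<close> is \<open>Free (Inr a)\<close>. A product of sorts \<open>\<Prod>\<^sub>i\<^sub>\<in>\<^sub>I S\<^sub>i\<close> is a partial map \<open>S\<close> with domain \<open>I\<close>.
\<close>

definition formulas_over ::
  "('f, 'r, 's) lang \<Rightarrow> ('i \<rightharpoonup> 's) \<Rightarrow> ('f, 'r, 's, 'a) struct \<Rightarrow> 'a set \<Rightarrow> ('f, 'r, 's, 'i + 'a) fm set" where
  "formulas_over L S M A = formulas L (case_sum S (sort_of M |` A))"

definition realizes ::
  "('f, 'r, 's, 'a) struct \<Rightarrow> ('i \<Rightarrow> 'a) \<Rightarrow> ('f, 'r, 's, 'i + 'a) fm set \<Rightarrow> bool" where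
  "realizes M v p \<longleftrightarrow> (\<forall>\<phi>\<in>p. sat M (case_sum v id) [] \<phi>)"

definition fin_sat ::
  "('i \<rightharpoonup> 's) \<Rightarrow> ('f, 'r, 's, 'a) struct \<Rightarrow> ('f, 'r, 's, 'i + 'a) fm set \<Rightarrow> bool" where
  "fin_sat S M p \<longleftrightarrow> (\<forall>q\<subseteq>p. finite q \<longrightarrow> (\<exists>v\<in>assigns M S. realizes M v q))"

definition saturated ::
  "('f, 'r, 's) lang \<Rightarrow> 'k rel \<Rightarrow> ('f, 'r, 's, 'a) struct \<Rightarrow> bool" where
  "saturated L \<kappa> M \<longleftrightarrow>
     (\<forall>A (S :: unit \<rightharpoonup> 's) p. A \<subseteq> univ M \<and> |A| <o \<kappa> \<and> p \<subseteq> formulas_over L S M A \<and> fin_sat S M p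
        \<longrightarrow> (\<exists>v\<in>assigns M S. realizes M v p))"

definition elementary_map ::
  "('f, 'r, 's) lang \<Rightarrow> ('f, 'r, 's, 'a) struct \<Rightarrow> 'a set \<Rightarrow> ('a \<Rightarrow> 'a) \<Rightarrow> bool" where
  "elementary_map L M A f \<longleftrightarrow>
     f \<in> assigns M (sort_of M |` A) \<and>
     (\<forall>\<phi>\<in>formulas L (sort_of M |` A). sat M id [] \<phi> \<longleftrightarrow> sat M f [] \<phi>)"

definition strongly_homogeneous ::
  "('f, 'r, 's) lang \<Rightarrow> 'k rel \<Rightarrow> ('f, 'r, 's, 'a) struct \<Rightarrow> bool" where
  "strongly_homogeneous L \<kappa> M \<longleftrightarrow>
     (\<forall>A f. A \<subseteq> univ M \<and> |A| <o \<kappa> \<and> elementary_map L M A f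
        \<longrightarrow> (\<exists>\<sigma>\<in>automorphisms L M. \<forall>a\<in>A. \<sigma> a = f a))"

text \<open>Every cardinal below \<open>\<kappa>\<close> is the cardinality of a subset of \<open>Field \<kappa>\<close>.\<close>

definition strong_limit :: "'k rel \<Rightarrow> bool" where
  "strong_limit \<kappa> \<longleftrightarrow> Card_order \<kappa> \<and> (\<forall>A\<subseteq>Field \<kappa>. |A| <o \<kappa> \<longrightarrow> |Pow A| <o \<kappa>)"

text \<open>
  \<open>\<kappa>\<close> is large when it exceeds \<open>|T|\<close>, that is, the number of sorts and symbols of the language
  plus \<open>\<aleph>\<^sub>0\<close>. In particular \<open>\<kappa>\<close> is uncountable.
\<close>

definition monster ::
  "('f, 'r, 's) lang \<Rightarrow> ('f, 'r, 's, unit) fm set \<Rightarrow> 'k rel \<Rightarrow> ('f, 'r, 's, 'a) struct \<Rightarrow> bool" where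
  "monster L T \<kappa> M \<longleftrightarrow>
     strong_limit \<kappa> \<and>
     natLeq +c |UNIV :: 's set| +c |funs L| +c |rels L| <o \<kappa> \<and>
     is_model L T M \<and> saturated L \<kappa> M \<and> strongly_homogeneous L \<kappa> M"


section \<open>The flow of global types and its Ellis semigroup\<close>

definition complete_types ::
  "('f, 'r, 's) lang \<Rightarrow> ('i \<rightharpoonup> 's) \<Rightarrow> ('f, 'r, 's, 'a) struct \<Rightarrow> ('f, 'r, 's, 'i + 'a) fm set set" where
  "complete_types L S M = {p.
     p \<subseteq> formulas_over L S M (univ M) \<and> fin_sat S M p \<and>
     (\<forall>\<phi>\<in>formulas_over L S M (univ M). \<phi> \<in> p \<or> Neg \<phi> \<in> p)}"

definition type_space ::
  "('f, 'r, 's) lang \<Rightarrow> ('i \<rightharpoonup> 's) \<Rightarrow> ('f, 'r, 's, 'i) fm set \<Rightarrow> ('f, 'r, 's, 'a) struct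
     \<Rightarrow> ('f, 'r, 's, 'i + 'a) fm set set" where
  "type_space L S X M = {p \<in> complete_types L S M. map_fm Inl ` X \<subseteq> p}"

definition stone_topology ::
  "('f, 'r, 's) lang \<Rightarrow> ('i \<rightharpoonup> 's) \<Rightarrow> ('f, 'r, 's, 'i) fm set \<Rightarrow> ('f, 'r, 's, 'a) struct
     \<Rightarrow> ('f, 'r, 's, 'i + 'a) fm set topology" where
  "stone_topology L S X M = topology_generated_by
     ((\<lambda>\<phi>. {p \<in> type_space L S X M. \<phi> \<in> p}) ` formulas_over L S M (univ M))"

definition type_action ::
  "('a \<Rightarrow> 'a) \<Rightarrow> ('f, 'r, 's, 'i + 'a) fm set \<Rightarrow> ('f, 'r, 's, 'i + 'a) fm set" where
  "type_action \<sigma> p = map_fm (map_sum id \<sigma>) ` p"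

definition ellis_semigroup ::
  "('f, 'r, 's) lang \<Rightarrow> ('i \<rightharpoonup> 's) \<Rightarrow> ('f, 'r, 's, 'i) fm set \<Rightarrow> ('f, 'r, 's, 'a) struct
     \<Rightarrow> (('f, 'r, 's, 'i + 'a) fm set \<Rightarrow> ('f, 'r, 's, 'i + 'a) fm set) set" where
  "ellis_semigroup L S X M =
     product_topology (\<lambda>_. stone_topology L S X M) (type_space L S X M)
       closure_of ((\<lambda>\<sigma>. restrict (type_action \<sigma>) (type_space L S X M)) ` automorphisms L M)"

definition left_ideal :: "'e set \<Rightarrow> ('e \<Rightarrow> 'e \<Rightarrow> 'e) \<Rightarrow> 'e set \<Rightarrow> bool" where
  "left_ideal E m J \<longleftrightarrow> J \<subseteq> E \<and> J \<noteq> {} \<and> (\<forall>e\<in>E. \<forall>x\<in>J. m e x \<in> J)"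

definition minimal_left_ideal :: "'e set \<Rightarrow> ('e \<Rightarrow> 'e \<Rightarrow> 'e) \<Rightarrow> 'e set \<Rightarrow> bool" where
  "minimal_left_ideal E m J \<longleftrightarrow>
     left_ideal E m J \<and> (\<forall>K. left_ideal E m K \<and> K \<subseteq> J \<longrightarrow> K = J)"

definition semigroup_isomorphic ::
  "'d set \<Rightarrow> ('d \<Rightarrow> 'd \<Rightarrow> 'd) \<Rightarrow> 'e set \<Rightarrow> ('e \<Rightarrow> 'e \<Rightarrow> 'e) \<Rightarrow> bool" where
  "semigroup_isomorphic A m B n \<longleftrightarrow>
     (\<exists>h. bij_betw h A B \<and> (\<forall>x\<in>A. \<forall>y\<in>A. h (m x y) = n (h x) (h y)))"

text \<open>
  The elements of the Ellis semigroup are extensional functions on the type space, so their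
  composition is \<open>compose\<close> on that space.
\<close>

abbreviation ellis_mult ::
  "('f, 'r, 's) lang \<Rightarrow> ('i \<rightharpoonup> 's) \<Rightarrow> ('f, 'r, 's, 'i) fm set \<Rightarrow> ('f, 'r, 's, 'a) struct
     \<Rightarrow> (('f, 'r, 's, 'i + 'a) fm set \<Rightarrow> ('f, 'r, 's, 'i + 'a) fm set)
     \<Rightarrow> (('f, 'r, 's, 'i + 'a) fm set \<Rightarrow> ('f, 'r, 's, 'i + 'a) fm set)
     \<Rightarrow> (('f, 'r, 's, 'i + 'a) fm set \<Rightarrow> ('f, 'r, 's, 'i + 'a) fm set)" where
  "ellis_mult L S X M \<equiv> compose (type_space L S X M)"

definition minimal_ellis_ideals ::
  "('f, 'r, 's) lang \<Rightarrow> ('i \<rightharpoonup> 's) \<Rightarrow> ('f, 'r, 's, 'i) fm set \<Rightarrow> ('f, 'r, 's, 'a) struct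
     \<Rightarrow> (('f, 'r, 's, 'i + 'a) fm set \<Rightarrow> ('f, 'r, 's, 'i + 'a) fm set) set set" where
  "minimal_ellis_ideals L S X M =
     {J. minimal_left_ideal (ellis_semigroup L S X M) (ellis_mult L S X M) J}"

end

theory Submission
  imports Defs "HOL-Analysis.T1_Spaces"
begin

text \<open>
  A map belongs to the Ellis semigroup iff every finite piece of it is copied from the identity by
  finite partial elementary maps; in this sense it only shrinks the contents of families of types.
  This relation makes sense between two monster models, and families can be extended along it by
  compactness.

  Let \<open>J\<close> be a minimal left ideal of bounded size. Every type in the image of an element of \<open>J\<close> has
  a bounded orbit, and a coheir argument shows that such a type is invariant over every conjugate of
  a small model \<open>N\<close>. A type invariant in this way is determined by small data, so these
  types correspond bijectively, preserving contents, in any two monster models. Carrying an element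
  of \<open>J\<close> over to the second model, composed with an extension of the correspondence, yields elements
  of its Ellis semigroup whose images consist of invariant types. Conversely, an ideal with such
  images is bounded, since its elements are determined by how they move the few sets
  \<open>{b. \<phi>(x,b) \<in> p}\<close> with \<open>p\<close> invariant. Finally, because of its idempotents a minimal left ideal is
  isomorphic to the semigroup of its restrictions to the invariant types, which is the same for
  both models.
\<close>

section \<open>Renaming, coincidence and abstraction\<close>

text \<open>The two monster models may have very different sizes and no embedding between them is
  given, so only finite pieces of types are compared. What they share is a model \<open>N\<close> of
  size at most \<open>card_lang\<close>, which lies below both cardinals and can therefore be copied
  from one model into the other. Three obstacles shape the rest. First, an element of the Ellis
  semigroup is approximated by automorphisms, and these move \<open>N\<close>; so invariance has to
  be required over all conjugates of \<open>N\<close> to be preserved by the semigroup. Second, the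
  number of variables is unbounded, so invariant types themselves cannot be counted. Counting goes
  through sets of parameters instead: there are at most doubly exponentially many of them in
  \<open>card_lang\<close>, which is few because \<kappa> is a strong limit. Third, carrying an
  element to the other model fixes its values on invariant types only, so it has many lifts. The
  isomorphism is therefore found backwards: all lifts of an ideal form a left ideal, and a minimal
  ideal chosen inside it maps back to the original one without ambiguity.\<close>

lemma tm_val_map: "tm_val M v e (map_tm g t) = tm_val M (v \<circ> g) e t"
  by (induction t) (auto simp: o_def cong: map_cong)

lemma sat_map: "sat M v e (map_fm g \<phi>) \<longleftrightarrow> sat M (v \<circ> g) e \<phi>"
  by (induction \<phi> arbitrary: e) (auto simp: tm_val_map o_def)

lemma tm_val_cong: "(\<And>x. x \<in> set_tm t \<Longrightarrow> v x = w x) \<Longrightarrow> tm_val M v e t = tm_val M w e t"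
proof (induction t)
  case (Fun f ts)
  then have "map (tm_val M v e) ts = map (tm_val M w e) ts" by auto
  then show ?case unfolding tm_val.simps by metis
qed auto

lemma sat_cong: "(\<And>x. x \<in> set_fm \<phi> \<Longrightarrow> v x = w x) \<Longrightarrow> sat M v e \<phi> \<longleftrightarrow> sat M w e \<phi>"
proof (induction \<phi> arbitrary: e)
  case (Eq t u)
  have "tm_val M v e t = tm_val M w e t" "tm_val M v e u = tm_val M w e u"
    by (rule tm_val_cong, use Eq in simp)+
  then show ?case by simp
next
  case (Rel r ts)
  then have "map (tm_val M v e) ts = map (tm_val M w e) ts"
    by (auto intro!: tm_val_cong)
  then show ?case unfolding sat.simps by metis
qed auto

lemma tm_sort_map: "tm_sort L S \<Gamma> (map_tm g t) = tm_sort L (S \<circ> g) \<Gamma> t"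
  by (induction t) (auto simp: o_def cong: map_cong)

lemma fm_wf_map: "fm_wf L S \<Gamma> (map_fm g \<phi>) \<longleftrightarrow> fm_wf L (S \<circ> g) \<Gamma> \<phi>"
  by (induction \<phi> arbitrary: \<Gamma>) (auto simp: tm_sort_map o_def)

lemma tm_sort_cong: "(\<And>x. x \<in> set_tm t \<Longrightarrow> S x = S' x) \<Longrightarrow> tm_sort L S \<Gamma> t = tm_sort L S' \<Gamma> t"
proof (induction t)
  case (Fun f ts)
  then have "map (tm_sort L S \<Gamma>) ts = map (tm_sort L S' \<Gamma>) ts" by auto
  then show ?case unfolding tm_sort.simps by metis
qed auto

lemma fm_wf_cong: "(\<And>x. x \<in> set_fm \<phi> \<Longrightarrow> S x = S' x) \<Longrightarrow> fm_wf L S \<Gamma> \<phi> \<longleftrightarrow> fm_wf L S' \<Gamma> \<phi>"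
proof (induction \<phi> arbitrary: \<Gamma>)
  case (Eq t u)
  have "tm_sort L S \<Gamma> t = tm_sort L S' \<Gamma> t" "tm_sort L S \<Gamma> u = tm_sort L S' \<Gamma> u"
    by (rule tm_sort_cong, use Eq in simp)+
  then show ?case by simp
next
  case (Rel r ts)
  then have "map (tm_sort L S \<Gamma>) ts = map (tm_sort L S' \<Gamma>) ts"
    by (auto intro!: tm_sort_cong)
  then show ?case unfolding fm_wf.simps by metis
qed auto

lemma tm_sort_args:
  "tm_sort L S \<Gamma> (Fun f ts) = Some s \<Longrightarrow> f \<in> funs L \<and> (\<forall>t\<in>set ts. \<exists>s'. tm_sort L S \<Gamma> t = Some s')"
proof -
  assume "tm_sort L S \<Gamma> (Fun f ts) = Some s"
  then have m: "map (tm_sort L S \<Gamma>) ts = map Some (fun_args L f)" "f \<in> funs L"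
    by (auto split: if_splits)
  have "\<exists>s'. tm_sort L S \<Gamma> t = Some s'" if "t \<in> set ts" for t
  proof -
    from that have "tm_sort L S \<Gamma> t \<in> set (map Some (fun_args L f))"
      unfolding m(1)[symmetric] by auto
    then show ?thesis by auto
  qed
  with m show ?thesis by blast
qed

lemma fm_wf_args:
  "fm_wf L S \<Gamma> (Rel r ts) \<Longrightarrow> r \<in> rels L \<and> (\<forall>t\<in>set ts. \<exists>s'. tm_sort L S \<Gamma> t = Some s')"
proof -
  assume "fm_wf L S \<Gamma> (Rel r ts)"
  then have m: "map (tm_sort L S \<Gamma>) ts = map Some (rel_args L r)" "r \<in> rels L"
    by auto
  have "\<exists>s'. tm_sort L S \<Gamma> t = Some s'" if "t \<in> set ts" for t
  proof -
    from that have "tm_sort L S \<Gamma> t \<in> set (map Some (rel_args L r))"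
      unfolding m(1)[symmetric] by auto
    then show ?thesis by auto
  qed
  with m show ?thesis by blast
qed

lemma tm_sort_dom: "tm_sort L S \<Gamma> t = Some s \<Longrightarrow> set_tm t \<subseteq> dom S"
proof (induction t arbitrary: s)
  case (Fun f ts)
  then have m: "map (tm_sort L S \<Gamma>) ts = map Some (fun_args L f)"
    by (auto split: if_splits)
  have "set_tm t \<subseteq> dom S" if "t \<in> set ts" for t
  proof -
    from that tm_sort_args[OF Fun.prems(1)] obtain s' where "tm_sort L S \<Gamma> t = Some s'" by blast
    with Fun.IH that show ?thesis by blast
  qed
  then show ?case by auto
qed auto

lemma fm_wf_dom: "fm_wf L S \<Gamma> \<phi> \<Longrightarrow> set_fm \<phi> \<subseteq> dom S"
proof (induction \<phi> arbitrary: \<Gamma>)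
  case (Eq t u)
  then obtain s where "tm_sort L S \<Gamma> t = Some s" "tm_sort L S \<Gamma> u = Some s" by auto
  from this[THEN tm_sort_dom] show ?case by auto
next
  case (Rel r ts)
  then have m: "map (tm_sort L S \<Gamma>) ts = map Some (rel_args L r)" by auto
  have "set_tm t \<subseteq> dom S" if "t \<in> set ts" for t
  proof -
    from that fm_wf_args[OF Rel.prems(1)] obtain s' where "tm_sort L S \<Gamma> t = Some s'" by blast
    then show ?thesis by (rule tm_sort_dom)
  qed
  then show ?case by auto
next
  case (Conj \<phi> \<psi>)
  then have "fm_wf L S \<Gamma> \<phi>" "fm_wf L S \<Gamma> \<psi>" by auto
  with Conj.IH show ?case by auto
qed auto

lemma finite_set_fm: "finite (set_fm \<phi>)"
  by (induction \<phi>) auto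

lemma formulas_map: "map_fm g \<phi> \<in> formulas L S \<longleftrightarrow> \<phi> \<in> formulas L (S \<circ> g)"
  by (simp add: formulas_def fm_wf_map)

lemma formulas_cong:
  "\<phi> \<in> formulas L S \<Longrightarrow> (\<And>x. x \<in> set_fm \<phi> \<Longrightarrow> S x = S' x) \<Longrightarrow> \<phi> \<in> formulas L S'"
  using fm_wf_cong[of \<phi> S S'] by (auto simp: formulas_def)

lemma formulas_dom: "\<phi> \<in> formulas L S \<Longrightarrow> set_fm \<phi> \<subseteq> dom S"
  by (auto simp: formulas_def dest!: fm_wf_dom)

lemma formulas_map_le:
  "\<phi> \<in> formulas L S \<Longrightarrow> S \<subseteq>\<^sub>m S' \<Longrightarrow> \<phi> \<in> formulas L S'"
  unfolding map_le_def by (rule formulas_cong, assumption) (metis formulas_dom subsetD)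

lemma formulas_restrict_iff: "\<phi> \<in> formulas L (S |` A) \<longleftrightarrow> \<phi> \<in> formulas L S \<and> set_fm \<phi> \<subseteq> A"
proof
  assume *: "\<phi> \<in> formulas L (S |` A)"
  with formulas_dom[OF *] formulas_map_le[OF *, of S] show "\<phi> \<in> formulas L S \<and> set_fm \<phi> \<subseteq> A"
    by (auto simp: map_le_def)
next
  assume *: "\<phi> \<in> formulas L S \<and> set_fm \<phi> \<subseteq> A"
  then show "\<phi> \<in> formulas L (S |` A)"
    by (auto intro!: formulas_cong[of \<phi> L S])
qed

lemma Neg_formulas [simp]: "Neg \<phi> \<in> formulas L S \<longleftrightarrow> \<phi> \<in> formulas L S"
  by (simp add: formulas_def)

lemma Conj_formulas [simp]: "Conj \<phi> \<psi> \<in> formulas L S \<longleftrightarrow> \<phi> \<in> formulas L S \<and> \<psi> \<in> formulas L S"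
  by (simp add: formulas_def)

text \<open>Binding the free name \<open>x\<close> by the de Bruijn index \<open>k\<close>, one level outside the current scope.\<close>

primrec bind_tm :: "nat \<Rightarrow> 'v \<Rightarrow> ('f, 'v) tm \<Rightarrow> ('f, 'v) tm" where
  "bind_tm k x (Free y) = (if y = x then Bnd k else Free y)"
| "bind_tm k x (Bnd n) = Bnd n"
| "bind_tm k x (Fun f ts) = Fun f (map (bind_tm k x) ts)"

primrec bind_fm :: "nat \<Rightarrow> 'v \<Rightarrow> ('f, 'r, 's, 'v) fm \<Rightarrow> ('f, 'r, 's, 'v) fm" where
  "bind_fm k x (Eq t u) = Eq (bind_tm k x t) (bind_tm k x u)"
| "bind_fm k x (Rel r ts) = Rel r (map (bind_tm k x) ts)"
| "bind_fm k x (Neg \<phi>) = Neg (bind_fm k x \<phi>)"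
| "bind_fm k x (Conj \<phi> \<psi>) = Conj (bind_fm k x \<phi>) (bind_fm k x \<psi>)"
| "bind_fm k x (Ex s \<phi>) = Ex s (bind_fm (Suc k) x \<phi>)"

lemma set_bind_tm: "set_tm (bind_tm k x t) = set_tm t - {x}"
  by (induction t) auto

lemma set_bind_fm: "set_fm (bind_fm k x \<phi>) = set_fm \<phi> - {x}"
  by (induction \<phi> arbitrary: k) (auto simp: set_bind_tm)

text \<open>The new value is appended at the far end of the environment, so quantifiers met on the
  way, which push values at the front, do not disturb it. Well-sortedness keeps the old indices
  below \<open>length e\<close>, so only the new index reads the appended value.\<close>

lemma tm_val_bind:
  "tm_sort L S \<Gamma> t = Some s \<Longrightarrow> length \<Gamma> = length e \<Longrightarrow>
    tm_val M v (e @ [a]) (bind_tm (length e) x t) = tm_val M (v(x := a)) e t"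
proof (induction t arbitrary: s)
  case (Fun f ts)
  then have m: "map (tm_sort L S \<Gamma>) ts = map Some (fun_args L f)"
    by (auto split: if_splits)
  have "tm_val M v (e @ [a]) (bind_tm (length e) x t) = tm_val M (v(x := a)) e t" if "t \<in> set ts" for t
  proof -
    from that tm_sort_args[OF Fun.prems(1)] obtain s' where "tm_sort L S \<Gamma> t = Some s'" by blast
    with Fun that show ?thesis by blast
  qed
  then have "map (tm_val M v (e @ [a])) (map (bind_tm (length e) x) ts) = map (tm_val M (v(x := a)) e) ts"
    by (simp add: o_def del: fun_upd_apply)
  then show ?case by (simp del: map_map fun_upd_apply)
qed (auto simp: nth_append split: if_splits)

lemma sat_bind:
  "fm_wf L S \<Gamma> \<phi> \<Longrightarrow> length \<Gamma> = length e \<Longrightarrow>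
    sat M v (e @ [a]) (bind_fm (length e) x \<phi>) \<longleftrightarrow> sat M (v(x := a)) e \<phi>"
proof (induction \<phi> arbitrary: \<Gamma> e)
  case (Eq t u)
  then obtain s where "tm_sort L S \<Gamma> t = Some s" "tm_sort L S \<Gamma> u = Some s" by auto
  from this[THEN tm_val_bind[OF _ Eq.prems(2)]] show ?case unfolding bind_fm.simps sat.simps by metis
next
  case (Rel r ts)
  then have m: "map (tm_sort L S \<Gamma>) ts = map Some (rel_args L r)" by auto
  have "tm_val M v (e @ [a]) (bind_tm (length e) x t) = tm_val M (v(x := a)) e t" if "t \<in> set ts" for t
  proof -
    from that fm_wf_args[OF Rel.prems(1)] obtain s' where "tm_sort L S \<Gamma> t = Some s'" by blast
    then show ?thesis using Rel.prems(2) by (rule tm_val_bind)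
  qed
  then have "map (tm_val M v (e @ [a])) (map (bind_tm (length e) x) ts) = map (tm_val M (v(x := a)) e) ts"
    by (simp add: o_def del: fun_upd_apply)
  then show ?case by (simp del: map_map fun_upd_apply)
next
  case (Ex s \<phi>)
  have "sat M v ((b # e) @ [a]) (bind_fm (length (b # e)) x \<phi>) \<longleftrightarrow> sat M (v(x := a)) (b # e) \<phi>" for b
    using Ex by (intro Ex.IH[of "s # \<Gamma>"]) auto
  then show ?case unfolding bind_fm.simps sat.simps append_Cons length_Cons by blast
qed auto

lemma tm_sort_bind:
  assumes "\<forall>y. y \<noteq> x \<longrightarrow> S' y = S y" "S x = Some s"
  shows "tm_sort L S \<Gamma> t = Some s' \<Longrightarrow>
    tm_sort L S' (\<Gamma> @ [s]) (bind_tm (length \<Gamma>) x t) = Some s'"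
proof (induction t arbitrary: s')
  case (Fun f ts)
  then have m: "map (tm_sort L S \<Gamma>) ts = map Some (fun_args L f)" "f \<in> funs L" "s' = fun_res L f"
    by (auto split: if_splits)
  have "tm_sort L S' (\<Gamma> @ [s]) (bind_tm (length \<Gamma>) x t) = tm_sort L S \<Gamma> t" if "t \<in> set ts" for t
  proof -
    from that tm_sort_args[OF Fun.prems(1)] obtain s' where "tm_sort L S \<Gamma> t = Some s'" by blast
    with Fun that show ?thesis by metis
  qed
  then have "map (tm_sort L S' (\<Gamma> @ [s])) (map (bind_tm (length \<Gamma>) x) ts) = map Some (fun_args L f)"
    unfolding m(1)[symmetric] by auto
  with m show ?case by (simp del: map_map)
qed (use assms in \<open>auto simp: nth_append split: if_splits\<close>)

lemma fm_wf_bind: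
  assumes "\<forall>y. y \<noteq> x \<longrightarrow> S' y = S y" "S x = Some s"
  shows "fm_wf L S \<Gamma> \<phi> \<Longrightarrow> fm_wf L S' (\<Gamma> @ [s]) (bind_fm (length \<Gamma>) x \<phi>)"
proof (induction \<phi> arbitrary: \<Gamma>)
  case (Eq t u)
  then show ?case using tm_sort_bind[OF assms(1,2)] by fastforce
next
  case (Rel r ts)
  then have m: "map (tm_sort L S \<Gamma>) ts = map Some (rel_args L r)" "r \<in> rels L" by auto
  have "tm_sort L S' (\<Gamma> @ [s]) (bind_tm (length \<Gamma>) x t) = tm_sort L S \<Gamma> t" if "t \<in> set ts" for t
  proof -
    from that fm_wf_args[OF Rel.prems(1)] obtain s' where "tm_sort L S \<Gamma> t = Some s'" by blast
    with tm_sort_bind[OF assms(1,2) this] show ?thesis by simp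
  qed
  then have "map (tm_sort L S' (\<Gamma> @ [s])) (map (bind_tm (length \<Gamma>) x) ts) = map Some (rel_args L r)"
    unfolding m(1)[symmetric] by auto
  with m show ?case by (simp del: map_map)
next
  case (Ex s' \<phi>)
  then show ?case using Ex.IH[of "s' # \<Gamma>"] by simp
qed auto

lemma Ex_bind_formulas:
  "\<phi> \<in> formulas L S \<Longrightarrow> S x = Some s \<Longrightarrow> \<forall>y. y \<noteq> x \<longrightarrow> S' y = S y \<Longrightarrow>
    Ex s (bind_fm 0 x \<phi>) \<in> formulas L S'"
  using fm_wf_bind[of x S' S s L "[]" \<phi>] by (simp add: formulas_def)

lemma sat_Ex_bind:
  "\<phi> \<in> formulas L S \<Longrightarrow>
    sat M v [] (Ex s (bind_fm 0 x \<phi>)) \<longleftrightarrow> (\<exists>a. sort_of M a = Some s \<and> sat M (v(x := a)) [] \<phi>)"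
  using sat_bind[of L S "[]" \<phi> "[]" M v _ x] by (simp add: formulas_def)

section \<open>Named families with the same type\<close>

text \<open>Both families are indexed by one set of names, so that formulas of a single language
  speak about tuples in two structures, repetitions included. Partial elementary maps are the case
  in which the names are elements of the first structure.\<close>

definition same_type ::
  "('f, 'r, 's) lang \<Rightarrow> ('v \<rightharpoonup> 's) \<Rightarrow> ('f, 'r, 's, 'a) struct \<Rightarrow> ('v \<Rightarrow> 'a)
     \<Rightarrow> ('f, 'r, 's, 'b) struct \<Rightarrow> ('v \<Rightarrow> 'b) \<Rightarrow> bool" where
  "same_type L S M v N w \<longleftrightarrow> v \<in> assigns M S \<and> w \<in> assigns N S \<and>
     (\<forall>\<phi>\<in>formulas L S. sat M v [] \<phi> \<longleftrightarrow> sat N w [] \<phi>)"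

lemma same_type_sym: "same_type L S M v N w \<Longrightarrow> same_type L S N w M v"
  by (simp add: same_type_def)

lemma same_type_trans:
  "same_type L S M v N w \<Longrightarrow> same_type L S N w K u \<Longrightarrow> same_type L S M v K u"
  by (simp add: same_type_def)

lemma same_type_refl: "v \<in> assigns M S \<Longrightarrow> same_type L S M v M v"
  by (simp add: same_type_def)

lemma same_type_sat: "same_type L S M v N w \<Longrightarrow> \<phi> \<in> formulas L S \<Longrightarrow> sat M v [] \<phi> \<longleftrightarrow> sat N w [] \<phi>"
  by (simp add: same_type_def)

lemma assigns_map_le: "v \<in> assigns M S \<Longrightarrow> S' \<subseteq>\<^sub>m S \<Longrightarrow> v \<in> assigns M S'"
  unfolding assigns_def map_le_def by (fastforce simp: dom_def)

lemma same_type_map_le: "same_type L S M v N w \<Longrightarrow> S' \<subseteq>\<^sub>m S \<Longrightarrow> same_type L S' M v N w"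
  unfolding same_type_def by (blast intro: assigns_map_le formulas_map_le)

lemma assigns_comp: "v \<in> assigns M S \<Longrightarrow> S' \<subseteq>\<^sub>m S \<circ> j \<Longrightarrow> v \<circ> j \<in> assigns M S'"
  unfolding assigns_def map_le_def by (fastforce simp: dom_def)

text \<open>Substituting names in formulas: the type of a family determines the type of every family
  enumerated from it by \<open>j\<close>. Since only \<open>S'\<close> has to be respected,
  \<open>j\<close> may take junk values outside \<open>dom S'\<close>.\<close>

lemma same_type_comp:
  assumes "same_type L S M v N w" "S' \<subseteq>\<^sub>m S \<circ> j"
  shows "same_type L S' M (v \<circ> j) N (w \<circ> j)"
  unfolding same_type_def
proof (intro conjI ballI)
  fix \<phi> assume "\<phi> \<in> formulas L S'"
  then have "map_fm j \<phi> \<in> formulas L S"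
    by (simp add: formulas_map formulas_map_le[OF _ assms(2)])
  with assms(1) have "sat M v [] (map_fm j \<phi>) \<longleftrightarrow> sat N w [] (map_fm j \<phi>)"
    by (rule same_type_sat)
  then show "sat M (v \<circ> j) [] \<phi> \<longleftrightarrow> sat N (w \<circ> j) [] \<phi>" by (simp add: sat_map)
qed (use assms assigns_comp in \<open>auto simp: same_type_def\<close>)

lemma assigns_cong: "v \<in> assigns M S \<Longrightarrow> (\<And>x. x \<in> dom S \<Longrightarrow> v x = v' x) \<Longrightarrow> v' \<in> assigns M S"
  by (auto simp: assigns_def)

lemma sat_formulas_cong:
  "\<phi> \<in> formulas L S \<Longrightarrow> (\<And>x. x \<in> dom S \<Longrightarrow> v x = w x) \<Longrightarrow> sat M v e \<phi> \<longleftrightarrow> sat M w e \<phi>"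
  using formulas_dom by (intro sat_cong) blast

lemma same_type_cong:
  assumes "same_type L S M v N w" "\<And>x. x \<in> dom S \<Longrightarrow> v x = v' x" "\<And>x. x \<in> dom S \<Longrightarrow> w x = w' x"
  shows "same_type L S M v' N w'"
  unfolding same_type_def
proof (intro conjI ballI)
  fix \<phi> assume "\<phi> \<in> formulas L S"
  then show "sat M v' [] \<phi> \<longleftrightarrow> sat N w' [] \<phi>"
    using assms sat_formulas_cong[of \<phi> L S v v'] sat_formulas_cong[of \<phi> L S w w']
    by (auto simp: same_type_def)
qed (use assms assigns_cong in \<open>unfold same_type_def, blast+\<close>)

section \<open>Automorphisms\<close>

lemma tm_sort_val:
  assumes "is_struct L M" "v \<in> assigns M S"
  shows "tm_sort L S \<Gamma> t = Some s \<Longrightarrow> map (sort_of M) e = map Some \<Gamma> \<Longrightarrow>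
    sort_of M (tm_val M v e t) = Some s"
proof (induction t arbitrary: s)
  case (Free x) then show ?case using assms(2) by (force simp: assigns_def)
next
  case (Bnd n)
  then have "length e = length \<Gamma>" by (metis length_map)
  with Bnd show ?case by (auto split: if_splits) (metis nth_map)
next
  case (Fun f ts)
  then have m: "map (tm_sort L S \<Gamma>) ts = map Some (fun_args L f)" "f \<in> funs L" "s = fun_res L f"
    by (auto split: if_splits)
  have "sort_of M (tm_val M v e t) = tm_sort L S \<Gamma> t" if "t \<in> set ts" for t
  proof -
    from that tm_sort_args[OF Fun.prems(1)] obtain s' where "tm_sort L S \<Gamma> t = Some s'" by blast
    with Fun that show ?thesis by metis
  qed
  then have "map (sort_of M) (map (tm_val M v e) ts) = map Some (fun_args L f)"
    unfolding m(1)[symmetric] by auto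
  with m assms(1) show ?case by (simp add: is_struct_def del: map_map)
qed

lemma aut_sort_eq: "\<sigma> \<in> automorphisms L M \<Longrightarrow> a \<in> univ M \<Longrightarrow> sort_of M (\<sigma> a) = sort_of M a"
  by (simp add: automorphisms_def)

lemma aut_sort: "\<sigma> \<in> automorphisms L M \<Longrightarrow> sort_of M a = Some s \<Longrightarrow> sort_of M (\<sigma> a) = Some s"
  using aut_sort_eq[of \<sigma> L M a] by (simp add: domI)

lemma aut_bij: "\<sigma> \<in> automorphisms L M \<Longrightarrow> bij_betw \<sigma> (univ M) (univ M)"
  by (simp add: automorphisms_def)

lemma aut_surj:
  assumes "\<sigma> \<in> automorphisms L M" "sort_of M b = Some s"
  shows "\<exists>a. sort_of M a = Some s \<and> \<sigma> a = b"
proof -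
  have "b \<in> \<sigma> ` univ M" using aut_bij[OF assms(1)] assms(2) by (metis bij_betw_imp_surj_on domI)
  then obtain a where "a \<in> univ M" "b = \<sigma> a" by (rule imageE)
  with aut_sort_eq[OF assms(1)] assms(2) show ?thesis by metis
qed

lemma aut_fun_int:
  "\<sigma> \<in> automorphisms L M \<Longrightarrow> f \<in> funs L \<Longrightarrow> map (sort_of M) as = map Some (fun_args L f) \<Longrightarrow>
    \<sigma> (fun_int M f as) = fun_int M f (map \<sigma> as)"
  unfolding automorphisms_def mem_Collect_eq by (elim conjE) simp

lemma aut_rel_int:
  "\<sigma> \<in> automorphisms L M \<Longrightarrow> r \<in> rels L \<Longrightarrow> map (sort_of M) as = map Some (rel_args L r) \<Longrightarrow>
    rel_int M r (map \<sigma> as) = rel_int M r as"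
  unfolding automorphisms_def mem_Collect_eq by (elim conjE) simp

lemma tm_val_aut:
  assumes "is_struct L M" "v \<in> assigns M S" "\<sigma> \<in> automorphisms L M"
  shows "tm_sort L S \<Gamma> t = Some s \<Longrightarrow> map (sort_of M) e = map Some \<Gamma> \<Longrightarrow>
    tm_val M (\<sigma> \<circ> v) (map \<sigma> e) t = \<sigma> (tm_val M v e t)"
proof (induction t arbitrary: s)
  case (Bnd n)
  then have "length e = length \<Gamma>" by (metis length_map)
  with Bnd show ?case by (auto split: if_splits)
next
  case (Fun f ts)
  then have m: "map (tm_sort L S \<Gamma>) ts = map Some (fun_args L f)" "f \<in> funs L" "s = fun_res L f"
    by (auto split: if_splits)
  have *: "sort_of M (tm_val M v e t) = tm_sort L S \<Gamma> t \<and>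
     tm_val M (\<sigma> \<circ> v) (map \<sigma> e) t = \<sigma> (tm_val M v e t)" if "t \<in> set ts" for t
  proof -
    from that tm_sort_args[OF Fun.prems(1)] obtain s' where "tm_sort L S \<Gamma> t = Some s'" by blast
    with Fun that tm_sort_val[OF assms(1,2)] show ?thesis by metis
  qed
  then have 1: "map (sort_of M) (map (tm_val M v e) ts) = map Some (fun_args L f)"
    unfolding m(1)[symmetric] by auto
  have 2: "map (tm_val M (\<sigma> \<circ> v) (map \<sigma> e)) ts = map \<sigma> (map (tm_val M v e) ts)"
    using * by auto
  have "tm_val M (\<sigma> \<circ> v) (map \<sigma> e) (Fun f ts) = fun_int M f (map \<sigma> (map (tm_val M v e) ts))"
    unfolding 2[symmetric] by simp
  also have "\<dots> = \<sigma> (fun_int M f (map (tm_val M v e) ts))"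
    using aut_fun_int[OF assms(3) m(2) 1] by simp
  also have "\<dots> = \<sigma> (tm_val M v e (Fun f ts))" by simp
  finally show ?case .
qed auto

lemma sat_aut:
  assumes "is_struct L M" "v \<in> assigns M S" "\<sigma> \<in> automorphisms L M"
  shows "fm_wf L S \<Gamma> \<phi> \<Longrightarrow> map (sort_of M) e = map Some \<Gamma> \<Longrightarrow>
    sat M (\<sigma> \<circ> v) (map \<sigma> e) \<phi> \<longleftrightarrow> sat M v e \<phi>"
proof (induction \<phi> arbitrary: \<Gamma> e)
  case (Eq t u)
  then obtain s where s: "tm_sort L S \<Gamma> t = Some s" "tm_sort L S \<Gamma> u = Some s" by auto
  have u: "tm_val M v e t \<in> univ M" "tm_val M v e u \<in> univ M"
    using tm_sort_val[OF assms(1,2) _ Eq.prems(2)] s by blast+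
  have "inj_on \<sigma> (univ M)" using aut_bij[OF assms(3)] by (rule bij_betw_imp_inj_on)
  then show ?case using s[THEN tm_val_aut[OF assms _ Eq.prems(2)]] u unfolding sat.simps by (metis inj_on_eq_iff)
next
  case (Rel r ts)
  then have m: "map (tm_sort L S \<Gamma>) ts = map Some (rel_args L r)" "r \<in> rels L" by auto
  have *: "sort_of M (tm_val M v e t) = tm_sort L S \<Gamma> t \<and>
     tm_val M (\<sigma> \<circ> v) (map \<sigma> e) t = \<sigma> (tm_val M v e t)" if "t \<in> set ts" for t
  proof -
    from that fm_wf_args[OF Rel.prems(1)] obtain s' where "tm_sort L S \<Gamma> t = Some s'" by blast
    with Rel tm_sort_val[OF assms(1,2)] tm_val_aut[OF assms] show ?thesis by metis
  qed
  then have 1: "map (sort_of M) (map (tm_val M v e) ts) = map Some (rel_args L r)"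
    unfolding m(1)[symmetric] by auto
  have 2: "map (tm_val M (\<sigma> \<circ> v) (map \<sigma> e)) ts = map \<sigma> (map (tm_val M v e) ts)"
    using * by auto
  have "rel_int M r (map \<sigma> (map (tm_val M v e) ts)) = rel_int M r (map (tm_val M v e) ts)"
    by (rule aut_rel_int[OF assms(3) m(2) 1])
  then show ?case unfolding sat.simps 2 .
next
  case (Ex s \<phi>)
  have *: "sat M (\<sigma> \<circ> v) (\<sigma> b # map \<sigma> e) \<phi> \<longleftrightarrow> sat M v (b # e) \<phi>" if "sort_of M b = Some s" for b
  proof -
    have "sat M (\<sigma> \<circ> v) (map \<sigma> (b # e)) \<phi> \<longleftrightarrow> sat M v (b # e) \<phi>"
      by (rule Ex.IH[of "s # \<Gamma>"]) (use Ex.prems that in auto)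
    then show ?thesis unfolding list.map .
  qed
  show ?case
  proof
    assume "sat M (\<sigma> \<circ> v) (map \<sigma> e) (Ex s \<phi>)"
    then obtain c where c: "sort_of M c = Some s" "sat M (\<sigma> \<circ> v) (c # map \<sigma> e) \<phi>" by auto
    with aut_surj[OF assms(3) c(1)] * show "sat M v e (Ex s \<phi>)" by auto
  next
    assume "sat M v e (Ex s \<phi>)"
    with * aut_sort[OF assms(3)] show "sat M (\<sigma> \<circ> v) (map \<sigma> e) (Ex s \<phi>)" by auto
  qed
qed auto

lemma same_type_aut:
  assumes "is_struct L M" "v \<in> assigns M S" "\<sigma> \<in> automorphisms L M"
  shows "same_type L S M v M (\<sigma> \<circ> v)"
  unfolding same_type_def
proof (intro conjI ballI)
  show "\<sigma> \<circ> v \<in> assigns M S"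
    using assms(2) aut_sort[OF assms(3)] unfolding assigns_def by (fastforce simp: dom_def)
  fix \<phi> assume "\<phi> \<in> formulas L S"
  then show "sat M v [] \<phi> \<longleftrightarrow> sat M (\<sigma> \<circ> v) [] \<phi>"
    using sat_aut[OF assms, of "[]" \<phi> "[]"] by (simp add: formulas_def)
qed fact

lemma aut_comp:
  assumes "\<sigma> \<in> automorphisms L M" "\<tau> \<in> automorphisms L M"
  shows "\<sigma> \<circ> \<tau> \<in> automorphisms L M"
proof -
  have s: "map (sort_of M) (map \<tau> as) = map Some ss" if "map (sort_of M) as = map Some ss" for as ss
    using that aut_sort[OF assms(2)]
    by (induction as arbitrary: ss) (auto simp: Cons_eq_map_conv)
  have b: "bij_betw (\<sigma> \<circ> \<tau>) (univ M) (univ M)"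
    using assms[THEN aut_bij] bij_betw_trans by blast
  note f = aut_fun_int and r = aut_rel_int and o = aut_sort_eq
  have u: "\<tau> a \<in> univ M" if "a \<in> univ M" for a
    using that aut_sort[OF assms(2)] by blast
  show ?thesis
    unfolding automorphisms_def mem_Collect_eq
  proof (intro conjI ballI allI impI)
    fix f as assume *: "f \<in> funs L" "map (sort_of M) as = map Some (fun_args L f)"
    have "(\<sigma> \<circ> \<tau>) (fun_int M f as) = fun_int M f (map \<sigma> (map \<tau> as))"
      using f[OF assms(2) *] f[OF assms(1) *(1) s[OF *(2)]] by (simp del: map_map)
    then show "(\<sigma> \<circ> \<tau>) (fun_int M f as) = fun_int M f (map (\<sigma> \<circ> \<tau>) as)" by simp
  next
    fix f as assume *: "f \<in> rels L" "map (sort_of M) as = map Some (rel_args L f)"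
    have "rel_int M f (map \<sigma> (map \<tau> as)) = rel_int M f as"
      using r[OF assms(2) *] r[OF assms(1) *(1) s[OF *(2)]] by (simp del: map_map)
    then show "rel_int M f (map (\<sigma> \<circ> \<tau>) as) = rel_int M f as" by simp
  qed (use b o[OF assms(1)] o[OF assms(2)] u in auto)
qed

lemma aut_inv:
  assumes "is_struct L M" "\<sigma> \<in> automorphisms L M"
  shows "inv_into (univ M) \<sigma> \<in> automorphisms L M"
proof -
  let ?i = "inv_into (univ M) \<sigma>"
  note b = aut_bij[OF assms(2)]
  have i1: "\<sigma> (?i a) = a" "?i a \<in> univ M" if "a \<in> univ M" for a
    using that b bij_betw_inv_into_right bij_betwE[OF bij_betw_inv_into] by metis+
  have i2: "?i (\<sigma> a) = a" if "a \<in> univ M" for a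
    using that b bij_betw_inv_into_left by metis
  note o = aut_sort_eq[OF assms(2)]
  have so: "sort_of M (?i a) = sort_of M a" if "a \<in> univ M" for a
    using o[of "?i a"] i1[OF that] by simp
  have u: "set as \<subseteq> univ M" if "map (sort_of M) as = map Some ss" for as ss
    using that by (induction as arbitrary: ss) (auto simp: Cons_eq_map_conv)
  have s: "map (sort_of M) (map ?i as) = map Some ss" if "map (sort_of M) as = map Some ss" for as ss
  proof -
    have "map (sort_of M) (map ?i as) = map (sort_of M) as"
      using u[OF that] so by (simp add: subset_eq)
    with that show ?thesis by metis
  qed
  have m: "map \<sigma> (map ?i as) = as" if "map (sort_of M) as = map Some ss" for as ss
    using u[OF that] i1 by (simp add: map_idI subset_eq)
  show ?thesis
    unfolding automorphisms_def mem_Collect_eq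
  proof (intro conjI ballI allI impI)
    show "bij_betw ?i (univ M) (univ M)" using b by (rule bij_betw_inv_into)
    fix f as assume *: "f \<in> funs L" "map (sort_of M) as = map Some (fun_args L f)"
    have "\<sigma> (fun_int M f (map ?i as)) = fun_int M f (map \<sigma> (map ?i as))"
      by (rule aut_fun_int[OF assms(2) *(1) s[OF *(2)]])
    then have "\<sigma> (fun_int M f (map ?i as)) = fun_int M f as" unfolding m[OF *(2)] .
    moreover have "fun_int M f (map ?i as) \<in> univ M"
      using assms(1) * s[OF *(2)] unfolding is_struct_def by blast
    ultimately show "?i (fun_int M f as) = fun_int M f (map ?i as)" using i2 by metis
  next
    fix f as assume *: "f \<in> rels L" "map (sort_of M) as = map Some (rel_args L f)"
    have "rel_int M f (map \<sigma> (map ?i as)) = rel_int M f (map ?i as)"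
      by (rule aut_rel_int[OF assms(2) *(1) s[OF *(2)]])
    then show "rel_int M f (map ?i as) = rel_int M f as" unfolding m[OF *(2)] by simp
  qed (use so in auto)
qed

lemma id_aut: "id \<in> automorphisms L M"
  by (simp add: automorphisms_def)

section \<open>Ultrafilters\<close>

definition ultrafilter :: "'x filter \<Rightarrow> bool" where
  "ultrafilter U \<longleftrightarrow> U \<noteq> bot \<and> (\<forall>P. eventually P U \<or> eventually (\<lambda>x. \<not> P x) U)"

lemma ultrafilter_Not: "ultrafilter U \<Longrightarrow> eventually (\<lambda>x. \<not> P x) U \<longleftrightarrow> \<not> eventually P U"
proof -
  assume U: "ultrafilter U"
  have "\<not> (eventually P U \<and> eventually (\<lambda>x. \<not> P x) U)"
  proof
    assume "eventually P U \<and> eventually (\<lambda>x. \<not> P x) U"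
    then have "eventually (\<lambda>x. P x \<and> \<not> P x) U" by (intro eventually_conj) auto
    with U show False by (simp add: ultrafilter_def trivial_limit_def)
  qed
  with U show ?thesis by (auto simp: ultrafilter_def)
qed

text \<open>Zorn for proper filters below \<open>F\<close>, ordered downwards. A minimal one decides
  \<open>P\<close>, because its infimum with the principal filter of \<open>P\<close> is either
  improper or the filter itself.\<close>

lemma ultrafilter_ex:
  fixes F :: "'x filter"
  assumes "F \<noteq> bot"
  shows "\<exists>U\<le>F. ultrafilter U"
proof -
  let ?A = "{G. G \<noteq> bot \<and> G \<le> F}"
  let ?P = "\<lambda>G H :: 'x filter. H \<le> G"
  have "\<exists>m\<in>?A. \<forall>a\<in>?A. ?P m a \<longrightarrow> a = m"
  proof (rule predicate_Zorn)
    show "partial_order_on ?A (relation_of ?P ?A)"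
      by (rule partial_order_on_relation_ofI) auto
    fix C assume C: "C \<in> Chains (relation_of ?P ?A)"
    show "\<exists>u\<in>?A. \<forall>a\<in>C. ?P a u"
    proof (cases "C = {}")
      case True then show ?thesis using assms by auto
    next
      case False
      have lin: "G \<le> H \<or> H \<le> G" if "G \<in> C" "H \<in> C" for G H
        using C that unfolding Chains_def relation_of_def by auto
      have in_A: "G \<in> ?A" if "G \<in> C" for G
        using C that unfolding Chains_def relation_of_def by auto
      have ev: "eventually P (Inf C) \<longleftrightarrow> (\<exists>b\<in>C. eventually P b)" for P
        using False lin by (intro eventually_Inf_base) (metis inf.absorb1 inf.absorb2 order_refl)+
      have "Inf C \<noteq> bot"
        using in_A ev[of "\<lambda>_. False"] by (auto simp: trivial_limit_def)
      moreover obtain G where "G \<in> C" using False by auto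
      then have "Inf C \<le> F" using in_A[of G] by (auto intro: Inf_lower2)
      ultimately show ?thesis by (auto intro: Inf_lower)
    qed
  qed
  then obtain U where U0: "U \<in> ?A" "\<forall>a\<in>?A. a \<le> U \<longrightarrow> a = U" by blast
  then have U: "U \<noteq> bot" "U \<le> F" by auto
  have Umin: "G = U" if "G \<noteq> bot" "G \<le> U" for G
    using that U0 U(2) by (auto dest: order.trans)
  have "eventually P U \<or> eventually (\<lambda>x. \<not> P x) U" for P
  proof (cases "inf U (principal {x. P x}) = bot")
    case True
    then show ?thesis
      by (auto simp: trivial_limit_def eventually_inf_principal)
  next
    case False
    then have *: "inf U (principal {x. P x}) = U" by (intro Umin) auto
    have "eventually P (inf U (principal {x. P x}))" by (simp add: eventually_inf_principal)
    then have "eventually P U" unfolding * .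
    then show ?thesis ..
  qed
  with U show ?thesis by (auto simp: ultrafilter_def)
qed

lemma ultrafilter_of_fip:
  assumes "\<And>\<F>'. finite \<F>' \<Longrightarrow> \<F>' \<subseteq> \<F> \<Longrightarrow> \<Inter>\<F>' \<noteq> {}"
  shows "\<exists>U. ultrafilter U \<and> (\<forall>A\<in>\<F>. eventually (\<lambda>x. x \<in> A) U)"
proof -
  let ?F = "Inf (principal ` \<F>)"
  have "?F \<noteq> bot"
  proof (rule Inf_filter_not_bot)
    fix X assume "X \<subseteq> principal ` \<F>" "finite X"
    then obtain \<F>' where F: "finite \<F>'" "\<F>' \<subseteq> \<F>" "X = principal ` \<F>'"
      by (meson finite_subset_image)
    have "Inf X = principal (\<Inter>\<F>')"
      using INF_principal_finite[OF F(1), of "\<lambda>x. x"] F by simp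
    with assms[OF F(1,2)] show "Inf X \<noteq> bot" by (simp add: principal_eq_bot_iff)
  qed
  then obtain U where U: "U \<le> ?F" "ultrafilter U" using ultrafilter_ex by blast
  have "eventually (\<lambda>x. x \<in> A) U" if "A \<in> \<F>" for A
  proof -
    have "U \<le> principal A" using U(1) that by (meson Inf_lower imageI order.trans)
    then show ?thesis by (simp add: le_principal)
  qed
  with U show ?thesis by blast
qed

section \<open>Cardinal bounds\<close>

lemma finite_subset_increasing_Union:
  assumes "finite A" "\<And>n. C n \<subseteq> C (Suc n)" "A \<subseteq> (\<Union>n. C n)"
  shows "\<exists>n. A \<subseteq> C n"
  using assms(1,3)
proof induction
  case (insert x A)
  then obtain m n where "A \<subseteq> C m" "x \<in> C n" by blast
  moreover have "C m \<subseteq> C (max m n)" "C n \<subseteq> C (max m n)"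
    using lift_Suc_mono_le[of C, OF assms(2)] by auto
  ultimately show ?case by (intro exI[of _ "max m n"]) blast
qed auto

text \<open>Iterate \<open>X \<union> G X\<close> countably often. The last hypothesis says that
  \<open>G\<close> is finitary, so the union of the stages is closed. Lists, terms, formulas and
  Skolem hulls are all bounded by this one construction.\<close>

lemma closure_exists:
  fixes G :: "'x set \<Rightarrow> 'x set"
  assumes r: "Cinfinite r" and A: "|A| \<le>o r"
    and G: "\<And>C. |C| \<le>o r \<Longrightarrow> |G C| \<le>o r"
    and fin: "\<And>(C :: nat \<Rightarrow> 'x set) y. (\<And>n. C n \<subseteq> C (Suc n)) \<Longrightarrow> y \<in> G (\<Union>n. C n) \<Longrightarrow> \<exists>n. y \<in> G (C n)"
  shows "\<exists>C. A \<subseteq> C \<and> G C \<subseteq> C \<and> |C| \<le>o r"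
proof -
  define C where "C = (\<lambda>n. ((\<lambda>X. X \<union> G X) ^^ n) A)"
  have C0: "C 0 = A" and CS: "C (Suc n) = C n \<union> G (C n)" for n by (auto simp: C_def)
  have card: "|C n| \<le>o r" for n
    by (induction n) (auto simp: C0 CS A G intro!: Un_Cinfinite_bound[OF _ _ r])
  have "|UNIV :: nat set| \<le>o r"
    using r natLeq_ordLeq_cinfinite card_of_nat ordIso_ordLeq_trans by blast
  then have "|\<Union>n. C n| \<le>o r"
    by (rule UNION_Cinfinite_bound) (use card r in auto)
  moreover have "A \<subseteq> (\<Union>n. C n)" using C0 by blast
  moreover have "G (\<Union>n. C n) \<subseteq> (\<Union>n. C n)"
  proof
    fix y assume "y \<in> G (\<Union>n. C n)"
    then obtain n where "y \<in> G (C n)" using fin[of C y] CS by blast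
    then have "y \<in> C (Suc n)" by (simp add: CS)
    then show "y \<in> (\<Union>n. C n)" by blast
  qed
  ultimately show ?thesis by blast
qed

lemma card_image_ordLeq: "|A| \<le>o r \<Longrightarrow> |f ` A| \<le>o r"
  using card_of_image ordLeq_transitive by blast

lemma card_image_ordLess: "|A| <o r \<Longrightarrow> |f ` A| <o r"
  using card_of_image ordLeq_ordLess_trans by blast

lemma card_subset_ordLeq: "|B| \<le>o r \<Longrightarrow> A \<subseteq> B \<Longrightarrow> |A| \<le>o r"
  using card_of_mono1 ordLeq_transitive by blast

lemma card_subset_ordLess: "|B| <o r \<Longrightarrow> A \<subseteq> B \<Longrightarrow> |A| <o r"
  using card_of_mono1 ordLeq_ordLess_trans by blast

lemma Times_Cinfinite_bound: "Cinfinite r \<Longrightarrow> |A| \<le>o r \<Longrightarrow> |B| \<le>o r \<Longrightarrow> |A \<times> B| \<le>o r"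
  by (auto simp: cinfinite_def intro: card_of_Times_ordLeq_infinite_Field)

lemma finite_Cinfinite_bound: "Cinfinite r \<Longrightarrow> finite A \<Longrightarrow> |A| <o r"
  using finite_ordLess_infinite[OF card_of_Well_order, of r A]
  by (auto simp: cinfinite_def card_order_on_def Field_card_of)

lemma lists_Cinfinite_bound:
  fixes A :: "'a set"
  assumes r: "Cinfinite r" and A: "|A| \<le>o r"
  shows "|lists A| \<le>o r"
proof -
  have "\<exists>C. {[]} \<subseteq> C \<and> (\<lambda>X. (\<lambda>(x, xs). x # xs) ` (A \<times> X)) C \<subseteq> C \<and> |C| \<le>o r"
  proof (rule closure_exists[OF r])
    show "|{[]}| \<le>o r"
      by (intro ordLess_imp_ordLeq finite_Cinfinite_bound r) simp
  next
    fix C :: "'a list set" assume "|C| \<le>o r"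
    then show "|(\<lambda>(x, xs). x # xs) ` (A \<times> C)| \<le>o r"
      by (intro card_image_ordLeq Times_Cinfinite_bound r A)
  next
    fix C :: "nat \<Rightarrow> 'a list set" and y
    assume "\<And>n. C n \<subseteq> C (Suc n)" "y \<in> (\<lambda>(x, xs). x # xs) ` (A \<times> \<Union> (range C))"
    then show "\<exists>n. y \<in> (\<lambda>(x, xs). x # xs) ` (A \<times> C n)" by blast
  qed
  then obtain C where C: "[] \<in> C" "\<And>x xs. x \<in> A \<Longrightarrow> xs \<in> C \<Longrightarrow> x # xs \<in> C" "|C| \<le>o r"
    by auto
  have "xs \<in> C" if "xs \<in> lists A" for xs
    using that by induction (auto intro: C)
  then show ?thesis using C(3) card_subset_ordLeq by blast
qed

text \<open>The types of symbols may be larger than \<open>funs L\<close> and \<open>rels L\<close>,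
  so the formulas are enclosed in a set generated from the actual symbols. One \<open>D\<close>
  serves every sorting \<open>S\<close>, as later uses let the sorts of the names vary.\<close>

lemma formulas_Cinfinite_bound:
  fixes L :: "('f, 'r, 's) lang" and V :: "'v set"
  assumes r: "Cinfinite r" "|UNIV :: 's set| \<le>o r" "|funs L| \<le>o r" "|rels L| \<le>o r" and V: "|V| \<le>o r"
  shows "\<exists>D :: ('f, 'r, 's, 'v) fm set. |D| \<le>o r \<and> (\<forall>S. dom S \<subseteq> V \<longrightarrow> formulas L S \<subseteq> D)"
proof -
  note r1 = r(1)
  have nat: "|UNIV :: nat set| \<le>o r"
    using r natLeq_ordLeq_cinfinite card_of_nat ordIso_ordLeq_trans by blast
  have "\<exists>C. (Free ` V \<union> Bnd ` UNIV) \<subseteq> C \<and> (\<lambda>X. (\<lambda>(f, ts). Fun f ts) ` (funs L \<times> lists X)) C \<subseteq> C \<and> |C| \<le>o r"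
  proof (rule closure_exists[OF r1])
    show "|Free ` V \<union> range Bnd :: ('f, 'v) tm set| \<le>o r"
      by (intro Un_Cinfinite_bound card_image_ordLeq nat V r1)
  next
    fix C :: "('f, 'v) tm set" assume "|C| \<le>o r"
    then show "|(\<lambda>(f, ts). Fun f ts) ` (funs L \<times> lists C)| \<le>o r"
      by (intro card_image_ordLeq Times_Cinfinite_bound r lists_Cinfinite_bound)
  next
    fix C :: "nat \<Rightarrow> ('f, 'v) tm set" and y
    assume C: "\<And>n. C n \<subseteq> C (Suc n)" "y \<in> (\<lambda>(f, ts). Fun f ts) ` (funs L \<times> lists (\<Union> (range C)))"
    then obtain f ts where y: "y = Fun f ts" "f \<in> funs L" "set ts \<subseteq> (\<Union>n. C n)" by (auto simp: subset_iff)
    from finite_subset_increasing_Union[of "set ts" C, OF _ C(1) y(3)]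
    obtain n where "set ts \<subseteq> C n" by auto
    with y show "\<exists>n. y \<in> (\<lambda>(f, ts). Fun f ts) ` (funs L \<times> lists (C n))" by (intro exI[of _ n]) auto
  qed
  then obtain Tm where Tm: "Free ` V \<subseteq> Tm" "range Bnd \<subseteq> Tm" "|Tm| \<le>o r"
    "\<And>f ts. f \<in> funs L \<Longrightarrow> set ts \<subseteq> Tm \<Longrightarrow> Fun f ts \<in> Tm"
    by (auto simp: image_subset_iff lists_eq_set)
  have tm: "t \<in> Tm" if "tm_sort L S \<Gamma> t = Some s" "dom S \<subseteq> V" for S \<Gamma> s t
    using that
  proof (induction t arbitrary: s)
    case (Fun f ts)
    from tm_sort_args[OF Fun.prems(1)] Fun show ?case by (intro Tm(4)) blast+
  qed (use Tm in auto)
  let ?A = "(\<lambda>(t, u). Eq t u) ` (Tm \<times> Tm) \<union> (\<lambda>(q, ts). Rel q ts) ` (rels L \<times> lists Tm)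
    :: ('f, 'r, 's, 'v) fm set"
  let ?G = "\<lambda>X. Neg ` X \<union> (\<lambda>(a, b). Conj a b) ` (X \<times> X) \<union> (\<lambda>(s, a). Ex s a) ` (UNIV \<times> X)
    :: ('f, 'r, 's, 'v) fm set"
  have "\<exists>C. ?A \<subseteq> C \<and> ?G C \<subseteq> C \<and> |C| \<le>o r"
  proof (rule closure_exists[OF r1])
    show "|?A| \<le>o r"
      by (intro Un_Cinfinite_bound card_image_ordLeq Times_Cinfinite_bound r lists_Cinfinite_bound Tm)
  next
    fix C :: "('f, 'r, 's, 'v) fm set" assume "|C| \<le>o r"
    then show "|?G C| \<le>o r"
      by (intro Un_Cinfinite_bound card_image_ordLeq Times_Cinfinite_bound r)
  next
    fix C :: "nat \<Rightarrow> ('f, 'r, 's, 'v) fm set" and y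
    assume C: "\<And>n. C n \<subseteq> C (Suc n)" "y \<in> ?G (\<Union> (range C))"
    then consider a where "y = Neg a" "{a} \<subseteq> (\<Union>n. C n)"
      | a b where "y = Conj a b" "{a, b} \<subseteq> (\<Union>n. C n)"
      | s a where "y = Ex s a" "{a} \<subseteq> (\<Union>n. C n)" by auto blast
    then show "\<exists>n. y \<in> ?G (C n)"
    proof cases
      case 1 then show ?thesis by auto
    next
      case (2 a b)
      from finite_subset_increasing_Union[of "{a, b}" C, OF _ C(1) 2(2)]
      obtain n where "{a, b} \<subseteq> C n" by auto
      with 2 show ?thesis by (intro exI[of _ n]) auto
    next
      case 3 then show ?thesis by auto
    qed
  qed
  then obtain D :: "('f, 'r, 's, 'v) fm set" where D: "|D| \<le>o r" "\<And>t u. t \<in> Tm \<Longrightarrow> u \<in> Tm \<Longrightarrow> Eq t u \<in> D"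
    "\<And>q ts. q \<in> rels L \<Longrightarrow> set ts \<subseteq> Tm \<Longrightarrow> Rel q ts \<in> D"
    "\<And>a. a \<in> D \<Longrightarrow> Neg a \<in> D" "\<And>a b. a \<in> D \<Longrightarrow> b \<in> D \<Longrightarrow> Conj a b \<in> D" "\<And>s a. a \<in> D \<Longrightarrow> Ex s a \<in> D"
    by (auto simp: image_subset_iff lists_eq_set)
  have "\<phi> \<in> D" if "fm_wf L S \<Gamma> \<phi>" "dom S \<subseteq> V" for S \<Gamma> \<phi>
    using that
  proof (induction \<phi> arbitrary: \<Gamma>)
    case (Eq t u) then show ?case using tm D(2) by auto
  next
    case (Rel q ts)
    from fm_wf_args[OF Rel(1)] tm[OF _ Rel(2)] show ?case by (intro D(3)) blast+
  next
    case (Neg \<phi>) then show ?case using D(4) by simp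
  next
    case (Conj \<phi> \<psi>) then show ?case using D(5) by auto
  next
    case (Ex s \<phi>) then show ?case using D(6) by simp
  qed
  with D(1) show ?thesis by (auto simp: formulas_def)
qed

text \<open>The definition of a strong limit speaks of subsets of \<open>Field \<kappa>\<close>
  only, so \<open>A\<close> is first copied there by an injection.\<close>

lemma strong_limit_Pow:
  assumes "strong_limit \<kappa>" "|A| <o \<kappa>"
  shows "|Pow A| <o \<kappa>"
proof -
  have c: "Card_order \<kappa>" using assms(1) by (simp add: strong_limit_def)
  have "|A| \<le>o |Field \<kappa>|"
    using assms(2) c card_of_Field_ordIso ordIso_symmetric ordLess_imp_ordLeq ordLeq_ordIso_trans by blast
  then obtain f where f: "inj_on f A" "f ` A \<subseteq> Field \<kappa>" by (auto simp: card_of_ordLeq[symmetric])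
  have "|f ` A| <o \<kappa>" using assms(2) by (rule card_image_ordLess)
  with f assms(1) have "|Pow (f ` A)| <o \<kappa>" by (simp add: strong_limit_def)
  moreover have "|Pow A| \<le>o |Pow (f ` A)|"
    using inj_on_image_Pow[OF f(1)]
    by (intro card_of_ordLeq[THEN iffD1] exI[of _ "image f"]) auto
  ultimately show ?thesis using ordLeq_ordLess_trans by blast
qed

lemma Times_ordLess:
  assumes "Cinfinite \<kappa>" "|A| <o \<kappa>" "|B| <o \<kappa>"
  shows "|A \<times> B| <o \<kappa>"
proof (cases "finite (A <+> B)")
  case True
  then have "finite (A \<times> B)" by auto
  then show ?thesis using assms(1) finite_Cinfinite_bound by blast
next
  case False
  have "|A <+> B| <o \<kappa>"
    using assms by (intro card_of_Plus_ordLess_infinite_Field) (auto simp: cinfinite_def)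
  moreover have "|A \<times> B| \<le>o |A <+> B|"
    using False by (intro card_of_Times_ordLeq_infinite_Field card_of_Card_order) (auto simp: card_of_Plus1 card_of_Plus2 Field_card_of)
  ultimately show ?thesis using ordLeq_ordLess_trans by blast
qed

lemma Plus_ordLess:
  assumes "Cinfinite \<kappa>" "|A| <o \<kappa>" "|B| <o \<kappa>"
  shows "|A <+> B| <o \<kappa>"
  using assms by (intro card_of_Plus_ordLess_infinite_Field) (auto simp: cinfinite_def)

lemma UNION_finite_ordLess:
  assumes \<kappa>: "natLeq <o \<kappa>" "Cinfinite \<kappa>" and I: "|I| <o \<kappa>" and fin: "\<And>i. i \<in> I \<Longrightarrow> finite (A i)"
  shows "|\<Union>i\<in>I. A i| <o \<kappa>"
proof -
  let ?B = "I <+> (UNIV :: nat set)"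
  have n: "|UNIV :: nat set| <o \<kappa>" using \<kappa>(1) card_of_nat ordIso_ordLess_trans by blast
  have inf: "infinite ?B" by simp
  have "|A i| \<le>o |?B|" if "i \<in> I" for i
  proof -
    have "Cinfinite |?B|" using inf by (simp add: cinfinite_def Field_card_of card_of_card_order_on)
    then show ?thesis using finite_Cinfinite_bound fin[OF that] ordLess_imp_ordLeq by blast
  qed
  then have "|\<Union>i\<in>I. A i| \<le>o |?B|"
    using inf by (intro card_of_UNION_ordLeq_infinite) (auto simp: card_of_Plus1)
  moreover have "|?B| <o \<kappa>" by (rule Plus_ordLess[OF \<kappa>(2) I n])
  ultimately show ?thesis using ordLeq_ordLess_trans by blast
qed

section \<open>Realizing types in a monster model\<close>

primrec conj_fm :: "('f, 'r, 's, 'v) fm \<Rightarrow> ('f, 'r, 's, 'v) fm list \<Rightarrow> ('f, 'r, 's, 'v) fm" where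
  "conj_fm \<phi> [] = \<phi>"
| "conj_fm \<phi> (\<psi> # \<psi>s) = Conj \<psi> (conj_fm \<phi> \<psi>s)"

lemma sat_conj_fm: "sat M v e (conj_fm \<phi> \<psi>s) \<longleftrightarrow> sat M v e \<phi> \<and> (\<forall>\<psi>\<in>set \<psi>s. sat M v e \<psi>)"
  by (induction \<psi>s) auto

lemma conj_fm_formulas: "conj_fm \<phi> \<psi>s \<in> formulas L S \<longleftrightarrow> \<phi> \<in> formulas L S \<and> set \<psi>s \<subseteq> formulas L S"
  by (induction \<psi>s) auto

lemma set_conj_fm: "set_fm (conj_fm \<phi> \<psi>s) = set_fm \<phi> \<union> (\<Union>\<psi>\<in>set \<psi>s. set_fm \<psi>)"
  by (induction \<psi>s) auto

text \<open>A closed formula that exists even if the language has no symbols. The sort does not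
  matter, because \<open>is_struct\<close> makes every sort nonempty.\<close>

definition top_fm :: "('f, 'r, 's, 'v) fm" where
  "top_fm = Ex undefined (Eq (Bnd 0) (Bnd 0))"

lemma top_fm [simp]: "top_fm \<in> formulas L S" "set_fm top_fm = {}" "is_struct L M \<Longrightarrow> sat M v e top_fm"
  by (auto simp: top_fm_def formulas_def is_struct_def)

locale monster_model =
  fixes L :: "('f, 'r, 's) lang" and T :: "('f, 'r, 's, unit) fm set"
    and \<kappa> :: "'k rel" and M :: "('f, 'r, 's, 'a) struct"
  assumes monster: "monster L T \<kappa> M" and complete: "complete_theory L T"
begin

abbreviation card_lang where "card_lang \<equiv> natLeq +c |UNIV :: 's set| +c |funs L| +c |rels L|"

lemma struct: "is_struct L M" and model: "is_model L T M"
  using monster by (simp_all add: monster_def is_model_def)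

lemma strong: "strong_limit \<kappa>" and lt: "card_lang <o \<kappa>"
  using monster by (simp_all add: monster_def)

lemma Cinfinite_lt: "Cinfinite card_lang"
  by (simp add: Cinfinite_csum natLeq_Cinfinite)

lemma natLeq_lt: "natLeq <o \<kappa>"
  using lt ordLeq_csum1[OF natLeq_Card_order] ordLeq_ordLess_trans by blast

lemma Card_order: "Card_order \<kappa>" using strong by (simp add: strong_limit_def)

lemma Cinfinite: "Cinfinite \<kappa>"
  using Card_order natLeq_lt by (meson Cinfinite_lt cinfinite_mono lt ordLess_imp_ordLeq)

lemma finite_small: "finite A \<Longrightarrow> |A| <o \<kappa>"
  using Cinfinite finite_Cinfinite_bound by blast

lemma Un_small: "|A| <o \<kappa> \<Longrightarrow> |B| <o \<kappa> \<Longrightarrow> |A \<union> B| <o \<kappa>"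
  using Cinfinite Un_Cinfinite_bound_strict by blast

text \<open>Saturation is given for types in one variable. A complete type in fewer than \<kappa>
  variables is realized one variable at a time, by Zorn on the partial realizations that extend
  \<open>v0\<close>; finite satisfiability may be witnessed in another structure
  \<open>M'\<close>.\<close>

lemma realize_type:
  fixes Sg :: "'v \<rightharpoonup> 's" and M' :: "('f, 'r, 's, 'b) struct"
  assumes Th: "Th \<subseteq> formulas L Sg" "\<And>\<phi>. \<phi> \<in> formulas L Sg \<Longrightarrow> \<phi> \<in> Th \<or> Neg \<phi> \<in> Th"
    and fs: "\<And>F. F \<subseteq> Th \<Longrightarrow> finite F \<Longrightarrow> \<exists>n\<in>assigns M' Sg. \<forall>\<phi>\<in>F. sat M' n [] \<phi>"
    and small: "|dom Sg| <o \<kappa>"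
    and V0: "V0 \<subseteq> dom Sg" "v0 \<in> assigns M (Sg |` V0)"
      "\<And>\<phi>. \<phi> \<in> formulas L (Sg |` V0) \<Longrightarrow> \<phi> \<in> Th \<longleftrightarrow> sat M v0 [] \<phi>"
  shows "\<exists>v\<in>assigns M Sg. (\<forall>x\<in>V0. v x = v0 x) \<and> (\<forall>\<phi>\<in>formulas L Sg. \<phi> \<in> Th \<longleftrightarrow> sat M v [] \<phi>)"
proof -
  have cons: "\<not> (\<phi> \<in> Th \<and> Neg \<phi> \<in> Th)" for \<phi>
  proof
    assume "\<phi> \<in> Th \<and> Neg \<phi> \<in> Th"
    then show False using fs[of "{\<phi>, Neg \<phi>}"] by auto
  qed
  have conj: "conj_fm top_fm \<phi>s \<in> Th" if "set \<phi>s \<subseteq> Th" for \<phi>s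
  proof (rule ccontr)
    assume no: "conj_fm top_fm \<phi>s \<notin> Th"
    have "conj_fm top_fm \<phi>s \<in> formulas L Sg" using that Th(1) by (auto simp: conj_fm_formulas)
    with no have "Neg (conj_fm top_fm \<phi>s) \<in> Th" using Th(2) by blast
    then have neg: "insert (Neg (conj_fm top_fm \<phi>s)) (set \<phi>s) \<subseteq> Th" using that by auto
    show False
    proof (cases "top_fm \<in> Th")
      case True
      with neg fs[of "insert top_fm (insert (Neg (conj_fm top_fm \<phi>s)) (set \<phi>s))"]
      show False by (auto simp: sat_conj_fm)
    next
      case False
      then have "Neg top_fm \<in> Th" using Th(2)[of top_fm] by auto
      \<comment> \<open>\<open>M'\<close> is an arbitrary record here, so the truth of
        \<open>top_fm\<close> is taken from \<open>M\<close>: a closed formula is also a formula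
        over \<open>V0\<close>, where \<open>Th\<close> agrees with \<open>M\<close>.\<close>
      moreover have "top_fm \<in> Th" using V0(3)[of top_fm] struct by simp
      ultimately show False using cons by blast
    qed
  qed
  define good where "good = (\<lambda>W v. V0 \<subseteq> W \<and> W \<subseteq> dom Sg \<and> v \<in> assigns M (Sg |` W) \<and>
     (\<forall>x\<in>V0. v x = v0 x) \<and> (\<forall>\<phi>\<in>formulas L (Sg |` W). \<phi> \<in> Th \<longleftrightarrow> sat M v [] \<phi>))"
  \<comment> \<open>Graphs turn the extension of partial realizations into set inclusion, as the
    chain form of Zorn's lemma requires.\<close>
  define gr where "gr = (\<lambda>W (v :: 'v \<Rightarrow> 'a). (\<lambda>x. (x, v x)) ` W)"
  let ?A = "{gr W v | W v. good W v}"
  have "good V0 v0" using V0 by (simp add: good_def)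
  then have ne: "?A \<noteq> {}" by blast
  have "\<exists>G\<in>?A. \<forall>X\<in>?A. G \<subseteq> X \<longrightarrow> X = G"
  proof (rule subset_Zorn_nonempty[OF ne])
    fix \<C> assume C: "\<C> \<noteq> {}" "subset.chain ?A \<C>"
    define W where "W = fst ` \<Union>\<C>"
    define v where "v = (\<lambda>x. THE y. (x, y) \<in> \<Union>\<C>)"
    have uniq: "y = y'" if "(x, y) \<in> \<Union>\<C>" "(x, y') \<in> \<Union>\<C>" for x y y'
    proof -
      from that obtain G where "G \<in> \<C>" "(x, y) \<in> G" "(x, y') \<in> G"
        using C(2) unfolding subset.chain_def by blast
      moreover then have "G \<in> ?A" using C(2) unfolding subset.chain_def by blast
      ultimately show ?thesis by (auto simp: gr_def)
    qed
    have v: "v x = y" if "(x, y) \<in> \<Union>\<C>" for x y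
      unfolding v_def using that uniq by (intro the_equality) auto
    have U: "\<Union>\<C> = gr W v" unfolding gr_def W_def using v by (force simp: image_iff)
    have piece: "\<exists>W' v'. G = gr W' v' \<and> good W' v' \<and> W' \<subseteq> W \<and> (\<forall>x\<in>W'. v x = v' x)" if "G \<in> \<C>" for G
    proof -
      from that C(2) have "G \<in> ?A" unfolding subset.chain_def by blast
      then obtain W' v' where *: "G = gr W' v'" "good W' v'" by auto
      have m: "(x, v' x) \<in> \<Union>\<C>" if "x \<in> W'" for x using that \<open>G \<in> \<C>\<close> * by (auto simp: gr_def)
      have "W' \<subseteq> W" using m unfolding W_def by (metis fst_conv image_eqI subsetI)
      with * show ?thesis using v[OF m] by blast
    qed
    have fin: "\<exists>W' v'. good W' v' \<and> B \<subseteq> W' \<and> (\<forall>x\<in>W'. v x = v' x) \<and> W' \<subseteq> W" if "finite B" "B \<subseteq> W" for B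
    proof -
      have "(\<lambda>x. (x, v x)) ` B \<subseteq> \<Union>\<C>" using that unfolding U gr_def by auto
      from finite_subset_Union_chain[OF finite_imageI[OF that(1)] this C]
      obtain G where G: "G \<in> \<C>" "(\<lambda>x. (x, v x)) ` B \<subseteq> G" by metis
      from piece[OF G(1)] obtain W' v' where *: "G = gr W' v'" "good W' v'" "W' \<subseteq> W" "\<forall>x\<in>W'. v x = v' x"
        by blast
      have "B \<subseteq> W'" using G(2) unfolding *(1) gr_def by auto
      with * show ?thesis by blast
    qed
    have "good W v" unfolding good_def
    proof (intro conjI ballI)
      show "V0 \<subseteq> W" using fin[of "{}"] by (auto simp: good_def)
      show "W \<subseteq> dom Sg"
      proof
        fix x assume "x \<in> W"
        then show "x \<in> dom Sg" using fin[of "{x}"] by (auto simp: good_def)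
      qed
      show "v \<in> assigns M (Sg |` W)" unfolding assigns_def
      proof (intro CollectI ballI)
        fix x assume "x \<in> dom (Sg |` W)"
        then have "x \<in> W" by auto
        then obtain W' v' where *: "good W' v'" "x \<in> W'" "v x = v' x" using fin[of "{x}"] by auto
        then have "v' \<in> assigns M (Sg |` W')" "x \<in> dom (Sg |` W')" by (auto simp: good_def)
        then have "sort_of M (v' x) = (Sg |` W') x" unfolding assigns_def by blast
        with * \<open>x \<in> W\<close> show "sort_of M (v x) = (Sg |` W) x" by simp
      qed
      show "v x = v0 x" if "x \<in> V0" for x
        using fin[of "{}"] that by (auto simp: good_def)
      show "\<phi> \<in> Th \<longleftrightarrow> sat M v [] \<phi>" if "\<phi> \<in> formulas L (Sg |` W)" for \<phi>
      proof -
        from that have f: "\<phi> \<in> formulas L Sg" "set_fm \<phi> \<subseteq> W" by (auto simp: formulas_restrict_iff)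
        then obtain W' v' where *: "good W' v'" "set_fm \<phi> \<subseteq> W'" "\<forall>x\<in>W'. v x = v' x"
          using fin[OF finite_set_fm f(2)] by blast
        then have "\<phi> \<in> formulas L (Sg |` W')" using f by (auto simp: formulas_restrict_iff)
        then have "\<phi> \<in> Th \<longleftrightarrow> sat M v' [] \<phi>" using * by (auto simp: good_def)
        moreover have "sat M v' [] \<phi> \<longleftrightarrow> sat M v [] \<phi>" using * by (intro sat_cong) auto
        ultimately show ?thesis by simp
      qed
    qed
    then show "\<Union>\<C> \<in> ?A" unfolding U by blast
  qed
  then obtain G where G: "G \<in> ?A" "\<forall>X\<in>?A. G \<subseteq> X \<longrightarrow> X = G" ..
  from G(1) obtain W v where GWv: "G = gr W v" and Wv: "good W v" by blast
  have max: "gr W' v' = gr W v" if "good W' v'" "gr W v \<subseteq> gr W' v'" for W' v'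
  proof -
    have "gr W' v' \<in> ?A" using that(1) by blast
    with G(2) that(2) show ?thesis unfolding GWv by blast
  qed
  have "W = dom Sg"
  proof (rule ccontr)
    assume "W \<noteq> dom Sg"
    with Wv obtain x s where x: "x \<notin> W" "Sg x = Some s" by (auto simp: good_def)
    let ?Sx = "Sg |` insert x W"
    \<comment> \<open>The name \<open>x\<close> becomes the single variable and every name already
      realized becomes the parameter \<open>v y\<close>; this makes \<open>?p\<close> a one-variable
      type over a small set.\<close>
    define j where "j = (\<lambda>y. if y = x then Inl () else Inr (v y))"
    let ?p = "map_fm j ` (Th \<inter> formulas L ?Sx)"
    let ?S1 = "[() \<mapsto> s]"
    let ?A = "v ` W"
    have W: "W \<subseteq> dom Sg" "v \<in> assigns M (Sg |` W)" using Wv by (auto simp: good_def)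
    have sv: "sort_of M (v y) = Sg y" if "y \<in> W" for y
    proof -
      have "y \<in> dom (Sg |` W)" using that W by auto
      then have "sort_of M (v y) = (Sg |` W) y" using W unfolding assigns_def by blast
      with that show ?thesis by simp
    qed
    have A: "?A \<subseteq> univ M" using sv W(1) by (auto simp: subset_iff dom_def)
    have "|?A| <o \<kappa>" using small W(1) by (intro card_image_ordLess) (rule card_subset_ordLess)
    have p: "?p \<subseteq> formulas_over L ?S1 M ?A"
    proof
      fix \<psi> assume "\<psi> \<in> ?p"
      then obtain \<phi> where \<phi>: "\<phi> \<in> formulas L ?Sx" "\<psi> = map_fm j \<phi>" by auto
      have "\<phi> \<in> formulas L (case_sum ?S1 (sort_of M |` ?A) \<circ> j)"
      proof (rule formulas_cong[OF \<phi>(1)])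
        fix y assume "y \<in> set_fm \<phi>"
        then have "y \<in> insert x W" using \<phi>(1) by (auto simp: formulas_restrict_iff)
        then show "?Sx y = (case_sum ?S1 (sort_of M |` ?A) \<circ> j) y"
          using x sv[of y] by (auto simp: j_def)
      qed
      then show "\<psi> \<in> formulas_over L ?S1 M ?A" by (simp add: \<phi> formulas_over_def formulas_map)
    qed
    have val: "sat M (case_sum (\<lambda>_. b) id) [] (map_fm j \<phi>) \<longleftrightarrow> sat M (v(x := b)) [] \<phi>" for b \<phi>
      unfolding sat_map by (rule sat_cong) (auto simp: j_def)
    have "fin_sat ?S1 M ?p" unfolding fin_sat_def
    proof (intro allI impI)
      fix q assume "q \<subseteq> ?p" "finite q"
      then obtain F where F: "F \<subseteq> Th \<inter> formulas L ?Sx" "finite F" "q = map_fm j ` F"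
        by (meson finite_subset_image)
      then obtain \<phi>s where \<phi>s: "set \<phi>s = F" using finite_list by blast
      let ?\<chi> = "conj_fm top_fm \<phi>s"
      have \<chi>: "?\<chi> \<in> Th" "?\<chi> \<in> formulas L ?Sx" using F \<phi>s conj by (auto simp: conj_fm_formulas)
      \<comment> \<open>Quantifying \<open>x\<close> away leaves a formula over \<open>W\<close>,
        where \<open>v\<close> already realizes \<open>Th\<close>. By completeness it lies in
        \<open>Th\<close>, as its negation together with \<open>?\<chi>\<close> has no model; so
        \<open>M\<close> has a witness for this finite piece.\<close>
      let ?\<theta> = "Ex s (bind_fm 0 x ?\<chi>)"
      have \<theta>: "?\<theta> \<in> formulas L (Sg |` W)"
        by (rule Ex_bind_formulas[OF \<chi>(2)]) (use x in \<open>auto simp: restrict_map_def\<close>)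
      then have \<theta>': "?\<theta> \<in> formulas L Sg" by (simp add: formulas_restrict_iff)
      have "?\<theta> \<in> Th"
      proof (rule ccontr)
        assume "?\<theta> \<notin> Th"
        then have "{Neg ?\<theta>, ?\<chi>} \<subseteq> Th" using Th(2)[OF \<theta>'] \<chi> by auto
        then obtain n where n: "n \<in> assigns M' Sg" "\<not> sat M' n [] ?\<theta>" "sat M' n [] ?\<chi>"
          using fs[of "{Neg ?\<theta>, ?\<chi>}"] by (auto simp del: sat.simps(5))
        have "sort_of M' (n x) = Some s" using n(1) x(2) by (force simp: assigns_def)
        then have "sat M' n [] ?\<theta>" unfolding sat_Ex_bind[OF \<chi>(2)]
          using n(3) by (intro exI[of _ "n x"]) simp
        with n show False by blast
      qed
      with \<theta> Wv have "sat M v [] ?\<theta>" by (auto simp: good_def simp del: sat.simps(5))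
      then obtain b where b: "sort_of M b = Some s" "sat M (v(x := b)) [] ?\<chi>"
        unfolding sat_Ex_bind[OF \<chi>(2)] by blast
      show "\<exists>u\<in>assigns M ?S1. realizes M u q"
      proof
        show "(\<lambda>_. b) \<in> assigns M ?S1" using b by (auto simp: assigns_def)
        show "realizes M (\<lambda>_. b) q"
          using b(2) unfolding realizes_def F(3) sat_conj_fm \<phi>s by (auto simp: val)
      qed
    qed
    with p A \<open>|?A| <o \<kappa>\<close> obtain u where u: "u \<in> assigns M ?S1" "realizes M u ?p"
      using monster unfolding monster_def saturated_def by blast
    let ?b = "u ()"
    have ub: "u = (\<lambda>_. ?b)" by auto
    have b: "sort_of M ?b = Some s" using u(1) by (auto simp: assigns_def)
    have good: "good (insert x W) (v(x := ?b))" unfolding good_def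
    proof (intro conjI ballI)
      show "V0 \<subseteq> insert x W" "insert x W \<subseteq> dom Sg" using Wv x by (auto simp: good_def)
      show "v(x := ?b) \<in> assigns M ?Sx" using b x sv by (auto simp: assigns_def)
      show "(v(x := ?b)) y = v0 y" if "y \<in> V0" for y using that Wv x by (auto simp: good_def)
      fix \<phi> assume \<phi>: "\<phi> \<in> formulas L ?Sx"
      have 1: "sat M (v(x := ?b)) [] \<psi>" if "\<psi> \<in> Th" "\<psi> \<in> formulas L ?Sx" for \<psi>
      proof -
        have "map_fm j \<psi> \<in> ?p" using that by blast
        then have "sat M (case_sum u id) [] (map_fm j \<psi>)" using u(2) unfolding realizes_def by blast
        then show ?thesis using val[of ?b \<psi>] ub by metis
      qed
      show "\<phi> \<in> Th \<longleftrightarrow> sat M (v(x := ?b)) [] \<phi>"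
      proof (cases "\<phi> \<in> Th")
        case True then show ?thesis using 1[of \<phi>] \<phi> by simp
      next
        case False
        then have "Neg \<phi> \<in> Th" using Th(2) \<phi> by (auto simp: formulas_restrict_iff)
        then have "sat M (v(x := ?b)) [] (Neg \<phi>)" using 1[of "Neg \<phi>"] \<phi> by simp
        with False show ?thesis by (simp del: fun_upd_apply)
      qed
    qed
    have "gr W v \<subseteq> gr (insert x W) (v(x := ?b))" using x(1) by (force simp: gr_def)
    with max[OF good] have "gr (insert x W) (v(x := ?b)) = gr W v" by simp
    then show False using x(1) by (auto simp: gr_def)
  qed
  moreover have "Sg |` dom Sg = Sg" by (auto simp: restrict_map_def fun_eq_iff domIff)
  ultimately show ?thesis using Wv unfolding good_def by metis
qed

text \<open>The forth step of a back-and-forth between two structures: a partial copy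
  \<open>v0\<close> of \<open>v'\<close> extends to a copy of the whole family.\<close>

lemma realize_same_type:
  fixes Sg :: "'v \<rightharpoonup> 's" and M' :: "('f, 'r, 's, 'b) struct"
  assumes "same_type L (Sg |` V0) M' v' M v0" "v' \<in> assigns M' Sg" "V0 \<subseteq> dom Sg" "|dom Sg| <o \<kappa>"
  shows "\<exists>v. same_type L Sg M' v' M v \<and> (\<forall>x\<in>V0. v x = v0 x)"
proof -
  let ?Th = "{\<phi> \<in> formulas L Sg. sat M' v' [] \<phi>}"
  have "\<exists>v\<in>assigns M Sg. (\<forall>x\<in>V0. v x = v0 x) \<and> (\<forall>\<phi>\<in>formulas L Sg. \<phi> \<in> ?Th \<longleftrightarrow> sat M v [] \<phi>)"
  proof (rule realize_type)
    show "\<exists>n\<in>assigns M' Sg. \<forall>\<phi>\<in>F. sat M' n [] \<phi>" if "F \<subseteq> ?Th" for F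
      using that assms(2) by auto
    show "\<phi> \<in> ?Th \<longleftrightarrow> sat M v0 [] \<phi>" if "\<phi> \<in> formulas L (Sg |` V0)" for \<phi>
      using that same_type_sat[OF assms(1) that] by (auto simp: formulas_restrict_iff)
  qed (use assms in \<open>auto simp: same_type_def\<close>)
  with assms(2) show ?thesis unfolding same_type_def by blast
qed

text \<open>Strong homogeneity concerns maps on elements, while a named family may repeat values.
  The map sends each value to \<open>w\<close> of a chosen name for it; formulas equating two names
  show that the choice is irrelevant.\<close>

lemma homogeneous:
  fixes Sg :: "'v \<rightharpoonup> 's"
  assumes st: "same_type L Sg M v M w" and small: "|dom Sg| <o \<kappa>"
  shows "\<exists>\<sigma>\<in>automorphisms L M. \<forall>x\<in>dom Sg. \<sigma> (v x) = w x"
proof -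
  let ?A = "v ` dom Sg"
  define j where "j = inv_into (dom Sg) v"
  have j: "j a \<in> dom Sg" "v (j a) = a" if "a \<in> ?A" for a
    using that by (auto simp: j_def inv_into_into f_inv_into_f)
  have va: "sort_of M (v x) = Sg x" "sort_of M (w x) = Sg x" if "x \<in> dom Sg" for x
    using st that by (auto simp: same_type_def assigns_def)
  have A: "?A \<subseteq> univ M" using va by (auto simp: subset_iff dom_def)
  have w: "w (j (v x)) = w x" if "x \<in> dom Sg" for x
  proof -
    let ?y = "j (v x)"
    have y: "?y \<in> dom Sg" "v ?y = v x" using j that by auto
    then have "Sg x = Sg ?y" using va that by metis
    then have "Eq (Free x) (Free ?y) \<in> formulas L Sg" using that by (auto simp: formulas_def dom_def)
    from same_type_sat[OF st this] y show ?thesis by simp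
  qed
  have le: "sort_of M |` ?A \<subseteq>\<^sub>m Sg \<circ> j"
    using j va A by (auto simp: map_le_def restrict_map_def) (metis j(2) va(1) imageI j(1) domI)+
  have "same_type L (sort_of M |` ?A) M (v \<circ> j) M (w \<circ> j)"
    using st le by (rule same_type_comp)
  then have "same_type L (sort_of M |` ?A) M id M (w \<circ> j)"
    by (rule same_type_cong) (use j in auto)
  then have "elementary_map L M ?A (w \<circ> j)"
    by (auto simp: elementary_map_def same_type_def)
  moreover have "|?A| <o \<kappa>" using small by (rule card_image_ordLess)
  ultimately obtain \<sigma> where "\<sigma> \<in> automorphisms L M" "\<forall>a\<in>?A. \<sigma> a = (w \<circ> j) a"
    using monster A unfolding monster_def strongly_homogeneous_def by blast
  then show ?thesis using w by auto
qed

text \<open>The Tarski--Vaught condition: \<open>N\<close> is the universe of an elementary substructure.\<close>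

definition elem_sub :: "'a set \<Rightarrow> bool" where
  "elem_sub N \<longleftrightarrow> N \<subseteq> univ M \<and>
     (\<forall>s. \<forall>\<psi>\<in>formulas_over L [() \<mapsto> s] M N.
        (\<exists>a. sort_of M a = Some s \<and> sat M (case_sum (\<lambda>_. a) id) [] \<psi>) \<longrightarrow>
        (\<exists>a\<in>N. sort_of M a = Some s \<and> sat M (case_sum (\<lambda>_. a) id) [] \<psi>))"

lemma lt_components: "|UNIV :: 's set| \<le>o card_lang" "|funs L| \<le>o card_lang" "|rels L| \<le>o card_lang"
proof -
  have 1: "|UNIV :: 's set| +c |funs L| +c |rels L| \<le>o card_lang"
    by (rule ordLeq_csum2) (simp add: Card_order_csum)
  have 2: "|funs L| +c |rels L| \<le>o |UNIV :: 's set| +c |funs L| +c |rels L|"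
    by (rule ordLeq_csum2) (simp add: Card_order_csum)
  show "|UNIV :: 's set| \<le>o card_lang"
    by (rule ordLeq_transitive[OF _ 1]) (rule ordLeq_csum1[OF card_of_Card_order])
  show "|funs L| \<le>o card_lang"
    by (rule ordLeq_transitive[OF _ ordLeq_transitive[OF 2 1]]) (rule ordLeq_csum1[OF card_of_Card_order])
  show "|rels L| \<le>o card_lang"
    by (rule ordLeq_transitive[OF _ ordLeq_transitive[OF 2 1]]) (rule ordLeq_csum2[OF card_of_Card_order])
qed

lemma formulas_bound:
  "|V| \<le>o card_lang \<Longrightarrow> \<exists>D :: ('f, 'r, 's, 'v) fm set. |D| \<le>o card_lang \<and> (\<forall>S. dom S \<subseteq> V \<longrightarrow> formulas L S \<subseteq> D)"
  by (rule formulas_Cinfinite_bound) (auto simp: Cinfinite_lt lt_components)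

text \<open>The Skolem hull of the empty set, with one chosen witness for each sort and each
  satisfiable formula.\<close>

lemma Lowenheim_Skolem: "\<exists>N. elem_sub N \<and> |N| \<le>o card_lang"
proof -
  define wit where "wit = (\<lambda>s (\<psi> :: ('f, 'r, 's, unit + 'a) fm).
     SOME a. sort_of M a = Some s \<and> sat M (case_sum (\<lambda>_. a) id) [] \<psi>)"
  define has where "has = (\<lambda>s (\<psi> :: ('f, 'r, 's, unit + 'a) fm).
     \<exists>a. sort_of M a = Some s \<and> sat M (case_sum (\<lambda>_. a) id) [] \<psi>)"
  define G where "G = (\<lambda>C. {wit s \<psi> | s \<psi>. \<psi> \<in> formulas_over L [() \<mapsto> s] M C \<and> has s \<psi>})"
  have wit: "sort_of M (wit s \<psi>) = Some s \<and> sat M (case_sum (\<lambda>_. wit s \<psi>) id) [] \<psi>" if "has s \<psi>" for s \<psi>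
    unfolding wit_def using that unfolding has_def by (rule someI_ex)
  \<comment> \<open>Being a formula over \<open>B\<close> depends only on the finitely many
    parameters that occur; this makes \<open>G\<close> finitary.\<close>
  have mono: "\<psi> \<in> formulas_over L S M B \<longleftrightarrow> \<psi> \<in> formulas_over L S M C \<and> {a. Inr a \<in> set_fm \<psi>} \<subseteq> B"
    if "B \<subseteq> C" for \<psi> :: "('f, 'r, 's, unit + 'a) fm" and S B C
  proof -
    have *: "case_sum S (sort_of M |` B) = case_sum S (sort_of M |` C) |` (range Inl \<union> Inr ` B)"
      using that by (auto simp: fun_eq_iff restrict_map_def split: sum.splits)
    have "x \<in> range Inl \<union> Inr ` B \<longleftrightarrow> (\<forall>a. x = Inr a \<longrightarrow> a \<in> B)" for x :: "unit + 'a"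
      by (cases x) auto
    then have "set_fm \<psi> \<subseteq> range Inl \<union> Inr ` B \<longleftrightarrow> {a. Inr a \<in> set_fm \<psi>} \<subseteq> B" by blast
    then show ?thesis unfolding formulas_over_def * formulas_restrict_iff by simp
  qed
  have "\<exists>C. {} \<subseteq> C \<and> G C \<subseteq> C \<and> |C| \<le>o card_lang"
  proof (rule closure_exists[OF Cinfinite_lt])
    show "|{}| \<le>o card_lang" by (simp add: finite_Cinfinite_bound[OF Cinfinite_lt] ordLess_imp_ordLeq)
  next
    fix C :: "'a set" assume C: "|C| \<le>o card_lang"
    have "|(UNIV :: unit set) <+> C| \<le>o card_lang"
      using C Cinfinite_lt finite_Cinfinite_bound[OF Cinfinite_lt, of "UNIV :: unit set"]
      by (intro card_of_Plus_ordLeq_infinite_Field) (auto simp: cinfinite_def intro: ordLess_imp_ordLeq)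
    then obtain D :: "('f, 'r, 's, unit + 'a) fm set" where
      D: "|D| \<le>o card_lang" "\<And>S. dom S \<subseteq> UNIV <+> C \<Longrightarrow> formulas L S \<subseteq> D"
      using formulas_bound by blast
    have "dom (case_sum [() \<mapsto> s] (sort_of M |` C)) \<subseteq> UNIV <+> C" for s
    proof
      fix x assume "x \<in> dom (case_sum [() \<mapsto> s] (sort_of M |` C))"
      then show "x \<in> UNIV <+> C" by (cases x) (auto simp: restrict_map_def split: if_splits)
    qed
    then have "\<psi> \<in> D" if "\<psi> \<in> formulas_over L [() \<mapsto> s] M C" for s \<psi>
      using D(2) that unfolding formulas_over_def by blast
    then have "G C \<subseteq> (\<lambda>(s, \<psi>). wit s \<psi>) ` (UNIV \<times> D)"
      unfolding G_def by blast
    moreover have "|(\<lambda>(s, \<psi>). wit s \<psi>) ` (UNIV \<times> D)| \<le>o card_lang"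
      by (intro card_image_ordLeq Times_Cinfinite_bound Cinfinite_lt lt_components D)
    ultimately show "|G C| \<le>o card_lang" using card_subset_ordLeq by blast
  next
    fix C :: "nat \<Rightarrow> 'a set" and y assume C: "\<And>n. C n \<subseteq> C (Suc n)" "y \<in> G (\<Union> (range C))"
    then obtain s \<psi> where y: "y = wit s \<psi>" "\<psi> \<in> formulas_over L [() \<mapsto> s] M (\<Union> (range C))" "has s \<psi>"
      by (auto simp: G_def)
    have "finite {a. Inr a \<in> set_fm \<psi>}"
      using finite_vimageI[OF finite_set_fm[of \<psi>], of Inr] by (simp add: vimage_def)
    moreover have "{a. Inr a \<in> set_fm \<psi>} \<subseteq> \<Union> (range C)" using y(2) mono by blast
    ultimately obtain n where n: "{a. Inr a \<in> set_fm \<psi>} \<subseteq> C n"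
      using finite_subset_increasing_Union[of _ C, OF _ C(1)] by metis
    have "C n \<subseteq> \<Union> (range C)" by blast
    from mono[OF this] n y(2) have "\<psi> \<in> formulas_over L [() \<mapsto> s] M (C n)" by blast
    with y show "\<exists>n. y \<in> G (C n)" by (auto simp: G_def)
  qed
  then obtain C where C: "G C \<subseteq> C" "|C| \<le>o card_lang" by auto
  \<comment> \<open>The closed set may contain points outside the universe. They have no sort, so
    cutting them off changes no formula.\<close>
  have same: "formulas_over L S M (C \<inter> univ M) = formulas_over L S M C" for S :: "unit \<rightharpoonup> 's"
  proof -
    have "sort_of M |` (C \<inter> univ M) = sort_of M |` C" by (auto simp: restrict_map_def fun_eq_iff)
    then show ?thesis by (simp add: formulas_over_def)
  qed
  have "elem_sub (C \<inter> univ M)" unfolding elem_sub_def same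
  proof (intro conjI allI ballI impI)
    fix s \<psi> assume "\<psi> \<in> formulas_over L [() \<mapsto> s] M C"
      "\<exists>a. sort_of M a = Some s \<and> sat M (case_sum (\<lambda>_. a) id) [] \<psi>"
    then have "wit s \<psi> \<in> C" "has s \<psi>" using C(1) by (auto simp: G_def has_def)
    with wit show "\<exists>a\<in>C \<inter> univ M. sort_of M a = Some s \<and> sat M (case_sum (\<lambda>_. a) id) [] \<psi>"
      by (intro bexI[of _ "wit s \<psi>"]) auto
  qed auto
  then show ?thesis using C(2) card_subset_ordLeq[of C card_lang "C \<inter> univ M"] by blast
qed

text \<open>The Tarski-Vaught condition for tuples. Induction on the number of names with values
  outside \<open>N\<close>: quantify one of them, apply the hypothesis to the others, then choose
  its new value in \<open>N\<close> by the one-variable condition. Values already in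
  \<open>N\<close> are kept, which the coheirs below rely on.\<close>

lemma elem_sub_realize:
  fixes Sg :: "'v \<rightharpoonup> 's"
  assumes N: "elem_sub N"
  shows "\<psi> \<in> formulas L Sg \<Longrightarrow> v \<in> assigns M Sg \<Longrightarrow> sat M v [] \<psi> \<Longrightarrow>
    \<exists>n\<in>assigns M Sg. (\<forall>x\<in>set_fm \<psi>. n x \<in> N) \<and> (\<forall>x. v x \<in> N \<longrightarrow> n x = v x) \<and> sat M n [] \<psi>"
proof (induction "card {x \<in> set_fm \<psi>. v x \<notin> N}" arbitrary: \<psi>)
  case 0
  then have "{x \<in> set_fm \<psi>. v x \<notin> N} = {}" using finite_set_fm[of \<psi>] by simp
  then show ?case using 0 by (intro bexI[of _ v]) auto
next
  case (Suc k)
  then have "{x \<in> set_fm \<psi>. v x \<notin> N} \<noteq> {}" by (metis card.empty nat.distinct(1))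
  then obtain x where x: "x \<in> set_fm \<psi>" "v x \<notin> N" by auto
  then obtain s where s: "Sg x = Some s" using formulas_dom[OF Suc.prems(1)] by auto
  let ?\<theta> = "Ex s (bind_fm 0 x \<psi>)"
  have vx: "sort_of M (v x) = Some s" using Suc.prems(2) s by (force simp: assigns_def)
  have "{y \<in> set_fm ?\<theta>. v y \<notin> N} = {y \<in> set_fm \<psi>. v y \<notin> N} - {x}" by (auto simp: set_bind_fm)
  then have card: "k = card {y \<in> set_fm ?\<theta>. v y \<notin> N}" using Suc.hyps(2) x finite_set_fm[of \<psi>] by simp
  have \<theta>: "?\<theta> \<in> formulas L Sg" by (rule Ex_bind_formulas[OF Suc.prems(1) s]) simp
  have "sat M v [] ?\<theta>" unfolding sat_Ex_bind[OF Suc.prems(1)]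
    using vx Suc.prems(3) by (intro exI[of _ "v x"]) simp
  from Suc.hyps(1)[OF card \<theta> Suc.prems(2) this] obtain n where n: "n \<in> assigns M Sg"
    "\<forall>y\<in>set_fm ?\<theta>. n y \<in> N" "\<forall>y. v y \<in> N \<longrightarrow> n y = v y" "sat M n [] ?\<theta>" by blast
  then obtain a where a: "sort_of M a = Some s" "sat M (n(x := a)) [] \<psi>"
    unfolding sat_Ex_bind[OF Suc.prems(1)] by blast
  define j where "j = (\<lambda>y. if y = x then Inl () else Inr (n y))"
  have val: "sat M (case_sum (\<lambda>_. b) id) [] (map_fm j \<psi>) \<longleftrightarrow> sat M (n(x := b)) [] \<psi>" for b
    unfolding sat_map by (rule sat_cong) (auto simp: j_def)
  have nN: "n y \<in> N" if "y \<in> set_fm \<psi>" "y \<noteq> x" for y using that n(2) by (auto simp: set_bind_fm)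
  have "map_fm j \<psi> \<in> formulas_over L [() \<mapsto> s] M N"
    unfolding formulas_over_def formulas_map
  proof (rule formulas_cong[OF Suc.prems(1)])
    fix y assume y: "y \<in> set_fm \<psi>"
    then have "y \<in> dom Sg" using formulas_dom[OF Suc.prems(1)] by auto
    then have "sort_of M (n y) = Sg y" using n(1) by (auto simp: assigns_def)
    then show "Sg y = (case_sum [() \<mapsto> s] (sort_of M |` N) \<circ> j) y"
      using s nN[OF y] by (auto simp: j_def)
  qed
  then obtain b where b: "b \<in> N" "sort_of M b = Some s" "sat M (n(x := b)) [] \<psi>"
    using N a unfolding elem_sub_def val[symmetric] by blast
  show ?case
  proof (intro bexI conjI ballI allI impI)
    show "n(x := b) \<in> assigns M Sg" using n(1) b s by (auto simp: assigns_def)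
    show "(n(x := b)) y \<in> N" if "y \<in> set_fm \<psi>" for y using that nN b by auto
    show "(n(x := b)) y = v y" if "v y \<in> N" for y using that n(3) x by auto
  qed (use b in simp)
qed

end

text \<open>Completeness of \<open>T\<close> enters here: a formula without free names is a renamed
  sentence, and \<open>T\<close> decides it. This starts every comparison between two
  models.\<close>

lemma same_type_empty:
  fixes L :: "('f, 'r, 's) lang" and M :: "('f, 'r, 's, 'a) struct" and M' :: "('f, 'r, 's, 'b) struct"
    and v :: "'v \<Rightarrow> 'a"
  assumes "complete_theory L T" "is_model L T M" "is_model L T M'"
  shows "same_type L Map.empty M v M' w"
  unfolding same_type_def
proof (intro conjI ballI)
  fix \<phi> :: "('f, 'r, 's, 'v) fm" assume "\<phi> \<in> formulas L Map.empty"
  then have "map_fm (\<lambda>_. ()) \<phi> \<in> formulas L Map.empty" and e: "set_fm \<phi> = {}"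
    using formulas_dom[of \<phi> L Map.empty] by (auto simp: formulas_map o_def)
  then have s: "map_fm (\<lambda>_. ()) \<phi> \<in> sentences L" by (simp add: sentences_def)
  have eq: "sat K u [] (map_fm (\<lambda>_. ()) \<phi>) \<longleftrightarrow> sat K u' [] \<phi>" for K :: "('f, 'r, 's, 'z) struct" and u u'
    unfolding sat_map by (rule sat_cong) (simp add: e)
  show "sat M v [] \<phi> \<longleftrightarrow> sat M' w [] \<phi>"
  proof (cases "map_fm (\<lambda>_. ()) \<phi> \<in> T")
    case True
    then show ?thesis using assms(2,3) eq unfolding is_model_def by metis
  next
    case False
    then have "Neg (map_fm (\<lambda>_. ()) \<phi>) \<in> T" using assms(1) s by (auto simp: complete_theory_def)
    then show ?thesis using assms(2,3) eq unfolding is_model_def by (metis sat.simps(3))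
  qed
qed (auto simp: assigns_def)

section \<open>Formulas with parameters and global types\<close>

definition params :: "('f, 'r, 's, 'i + 'a) fm \<Rightarrow> 'a set" where
  "params \<phi> = {a. Inr a \<in> set_fm \<phi>}"

abbreviation inst :: "('a \<Rightarrow> 'b) \<Rightarrow> ('f, 'r, 's, 'i + 'a) fm \<Rightarrow> ('f, 'r, 's, 'i + 'b) fm" where
  "inst g \<equiv> map_fm (map_sum id g)"

abbreviation global_formulas ::
  "('f, 'r, 's) lang \<Rightarrow> ('i \<rightharpoonup> 's) \<Rightarrow> ('f, 'r, 's, 'a) struct \<Rightarrow> ('f, 'r, 's, 'i + 'a) fm set" where
  "global_formulas L S M \<equiv> formulas L (case_sum S (sort_of M))"

text \<open>The elements of \<open>A\<close> are their own names. Points of \<open>A\<close> outside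
  the universe have no sort and impose no condition.\<close>

abbreviation elem_map ::
  "('f, 'r, 's) lang \<Rightarrow> ('f, 'r, 's, 'a) struct \<Rightarrow> 'a set \<Rightarrow> ('a \<Rightarrow> 'b) \<Rightarrow> ('f, 'r, 's, 'b) struct \<Rightarrow> bool" where
  "elem_map L M A g M' \<equiv> same_type L (sort_of M |` A) M id M' g"

lemma formulas_over_univ: "formulas_over L S M (univ M) = global_formulas L S M"
proof -
  have "sort_of M |` univ M = sort_of M" by (auto simp: restrict_map_def fun_eq_iff domIff)
  then show ?thesis by (simp add: formulas_over_def)
qed

lemma finite_params: "finite (params \<phi>)"
  using finite_vimageI[OF finite_set_fm[of \<phi>], of Inr] by (simp add: vimage_def params_def)

lemma params_subset: "\<phi> \<in> global_formulas L S M \<Longrightarrow> params \<phi> \<subseteq> univ M"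
proof
  fix a assume "\<phi> \<in> global_formulas L S M" "a \<in> params \<phi>"
  then have "Inr a \<in> dom (case_sum S (sort_of M))" by (auto simp: params_def dest: formulas_dom)
  then show "a \<in> univ M" by (auto simp: dom_def)
qed

lemma inst_inst: "inst g (inst h \<phi>) = inst (g \<circ> h) \<phi>"
  by (simp add: fm.map_comp map_sum.comp)

lemma inst_cong: "(\<And>a. a \<in> params \<phi> \<Longrightarrow> g a = h a) \<Longrightarrow> inst g \<phi> = inst h \<phi>"
proof (rule fm.map_cong0)
  fix z assume *: "\<And>a. a \<in> params \<phi> \<Longrightarrow> g a = h a" and "z \<in> set_fm \<phi>"
  then show "map_sum id g z = map_sum id h z"
    by (cases z rule: sum.exhaust) (auto simp: params_def)
qed

lemma inst_id: "(\<And>a. a \<in> params \<phi> \<Longrightarrow> g a = a) \<Longrightarrow> inst g \<phi> = \<phi>"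
  using inst_cong[of \<phi> g id] by (simp add: sum.map_id0 fm.map_id)

lemma params_inst: "params (inst g \<phi>) = g ` params \<phi>"
proof -
  have "b \<in> params (inst g \<phi>) \<longleftrightarrow> (\<exists>z\<in>set_fm \<phi>. map_sum id g z = Inr b)" for b
    by (force simp: params_def fm.set_map image_iff)
  also have "(\<exists>z\<in>set_fm \<phi>. map_sum id g z = Inr b) \<longleftrightarrow> b \<in> g ` params \<phi>" for b
  proof
    assume "\<exists>z\<in>set_fm \<phi>. map_sum id g z = Inr b"
    then obtain z where "z \<in> set_fm \<phi>" "map_sum id g z = Inr b" by blast
    then show "b \<in> g ` params \<phi>" by (cases z rule: sum.exhaust) (auto simp: params_def)
  next
    assume "b \<in> g ` params \<phi>"
    then obtain a where "Inr a \<in> set_fm \<phi>" "b = g a" by (auto simp: params_def)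
    then show "\<exists>z\<in>set_fm \<phi>. map_sum id g z = Inr b" by (intro bexI[of _ "Inr a"]) auto
  qed
  finally show ?thesis by blast
qed

lemma params_Neg [simp]: "params (Neg \<phi>) = params \<phi>"
  by (simp add: params_def)

lemma inst_map_Inl [simp]: "inst g (map_fm Inl \<phi>) = map_fm Inl \<phi>"
  by (simp add: fm.map_comp o_def)

lemma case_sum_map_sum: "case_sum u w \<circ> map_sum id g = case_sum u (w \<circ> g)"
  by (auto simp: fun_eq_iff split: sum.splits)

lemma sat_inst: "sat M (case_sum v w) [] (inst g \<phi>) \<longleftrightarrow> sat M (case_sum v (w \<circ> g)) [] \<phi>"
  by (simp add: sat_map case_sum_map_sum)

lemma inst_global_formulas:
  assumes "\<phi> \<in> global_formulas L S M'" "\<And>a. a \<in> params \<phi> \<Longrightarrow> sort_of M (g a) = sort_of M' a"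
  shows "inst g \<phi> \<in> global_formulas L S M"
  unfolding formulas_map case_sum_map_sum
proof (rule formulas_cong[OF assms(1)])
  fix z assume "z \<in> set_fm \<phi>"
  then show "case_sum S (sort_of M') z = case_sum S (sort_of M \<circ> g) z"
    using assms(2) by (cases z rule: sum.exhaust) (auto simp: params_def)
qed

lemma elem_map_sort:
  assumes "elem_map L M A g M'" "a \<in> A" "a \<in> univ M"
  shows "sort_of M' (g a) = sort_of M a"
proof -
  have "a \<in> dom (sort_of M |` A)" using assms by auto
  then have "sort_of M' (g a) = (sort_of M |` A) a"
    using assms(1) unfolding same_type_def assigns_def by blast
  with assms show ?thesis by simp
qed

lemma elem_map_inst:
  assumes "elem_map L M' A g M" "\<phi> \<in> global_formulas L S M'" "params \<phi> \<subseteq> A"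
  shows "inst g \<phi> \<in> global_formulas L S M"
  using assms params_subset[OF assms(2)] by (intro inst_global_formulas) (auto intro: elem_map_sort)

lemma elem_map_subset: "elem_map L M A g M' \<Longrightarrow> B \<subseteq> A \<Longrightarrow> elem_map L M B g M'"
  by (erule same_type_map_le) (auto simp: map_le_def)

lemma elem_map_comp:
  assumes "elem_map L M1 A g M2" "elem_map L M2 (g ` A) h M3"
  shows "elem_map L M1 A (h \<circ> g) M3"
proof -
  have "sort_of M1 |` A \<subseteq>\<^sub>m (sort_of M2 |` (g ` A)) \<circ> g"
    using elem_map_sort[OF assms(1)] by (auto simp: map_le_def restrict_map_def domIff split: if_splits)
  from same_type_comp[OF assms(2) this]
  have "same_type L (sort_of M1 |` A) M2 g M3 (h \<circ> g)" by simp
  with assms(1) show ?thesis by (rule same_type_trans)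
qed

lemma elem_map_aut:
  assumes "is_struct L M" "\<sigma> \<in> automorphisms L M"
  shows "elem_map L M A \<sigma> M"
proof -
  have "id \<in> assigns M (sort_of M |` A)" by (auto simp: assigns_def)
  from same_type_aut[OF assms(1) this assms(2)] show ?thesis by simp
qed

section \<open>Complete global types\<close>

lemma complete_typesD:
  assumes "p \<in> complete_types L S M"
  shows "p \<subseteq> global_formulas L S M"
    and "\<And>\<Phi>. \<Phi> \<subseteq> p \<Longrightarrow> finite \<Phi> \<Longrightarrow> \<exists>v\<in>assigns M S. \<forall>\<phi>\<in>\<Phi>. sat M (case_sum v id) [] \<phi>"
    and "\<And>\<phi>. \<phi> \<in> global_formulas L S M \<Longrightarrow> Neg \<phi> \<in> p \<longleftrightarrow> \<phi> \<notin> p"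
proof -
  show "p \<subseteq> global_formulas L S M" using assms by (simp add: complete_types_def formulas_over_univ)
  show *: "\<exists>v\<in>assigns M S. \<forall>\<phi>\<in>\<Phi>. sat M (case_sum v id) [] \<phi>" if "\<Phi> \<subseteq> p" "finite \<Phi>" for \<Phi>
    using assms that by (auto simp: complete_types_def fin_sat_def realizes_def)
  show "Neg \<phi> \<in> p \<longleftrightarrow> \<phi> \<notin> p" if "\<phi> \<in> global_formulas L S M" for \<phi>
    using that assms *[of "{\<phi>, Neg \<phi>}"] by (auto simp: complete_types_def formulas_over_univ)
qed

lemma complete_typesI:
  assumes "p \<subseteq> global_formulas L S M"
    and "\<And>\<Phi>. \<Phi> \<subseteq> p \<Longrightarrow> finite \<Phi> \<Longrightarrow> \<exists>v\<in>assigns M S. \<forall>\<phi>\<in>\<Phi>. sat M (case_sum v id) [] \<phi>"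
    and "\<And>\<phi>. \<phi> \<in> global_formulas L S M \<Longrightarrow> \<phi> \<in> p \<or> Neg \<phi> \<in> p"
  shows "p \<in> complete_types L S M"
  using assms by (auto simp: complete_types_def fin_sat_def realizes_def formulas_over_univ)

lemma complete_types_eqI:
  assumes "p \<in> complete_types L S M" "q \<in> complete_types L S M"
    "\<And>\<phi>. \<phi> \<in> global_formulas L S M \<Longrightarrow> \<phi> \<in> p \<Longrightarrow> \<phi> \<in> q"
  shows "p = q"
proof
  show "p \<subseteq> q" using assms complete_typesD(1)[OF assms(1)] by blast
  show "q \<subseteq> p"
  proof
    fix \<phi> assume "\<phi> \<in> q"
    then have f: "\<phi> \<in> global_formulas L S M" using complete_typesD(1)[OF assms(2)] by blast
    then show "\<phi> \<in> p"
      using assms(3)[of "Neg \<phi>"] complete_typesD(3)[OF assms(1) f] complete_typesD(3)[OF assms(2) f] \<open>\<phi> \<in> q\<close>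
      by auto
  qed
qed

lemma type_spaceD: "p \<in> type_space L S X M \<Longrightarrow> p \<in> complete_types L S M"
  by (simp add: type_space_def)

text \<open>Take an ultrafilter on assignments that contains the solution sets of all formulas in
  \<open>p\<close>, and collect what holds for almost all assignments.\<close>

lemma exists_complete_type:
  assumes p: "p \<subseteq> global_formulas L S M"
    and fs: "\<And>\<Phi>. \<Phi> \<subseteq> p \<Longrightarrow> finite \<Phi> \<Longrightarrow> \<exists>v\<in>assigns M S. \<forall>\<phi>\<in>\<Phi>. sat M (case_sum v id) [] \<phi>"
  shows "\<exists>q\<in>complete_types L S M. p \<subseteq> q"
proof -
  let ?B = "\<lambda>\<phi>. {v\<in>assigns M S. sat M (case_sum v id) [] \<phi>}"
  \<comment> \<open>The set of well-sorted assignments is added explicitly, so that the ultrafilter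
    concentrates on it even if \<open>p\<close> is empty.\<close>
  have "\<exists>U. ultrafilter U \<and> (\<forall>A\<in>insert (assigns M S) (?B ` p). eventually (\<lambda>v. v \<in> A) U)"
  proof (rule ultrafilter_of_fip)
    fix \<F>' assume \<F>': "finite \<F>'" "\<F>' \<subseteq> insert (assigns M S) (?B ` p)"
    then have "finite (\<F>' - {assigns M S})" "\<F>' - {assigns M S} \<subseteq> ?B ` p" by auto
    then obtain \<Phi> where \<Phi>: "\<Phi> \<subseteq> p" "finite \<Phi>" "\<F>' - {assigns M S} = ?B ` \<Phi>"
      by (meson finite_subset_image)
    from fs[OF this(1,2)] obtain v where v: "v \<in> assigns M S" "\<forall>\<phi>\<in>\<Phi>. sat M (case_sum v id) [] \<phi>" by blast
    have "v \<in> A" if "A \<in> \<F>'" for A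
    proof (cases "A = assigns M S")
      case False
      with that have "A \<in> ?B ` \<Phi>" using \<Phi>(3) by blast
      with v show ?thesis by auto
    qed (use v in simp)
    then show "\<Inter>\<F>' \<noteq> {}" by blast
  qed
  then obtain U where U: "ultrafilter U" "\<And>A. A \<in> insert (assigns M S) (?B ` p) \<Longrightarrow> eventually (\<lambda>v. v \<in> A) U"
    by blast
  let ?q = "{\<phi> \<in> global_formulas L S M. eventually (\<lambda>v. sat M (case_sum v id) [] \<phi>) U}"
  have a: "eventually (\<lambda>v. v \<in> assigns M S) U" using U(2) by blast
  have "?q \<in> complete_types L S M"
  proof (rule complete_typesI)
    fix \<Phi> assume \<Phi>: "\<Phi> \<subseteq> ?q" "finite \<Phi>"
    then have "eventually (\<lambda>v. \<forall>\<phi>\<in>\<Phi>. sat M (case_sum v id) [] \<phi>) U"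
      by (intro eventually_ball_finite) auto
    then have "eventually (\<lambda>v. v \<in> assigns M S \<and> (\<forall>\<phi>\<in>\<Phi>. sat M (case_sum v id) [] \<phi>)) U"
      using a by (rule eventually_conj[rotated])
    then show "\<exists>v\<in>assigns M S. \<forall>\<phi>\<in>\<Phi>. sat M (case_sum v id) [] \<phi>"
      using U(1) eventually_happens' unfolding ultrafilter_def by blast
  next
    fix \<phi> assume "\<phi> \<in> global_formulas L S M"
    then show "\<phi> \<in> ?q \<or> Neg \<phi> \<in> ?q" using U(1) by (auto simp: ultrafilter_def)
  qed auto
  moreover have "p \<subseteq> ?q"
  proof
    fix \<phi> assume "\<phi> \<in> p"
    then have "eventually (\<lambda>v. v \<in> ?B \<phi>) U" using U(2) by blast
    then have "eventually (\<lambda>v. sat M (case_sum v id) [] \<phi>) U" by (rule eventually_mono) auto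
    with \<open>\<phi> \<in> p\<close> p show "\<phi> \<in> ?q" by blast
  qed
  ultimately show ?thesis by blast
qed

section \<open>The action of automorphisms on global types\<close>

lemma aut_inv_apply:
  assumes "\<sigma> \<in> automorphisms L M" "a \<in> univ M"
  shows "inv_into (univ M) \<sigma> (\<sigma> a) = a" "\<sigma> (inv_into (univ M) \<sigma> a) = a"
  using aut_bij[OF assms(1)] assms(2) by (auto simp: bij_betw_inv_into_left bij_betw_inv_into_right)

lemma aut_inst:
  assumes "\<sigma> \<in> automorphisms L M" "\<phi> \<in> global_formulas L S M"
  shows "inst \<sigma> \<phi> \<in> global_formulas L S M"
  using assms params_subset[OF assms(2)] aut_sort_eq[OF assms(1)]
  by (intro inst_global_formulas[OF assms(2)]) auto

lemma inst_inv:
  assumes "\<sigma> \<in> automorphisms L M" "\<phi> \<in> global_formulas L S M"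
  shows "inst (inv_into (univ M) \<sigma>) (inst \<sigma> \<phi>) = \<phi>" "inst \<sigma> (inst (inv_into (univ M) \<sigma>) \<phi>) = \<phi>"
  unfolding inst_inst using params_subset[OF assms(2)] aut_inv_apply[OF assms(1)]
  by (intro inst_id; auto)+

lemma type_action_inst_iff:
  assumes "\<sigma> \<in> automorphisms L M" "\<phi> \<in> global_formulas L S M" "p \<subseteq> global_formulas L S M"
  shows "inst \<sigma> \<phi> \<in> type_action \<sigma> p \<longleftrightarrow> \<phi> \<in> p"
proof
  assume "inst \<sigma> \<phi> \<in> type_action \<sigma> p"
  then obtain \<psi> where \<psi>: "\<psi> \<in> p" "inst \<sigma> \<phi> = inst \<sigma> \<psi>" by (auto simp: type_action_def)
  then have "\<psi> \<in> global_formulas L S M" using assms(3) by blast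
  from inst_inv(1)[OF assms(1) this] inst_inv(1)[OF assms(1,2)] \<psi> show "\<phi> \<in> p" by simp
qed (auto simp: type_action_def)

lemma type_action_iff:
  assumes "is_struct L M" "\<sigma> \<in> automorphisms L M" "\<phi> \<in> global_formulas L S M" "p \<subseteq> global_formulas L S M"
  shows "\<phi> \<in> type_action \<sigma> p \<longleftrightarrow> inst (inv_into (univ M) \<sigma>) \<phi> \<in> p"
  using type_action_inst_iff[OF assms(2) aut_inst[OF aut_inv[OF assms(1,2)] assms(3)] assms(4)]
  by (simp add: inst_inv(2)[OF assms(2,3)])

lemma type_action_formulas:
  assumes "\<sigma> \<in> automorphisms L M" "p \<subseteq> global_formulas L S M"
  shows "type_action \<sigma> p \<subseteq> global_formulas L S M"
  unfolding type_action_def using assms(2) aut_inst[OF assms(1)] by blast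

lemma type_action_inv_iff:
  assumes "is_struct L M" "\<sigma> \<in> automorphisms L M" "\<phi> \<in> global_formulas L S M" "p \<subseteq> global_formulas L S M"
  shows "\<phi> \<in> type_action (inv_into (univ M) \<sigma>) p \<longleftrightarrow> inst \<sigma> \<phi> \<in> p"
proof -
  have "inst \<sigma> \<phi> \<in> p \<longleftrightarrow> inst (inv_into (univ M) \<sigma>) (inst \<sigma> \<phi>) \<in> type_action (inv_into (univ M) \<sigma>) p"
    using type_action_inst_iff[OF aut_inv[OF assms(1,2)] aut_inst[OF assms(2,3)] assms(4)] by simp
  then show ?thesis by (simp add: inst_inv(1)[OF assms(2,3)])
qed

lemma type_action_complete_types:
  assumes "is_struct L M" "\<sigma> \<in> automorphisms L M" "p \<in> complete_types L S M"
  shows "type_action \<sigma> p \<in> complete_types L S M"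
proof (rule complete_typesI)
  let ?i = "inv_into (univ M) \<sigma>"
  note p = complete_typesD[OF assms(3)]
  show "type_action \<sigma> p \<subseteq> global_formulas L S M" using assms(2) p(1) by (rule type_action_formulas)
  fix \<Phi> assume \<Phi>: "\<Phi> \<subseteq> type_action \<sigma> p" "finite \<Phi>"
  then obtain \<Psi> where \<Psi>: "\<Psi> \<subseteq> p" "finite \<Psi>" "\<Phi> = inst \<sigma> ` \<Psi>"
    unfolding type_action_def by (meson finite_subset_image)
  from p(2)[OF \<Psi>(1,2)] obtain v where v: "v \<in> assigns M S" "\<forall>\<psi>\<in>\<Psi>. sat M (case_sum v id) [] \<psi>" by blast
  have cs: "case_sum v id \<in> assigns M (case_sum S (sort_of M))"
    using v(1) by (auto simp: assigns_def split: sum.splits)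
  have eq: "\<sigma> \<circ> case_sum v id = case_sum (\<sigma> \<circ> v) \<sigma>" by (auto simp: fun_eq_iff split: sum.splits)
  have "sat M (case_sum (\<sigma> \<circ> v) id) [] (inst \<sigma> \<psi>)" if "\<psi> \<in> \<Psi>" for \<psi>
    using same_type_sat[OF same_type_aut[OF assms(1) cs assms(2)], of \<psi>] that \<Psi>(1) p(1) v(2)
    unfolding sat_inst eq by auto
  moreover have "\<sigma> \<circ> v \<in> assigns M S"
    using v(1) assms(2) same_type_aut[OF assms(1) v(1) assms(2)] by (simp add: same_type_def)
  ultimately show "\<exists>v\<in>assigns M S. \<forall>\<phi>\<in>\<Phi>. sat M (case_sum v id) [] \<phi>" using \<Psi>(3) by blast
next
  fix \<phi> assume \<phi>: "\<phi> \<in> global_formulas L S M"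
  let ?i = "inv_into (univ M) \<sigma>"
  note p = complete_typesD[OF assms(3)]
  have "inst ?i \<phi> \<in> global_formulas L S M" by (rule aut_inst[OF aut_inv[OF assms(1,2)] \<phi>])
  from p(3)[OF this] show "\<phi> \<in> type_action \<sigma> p \<or> Neg \<phi> \<in> type_action \<sigma> p"
    using type_action_iff[OF assms(1,2) \<phi> p(1)] type_action_iff[OF assms(1,2) _ p(1), of "Neg \<phi>"] \<phi> by auto
qed

lemma type_action_type_space:
  assumes "is_struct L M" "\<sigma> \<in> automorphisms L M" "p \<in> type_space L S X M"
  shows "type_action \<sigma> p \<in> type_space L S X M"
proof -
  have "map_fm Inl ` X \<subseteq> type_action \<sigma> p"
  proof (rule image_subsetI)
    fix \<psi> assume "\<psi> \<in> X"
    then have "map_fm Inl \<psi> \<in> p" using assms(3) by (auto simp: type_space_def)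
    then have "inst \<sigma> (map_fm Inl \<psi>) \<in> type_action \<sigma> p" unfolding type_action_def by (rule imageI)
    then show "map_fm Inl \<psi> \<in> type_action \<sigma> p" by simp
  qed
  then show ?thesis
    using type_action_complete_types[OF assms(1,2)] assms(3) unfolding type_space_def by blast
qed

lemma type_action_comp: "type_action \<sigma> (type_action \<tau> p) = type_action (\<sigma> \<circ> \<tau>) p"
  by (auto simp: type_action_def image_image inst_inst)

lemma type_action_inv:
  assumes "\<sigma> \<in> automorphisms L M" "p \<subseteq> global_formulas L S M"
  shows "type_action (inv_into (univ M) \<sigma>) (type_action \<sigma> p) = p"
    "type_action \<sigma> (type_action (inv_into (univ M) \<sigma>) p) = p"
proof -
  have *: "inst (inv_into (univ M) \<sigma>) (inst \<sigma> \<phi>) = \<phi>" "inst \<sigma> (inst (inv_into (univ M) \<sigma>) \<phi>) = \<phi>"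
    if "\<phi> \<in> p" for \<phi> using inst_inv[OF assms(1)] assms(2) that by blast+
  then show "type_action (inv_into (univ M) \<sigma>) (type_action \<sigma> p) = p"
    "type_action \<sigma> (type_action (inv_into (univ M) \<sigma>) p) = p"
    by (auto simp: type_action_def image_image)
qed

section \<open>Comparing families of types by content\<close>

text \<open>
  A family \<open>q\<close> of types over \<open>M'\<close> lies below a family \<open>p\<close> of types over \<open>M\<close> if every finite piece of
  \<open>q\<close> is copied from \<open>p\<close> by a finite partial elementary map; equivalently, the content of each finite
  subfamily of \<open>q\<close> is contained in the content of the corresponding subfamily of \<open>p\<close>.
\<close>

definition below ::
  "('f, 'r, 's) lang \<Rightarrow> ('i \<rightharpoonup> 's) \<Rightarrow> 'k set \<Rightarrow> ('f, 'r, 's, 'a) struct \<Rightarrow> ('k \<Rightarrow> ('f, 'r, 's, 'i + 'a) fm set)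
     \<Rightarrow> ('f, 'r, 's, 'b) struct \<Rightarrow> ('k \<Rightarrow> ('f, 'r, 's, 'i + 'b) fm set) \<Rightarrow> bool" where
  "below L S K M' q M p \<longleftrightarrow>
     (\<forall>Z. finite Z \<and> Z \<subseteq> K \<times> global_formulas L S M' \<longrightarrow>
        (\<exists>g. elem_map L M' (\<Union>z\<in>Z. params (snd z)) g M \<and> (\<forall>(k, \<phi>)\<in>Z. \<phi> \<in> q k \<longleftrightarrow> inst g \<phi> \<in> p k)))"

lemma belowD:
  assumes "below L S K M' q M p" "finite Z" "Z \<subseteq> K \<times> global_formulas L S M'"
  obtains g where "elem_map L M' (\<Union>z\<in>Z. params (snd z)) g M"
    "\<And>k \<phi>. (k, \<phi>) \<in> Z \<Longrightarrow> \<phi> \<in> q k \<longleftrightarrow> inst g \<phi> \<in> p k"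
  using assms unfolding below_def by (metis (mono_tags, lifting) case_prodD)

lemma below_trans:
  assumes "below L S K M1 p M2 q" "below L S K M2 q M3 r"
  shows "below L S K M1 p M3 r"
  unfolding below_def
proof (intro allI impI)
  fix Z assume Z: "finite Z \<and> Z \<subseteq> K \<times> global_formulas L S M1"
  then obtain g where g: "elem_map L M1 (\<Union>z\<in>Z. params (snd z)) g M2"
    "\<And>k \<phi>. (k, \<phi>) \<in> Z \<Longrightarrow> \<phi> \<in> p k \<longleftrightarrow> inst g \<phi> \<in> q k"
    using belowD[OF assms(1)] by metis
  let ?Z = "map_prod id (inst g) ` Z"
  have "?Z \<subseteq> K \<times> global_formulas L S M2"
  proof (clarsimp, intro conjI)
    fix k \<phi> assume kz: "(k, \<phi>) \<in> Z"
    then show "k \<in> K" using Z by auto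
    have "params \<phi> \<subseteq> (\<Union>z\<in>Z. params (snd z))" using kz by force
    then show "inst g \<phi> \<in> global_formulas L S M2" using g(1) Z kz by (intro elem_map_inst) auto
  qed
  then obtain h where h: "elem_map L M2 (\<Union>z\<in>?Z. params (snd z)) h M3"
    "\<And>k \<phi>. (k, \<phi>) \<in> ?Z \<Longrightarrow> \<phi> \<in> q k \<longleftrightarrow> inst h \<phi> \<in> r k"
    using belowD[OF assms(2), of ?Z] Z by blast
  have "(\<Union>z\<in>?Z. params (snd z)) = g ` (\<Union>z\<in>Z. params (snd z))"
    by (auto simp: params_inst)
  with g h have "elem_map L M1 (\<Union>z\<in>Z. params (snd z)) (h \<circ> g) M3"
    by (metis elem_map_comp)
  moreover have "\<phi> \<in> p k \<longleftrightarrow> inst (h \<circ> g) \<phi> \<in> r k" if "(k, \<phi>) \<in> Z" for k \<phi>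
  proof -
    have "(k, inst g \<phi>) \<in> ?Z" using that by force
    from g(2)[OF that] h(2)[OF this] show ?thesis by (simp add: inst_inst)
  qed
  ultimately show "\<exists>g. elem_map L M1 (\<Union>z\<in>Z. params (snd z)) g M3 \<and> (\<forall>(k, \<phi>)\<in>Z. \<phi> \<in> p k \<longleftrightarrow> inst g \<phi> \<in> r k)"
    by blast
qed

text \<open>The index map may be any map, in particular one between type spaces. Statements about a
  map \<open>f\<close> of types thus become statements about \<open>f \<circ> g\<close>.\<close>

lemma below_reindex:
  assumes "below L S K M' q M p" "j ` K' \<subseteq> K"
  shows "below L S K' M' (q \<circ> j) M (p \<circ> j)"
  unfolding below_def
proof (intro allI impI)
  fix Z assume Z: "finite Z \<and> Z \<subseteq> K' \<times> global_formulas L S M'"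
  let ?Z = "map_prod j id ` Z"
  have "finite ?Z" "?Z \<subseteq> K \<times> global_formulas L S M'" using Z assms(2) by auto
  then obtain g where g: "elem_map L M' (\<Union>z\<in>?Z. params (snd z)) g M"
    "\<And>k \<phi>. (k, \<phi>) \<in> ?Z \<Longrightarrow> \<phi> \<in> q k \<longleftrightarrow> inst g \<phi> \<in> p k"
    using belowD[OF assms(1)] by metis
  have "(\<Union>z\<in>?Z. params (snd z)) = (\<Union>z\<in>Z. params (snd z))" by auto
  moreover have "\<phi> \<in> q (j k) \<longleftrightarrow> inst g \<phi> \<in> p (j k)" if "(k, \<phi>) \<in> Z" for k \<phi>
    using g(2)[of "j k" \<phi>] that by force
  ultimately show "\<exists>g. elem_map L M' (\<Union>z\<in>Z. params (snd z)) g M \<and>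
     (\<forall>(k, \<phi>)\<in>Z. \<phi> \<in> (q \<circ> j) k \<longleftrightarrow> inst g \<phi> \<in> (p \<circ> j) k)"
    using g(1) by auto
qed

lemma below_cong:
  assumes "below L S K M' q M p" "\<And>k. k \<in> K \<Longrightarrow> q k = q' k" "\<And>k. k \<in> K \<Longrightarrow> p k = p' k"
  shows "below L S K M' q' M p'"
  unfolding below_def
proof (intro allI impI)
  fix Z assume Z: "finite Z \<and> Z \<subseteq> K \<times> global_formulas L S M'"
  then obtain g where g: "elem_map L M' (\<Union>z\<in>Z. params (snd z)) g M"
    "\<And>k \<phi>. (k, \<phi>) \<in> Z \<Longrightarrow> \<phi> \<in> q k \<longleftrightarrow> inst g \<phi> \<in> p k"
    using belowD[OF assms(1)] by metis
  have "\<phi> \<in> q' k \<longleftrightarrow> inst g \<phi> \<in> p' k" if "(k, \<phi>) \<in> Z" for k \<phi>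
    using g(2)[OF that] that Z assms(2,3) by auto
  with g(1) show "\<exists>g. elem_map L M' (\<Union>z\<in>Z. params (snd z)) g M \<and>
     (\<forall>(k, \<phi>)\<in>Z. \<phi> \<in> q' k \<longleftrightarrow> inst g \<phi> \<in> p' k)" by blast
qed

context monster_model
begin

text \<open>\<open>dom S\<close> may exceed \<kappa>, but finitely many formulas mention finitely
  many names. Only those are realized in \<open>M\<close>, with the given parameters kept in
  place.\<close>

lemma transfer_solution:
  fixes Sg :: "'n \<rightharpoonup> 's" and M' :: "('f, 'r, 's, 'b) struct" and S :: "'i \<rightharpoonup> 's"
  assumes st: "same_type L Sg M' u M w"
    and \<Phi>: "finite \<Phi>" "\<Phi> \<subseteq> formulas L (case_sum S Sg)"
    and v: "v \<in> assigns M' S" "\<And>\<phi>. \<phi> \<in> \<Phi> \<Longrightarrow> sat M' (case_sum v u) [] \<phi>"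
  shows "\<exists>v'\<in>assigns M S. \<forall>\<phi>\<in>\<Phi>. sat M (case_sum v' w) [] \<phi>"
proof -
  define F where "F = (\<Union>\<phi>\<in>\<Phi>. set_fm \<phi>)"
  have F: "finite F" "F \<subseteq> dom (case_sum S Sg)"
    unfolding F_def using \<Phi> finite_set_fm formulas_dom[of _ L "case_sum S Sg"] by blast+
  let ?Sg = "case_sum S Sg |` F"
  have dom: "dom ?Sg = F" using F by auto
  let ?V0 = "F \<inter> range Inr"
  let ?w0 = "case_sum (\<lambda>_. undefined) w :: 'i + 'n \<Rightarrow> 'a"
  have b: "same_type L (?Sg |` ?V0) M' (case_sum v u) M ?w0"
  proof -
    define j where "j = (\<lambda>z :: 'i + 'n. case z of Inl _ \<Rightarrow> undefined | Inr n \<Rightarrow> n)"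
    have "same_type L (?Sg |` ?V0) M' (u \<circ> j) M (w \<circ> j)"
      using st by (rule same_type_comp) (auto simp: map_le_def j_def restrict_map_def split: sum.splits if_splits)
    then show ?thesis by (rule same_type_cong) (auto simp: j_def)
  qed
  have cs: "case_sum v u \<in> assigns M' ?Sg"
  proof -
    have "u \<in> assigns M' Sg" using st by (simp add: same_type_def)
    then have "case_sum v u \<in> assigns M' (case_sum S Sg)"
      using v(1) by (auto simp: assigns_def split: sum.splits)
    then show ?thesis by (rule assigns_map_le) (auto simp: map_le_def)
  qed
  have "?V0 \<subseteq> dom ?Sg" "|dom ?Sg| <o \<kappa>" using dom F finite_small by auto
  from realize_same_type[OF b cs this]
  obtain v2 where v2: "same_type L ?Sg M' (case_sum v u) M v2" "\<forall>x\<in>?V0. v2 x = ?w0 x" by blast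
  \<comment> \<open>Variables that do not occur still need values of the right sort, and
    nonemptiness of the sorts supplies them.\<close>
  define v' where "v' = (\<lambda>i. if Inl i \<in> F then v2 (Inl i) else SOME a. sort_of M a = S i)"
  have "v' \<in> assigns M S" unfolding assigns_def
  proof (intro CollectI ballI)
    fix i assume i: "i \<in> dom S"
    show "sort_of M (v' i) = S i"
    proof (cases "Inl i \<in> F")
      case True
      then have "Inl i \<in> dom ?Sg" using dom by simp
      then have "sort_of M (v2 (Inl i)) = ?Sg (Inl i)"
        using v2(1) unfolding same_type_def assigns_def by blast
      with True show ?thesis by (simp add: v'_def)
    next
      case False
      obtain s where s: "S i = Some s" using i by auto
      then have "\<exists>a. sort_of M a = S i" using struct by (simp add: is_struct_def)
      then have "sort_of M (SOME a. sort_of M a = S i) = S i" by (rule someI_ex)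
      with False show ?thesis by (simp add: v'_def)
    qed
  qed
  moreover have "sat M (case_sum v' w) [] \<phi>" if "\<phi> \<in> \<Phi>" for \<phi>
  proof -
    have sub: "set_fm \<phi> \<subseteq> F" using that by (auto simp: F_def)
    then have "\<phi> \<in> formulas L ?Sg" using that \<Phi>(2) by (auto simp: formulas_restrict_iff)
    from same_type_sat[OF v2(1) this] v(2)[OF that] have "sat M v2 [] \<phi>" by simp
    moreover have "sat M v2 [] \<phi> \<longleftrightarrow> sat M (case_sum v' w) [] \<phi>"
    proof (rule sat_cong)
      fix z assume "z \<in> set_fm \<phi>"
      then have "z \<in> F" using sub by auto
      then show "v2 z = case_sum v' w z" using v2(2) by (cases z rule: sum.exhaust) (auto simp: v'_def)
    qed
    ultimately show ?thesis by simp
  qed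
  ultimately show ?thesis by blast
qed

lemma elem_map_extend:
  fixes M' :: "('f, 'r, 's, 'b) struct"
  assumes "elem_map L M' A g M" "|B| <o \<kappa>" "A \<subseteq> B"
  shows "\<exists>h. elem_map L M' B h M \<and> (\<forall>a\<in>A \<inter> univ M'. h a = g a)"
proof -
  let ?Sg = "sort_of M' |` B"
  have d: "dom ?Sg = univ M' \<inter> B" by auto
  have "?Sg |` (A \<inter> univ M') = sort_of M' |` A"
    using assms(3) by (auto simp: restrict_map_def fun_eq_iff domIff)
  then have 1: "same_type L (?Sg |` (A \<inter> univ M')) M' id M g" using assms(1) by simp
  have 2: "id \<in> assigns M' ?Sg" by (auto simp: assigns_def)
  have "A \<inter> univ M' \<subseteq> dom ?Sg" "|dom ?Sg| <o \<kappa>"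
    using assms(2,3) card_subset_ordLess[of B \<kappa> "univ M' \<inter> B"] d by auto
  from realize_same_type[OF 1 2 this] show ?thesis by blast
qed

text \<open>
  Compactness: a family over \<open>M\<close> lying below a subfamily of \<open>p\<close> extends to a family below all of \<open>p\<close>.
  The new types are ultralimits of the pullbacks of \<open>p\<close> along finite partial elementary maps.
\<close>

lemma extend_below:
  fixes M' :: "('f, 'r, 's, 'b) struct" and K :: "'x set" and S :: "'i \<rightharpoonup> 's"
  assumes M': "monster_model L T \<kappa>' M'" and X: "X \<subseteq> formulas L S"
    and K0: "K0 \<subseteq> K" and p: "p \<in> K \<rightarrow> type_space L S X M'" and q: "q \<in> K0 \<rightarrow> type_space L S X M"
    and bel: "below L S K0 M q M' p"
  shows "\<exists>q'\<in>K \<rightarrow> type_space L S X M. (\<forall>k\<in>K0. q' k = q k) \<and> below L S K M q' M' p"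
proof -
  interpret M': monster_model L T \<kappa>' M' by (rule M')
  let ?G = "global_formulas L S M"
  let ?I = "{Z. finite Z \<and> Z \<subseteq> K \<times> ?G}"
  let ?P = "\<lambda>Z. \<Union>z\<in>Z. params (snd z)"
  have "\<exists>g. elem_map L M (?P Z) g M' \<and> (\<forall>(k, \<phi>)\<in>Z. k \<in> K0 \<longrightarrow> (\<phi> \<in> q k \<longleftrightarrow> inst g \<phi> \<in> p k))" if "Z \<in> ?I" for Z
  proof -
    let ?Z0 = "Z \<inter> K0 \<times> UNIV"
    have "finite ?Z0" "?Z0 \<subseteq> K0 \<times> ?G" using that by auto
    then obtain g where g: "elem_map L M (?P ?Z0) g M'"
      "\<And>k \<phi>. (k, \<phi>) \<in> ?Z0 \<Longrightarrow> \<phi> \<in> q k \<longleftrightarrow> inst g \<phi> \<in> p k"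
      using belowD[OF bel] by metis
    have "finite (?P Z)" using that finite_params by blast
    then have "|?P Z| <o \<kappa>'" by (rule M'.finite_small)
    moreover have "?P ?Z0 \<subseteq> ?P Z" by auto
    ultimately obtain h where h: "elem_map L M (?P Z) h M'" "\<forall>a\<in>?P ?Z0 \<inter> univ M. h a = g a"
      using M'.elem_map_extend[OF g(1)] by blast
    have "\<phi> \<in> q k \<longleftrightarrow> inst h \<phi> \<in> p k" if kz: "(k, \<phi>) \<in> Z" "k \<in> K0" for k \<phi>
    proof -
      have "params \<phi> \<subseteq> ?P ?Z0" using kz by force
      moreover have "params \<phi> \<subseteq> univ M" using kz \<open>Z \<in> ?I\<close> params_subset by blast
      ultimately have "inst h \<phi> = inst g \<phi>" using h(2) by (intro inst_cong) blast
      with g(2)[of k \<phi>] kz show ?thesis by auto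
    qed
    with h(1) show ?thesis by blast
  qed
  then obtain G where G: "\<And>Z. Z \<in> ?I \<Longrightarrow> elem_map L M (?P Z) (G Z) M'"
    "\<And>Z k \<phi>. Z \<in> ?I \<Longrightarrow> (k, \<phi>) \<in> Z \<Longrightarrow> k \<in> K0 \<Longrightarrow> \<phi> \<in> q k \<longleftrightarrow> inst (G Z) \<phi> \<in> p k"
    by (metis (mono_tags, lifting) case_prodD)
  \<comment> \<open>The cones over finite pieces have the finite intersection property, because the
    union of finitely many pieces lies in all their cones. An ultrafilter containing the cones
    eventually passes every given piece.\<close>
  let ?C = "\<lambda>Z. {Z' \<in> ?I. Z \<subseteq> Z'}"
  have "\<exists>U. ultrafilter U \<and> (\<forall>A\<in>?C ` ?I. eventually (\<lambda>Z. Z \<in> A) U)"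
  proof (rule ultrafilter_of_fip)
    fix \<F>' assume "finite \<F>'" "\<F>' \<subseteq> ?C ` ?I"
    then obtain \<Z> where \<Z>: "finite \<Z>" "\<Z> \<subseteq> ?I" "\<F>' = ?C ` \<Z>" by (meson finite_subset_image)
    then have "\<Union>\<Z> \<in> ?I" by auto
    then have "\<Union>\<Z> \<in> \<Inter>\<F>'" unfolding \<Z>(3) by auto
    then show "\<Inter>\<F>' \<noteq> {}" by blast
  qed
  then obtain U where U: "ultrafilter U" "\<And>A. A \<in> ?C ` ?I \<Longrightarrow> eventually (\<lambda>Z. Z \<in> A) U"
    by blast
  \<comment> \<open>The map \<open>G Z\<close> is elementary only on the parameters of
    \<open>Z\<close>. For a fixed formula the pullback is still meaningful, since almost every
    \<open>Z\<close> contains that formula paired with \<open>k\<close>.\<close>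
  define q' where "q' = (\<lambda>k. {\<phi> \<in> ?G. eventually (\<lambda>Z. inst (G Z) \<phi> \<in> p k) U})"
  have key: "\<exists>Z'\<in>?I. Z \<subseteq> Z' \<and> (\<forall>(k, \<phi>)\<in>Z. \<phi> \<in> q' k \<longleftrightarrow> inst (G Z') \<phi> \<in> p k)" if "Z \<in> ?I" for Z
  proof -
    have "eventually (\<lambda>Z'. case z of (k, \<phi>) \<Rightarrow> \<phi> \<in> q' k \<longleftrightarrow> inst (G Z') \<phi> \<in> p k) U" if "z \<in> Z" for z
    proof -
      obtain k \<phi> where z: "z = (k, \<phi>)" by force
      then have "\<phi> \<in> ?G" using that \<open>Z \<in> ?I\<close> by auto
      then show ?thesis
        using ultrafilter_Not[OF U(1), of "\<lambda>Z'. inst (G Z') \<phi> \<in> p k"]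
        by (cases "\<phi> \<in> q' k") (auto simp: z q'_def)
    qed
    then have "eventually (\<lambda>Z'. \<forall>z\<in>Z. case z of (k, \<phi>) \<Rightarrow> \<phi> \<in> q' k \<longleftrightarrow> inst (G Z') \<phi> \<in> p k) U"
      using that by (intro eventually_ball_finite) auto
    moreover have "eventually (\<lambda>Z'. Z' \<in> ?C Z) U" using U(2) that by blast
    ultimately have "eventually (\<lambda>Z'. Z' \<in> ?C Z \<and> (\<forall>z\<in>Z. case z of (k, \<phi>) \<Rightarrow> \<phi> \<in> q' k \<longleftrightarrow> inst (G Z') \<phi> \<in> p k)) U"
      by (rule eventually_conj[rotated])
    then have "\<exists>Z'. Z' \<in> ?C Z \<and> (\<forall>z\<in>Z. case z of (k, \<phi>) \<Rightarrow> \<phi> \<in> q' k \<longleftrightarrow> inst (G Z') \<phi> \<in> p k)"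
      using U(1) eventually_happens' unfolding ultrafilter_def by blast
    then show ?thesis by blast
  qed
  have key': "\<exists>g. elem_map L M (?P Z) g M' \<and> (\<forall>(k, \<phi>)\<in>Z. \<phi> \<in> q' k \<longleftrightarrow> inst g \<phi> \<in> p k)"
    if Z: "Z \<in> ?I" for Z
  proof -
    obtain Z' where Z': "Z' \<in> ?I" "Z \<subseteq> Z'" "\<forall>(k, \<phi>)\<in>Z. \<phi> \<in> q' k \<longleftrightarrow> inst (G Z') \<phi> \<in> p k"
      using key[OF Z] by blast
    have "?P Z \<subseteq> ?P Z'" using Z'(2) by blast
    with G(1)[OF Z'(1)] have "elem_map L M (?P Z) (G Z') M'" by (rule elem_map_subset)
    with Z'(3) show ?thesis by blast
  qed
  have bel': "below L S K M q' M' p" unfolding below_def using key' by blast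
  have agree: "q' k = q k" if k: "k \<in> K0" for k
  proof (rule set_eqI)
    fix \<phi>
    show "\<phi> \<in> q' k \<longleftrightarrow> \<phi> \<in> q k"
    proof (cases "\<phi> \<in> ?G")
      case True
      then have "{(k, \<phi>)} \<in> ?I" using k K0 by auto
      from key[OF this] obtain Z' where "Z' \<in> ?I" "(k, \<phi>) \<in> Z'" "\<phi> \<in> q' k \<longleftrightarrow> inst (G Z') \<phi> \<in> p k"
        by auto
      with G(2)[of Z' k \<phi>] k show ?thesis by blast
    next
      case False
      have "q k \<in> complete_types L S M" using q k type_spaceD by blast
      with False complete_typesD(1) show ?thesis by (fastforce simp: q'_def)
    qed
  qed
  have "q' k \<in> type_space L S X M" if k: "k \<in> K" for k
  proof -
    have pk: "p k \<in> type_space L S X M'" using p k by blast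
    note pc = complete_typesD[OF type_spaceD[OF pk]]
    have "q' k \<in> complete_types L S M"
    proof (rule complete_typesI)
      show "q' k \<subseteq> ?G" by (auto simp: q'_def)
      fix \<Phi> assume \<Phi>: "\<Phi> \<subseteq> q' k" "finite \<Phi>"
      then have "{k} \<times> \<Phi> \<in> ?I" using k by (auto simp: q'_def)
      from key'[OF this] obtain g where g: "elem_map L M (?P ({k} \<times> \<Phi>)) g M'"
        "\<forall>\<phi>\<in>\<Phi>. \<phi> \<in> q' k \<longleftrightarrow> inst g \<phi> \<in> p k" by auto
      let ?A = "?P ({k} \<times> \<Phi>)"
      have "inst g ` \<Phi> \<subseteq> p k" "finite (inst g ` \<Phi>)" using g(2) \<Phi> by auto
      from pc(2)[OF this] obtain v where v: "v \<in> assigns M' S" "\<forall>\<phi>\<in>\<Phi>. sat M' (case_sum v g) [] \<phi>"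
        by (auto simp: sat_inst)
      have \<Phi>': "\<Phi> \<subseteq> formulas L (case_sum S (sort_of M |` ?A))"
      proof
        fix \<phi> assume \<phi>: "\<phi> \<in> \<Phi>"
        then have "\<phi> \<in> ?G" using \<Phi>(1) by (auto simp: q'_def)
        then show "\<phi> \<in> formulas L (case_sum S (sort_of M |` ?A))"
        proof (rule formulas_cong)
          fix z assume "z \<in> set_fm \<phi>"
          then show "case_sum S (sort_of M) z = case_sum S (sort_of M |` ?A) z"
            using \<phi> by (cases z rule: sum.exhaust) (auto simp: params_def restrict_map_def)
        qed
      qed
      show "\<exists>v\<in>assigns M S. \<forall>\<phi>\<in>\<Phi>. sat M (case_sum v id) [] \<phi>"
        by (rule transfer_solution[OF same_type_sym[OF g(1)] \<Phi>(2) \<Phi>' v(1)]) (use v(2) in blast)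
    next
      fix \<phi> assume \<phi>: "\<phi> \<in> ?G"
      then have "{(k, \<phi>), (k, Neg \<phi>)} \<in> ?I" using k by auto
      from key'[OF this] obtain g where g: "elem_map L M (params \<phi>) g M'"
        "\<phi> \<in> q' k \<longleftrightarrow> inst g \<phi> \<in> p k" "Neg \<phi> \<in> q' k \<longleftrightarrow> Neg (inst g \<phi>) \<in> p k" by auto
      have "inst g \<phi> \<in> global_formulas L S M'" using g(1) \<phi> by (rule elem_map_inst) simp
      from pc(3)[OF this] g show "\<phi> \<in> q' k \<or> Neg \<phi> \<in> q' k" by auto
    qed
    moreover have "map_fm Inl ` X \<subseteq> q' k"
    proof (rule image_subsetI)
      fix \<psi> assume \<psi>: "\<psi> \<in> X"
      then have "map_fm Inl \<psi> \<in> ?G" using X by (auto simp: formulas_map o_def)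
      moreover have "map_fm Inl \<psi> \<in> p k" using pk \<psi> by (auto simp: type_space_def)
      ultimately show "map_fm Inl \<psi> \<in> q' k" by (simp add: q'_def)
    qed
    ultimately show ?thesis by (simp add: type_space_def)
  qed
  with agree bel' show ?thesis by blast
qed

end

section \<open>Compact right topological semigroups\<close>

lemma finite_chain_Inter:
  assumes "finite \<F>" "\<F> \<noteq> {}" "\<And>A B. A \<in> \<F> \<Longrightarrow> B \<in> \<F> \<Longrightarrow> A \<subseteq> B \<or> B \<subseteq> A"
  shows "\<Inter>\<F> \<in> \<F>"
  using assms
proof (induction rule: finite_ne_induct)
  case (insert A \<F>)
  then have "\<Inter>\<F> \<in> \<F>" by blast
  then have "A \<subseteq> \<Inter>\<F> \<or> \<Inter>\<F> \<subseteq> A" using insert.prems by blast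
  then have "A \<inter> \<Inter>\<F> = A \<or> A \<inter> \<Inter>\<F> = \<Inter>\<F>" by blast
  then show ?case using \<open>\<Inter>\<F> \<in> \<F>\<close> by auto
qed simp

text \<open>Compactness keeps the intersection of a chain of nonempty closed sets nonempty; the last
  hypothesis asks that the family then contains it. It is used for closed left ideals and for closed
  subsemigroups.\<close>

lemma compact_space_minimal_closed:
  assumes X: "compact_space X" and ne: "\<A> \<noteq> {}"
    and cl: "\<And>A. A \<in> \<A> \<Longrightarrow> closedin X A \<and> A \<noteq> {}"
    and chain: "\<And>\<C>. \<C> \<subseteq> \<A> \<Longrightarrow> \<C> \<noteq> {} \<Longrightarrow> \<Inter>\<C> \<noteq> {} \<Longrightarrow> closedin X (\<Inter>\<C>) \<Longrightarrow> \<Inter>\<C> \<in> \<A>"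
  shows "\<exists>A\<in>\<A>. \<forall>B\<in>\<A>. B \<subseteq> A \<longrightarrow> B = A"
proof (rule predicate_Zorn[of \<A> "\<lambda>A B. B \<subseteq> A"])
  show "partial_order_on \<A> (relation_of (\<lambda>A B. B \<subseteq> A) \<A>)"
    by (rule partial_order_on_relation_ofI) auto
  fix \<C> assume C: "\<C> \<in> Chains (relation_of (\<lambda>A B. B \<subseteq> A) \<A>)"
  then have sub: "\<C> \<subseteq> \<A>" and lin: "\<And>A B. A \<in> \<C> \<Longrightarrow> B \<in> \<C> \<Longrightarrow> A \<subseteq> B \<or> B \<subseteq> A"
    unfolding Chains_def relation_of_def by blast+
  show "\<exists>u\<in>\<A>. \<forall>a\<in>\<C>. u \<subseteq> a"
  proof (cases "\<C> = {}")
    case True then show ?thesis using ne by blast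
  next
    case False
    have "\<Inter>\<C> \<noteq> {}"
    proof -
      have "\<Inter>\<F> \<noteq> {}" if "finite \<F>" "\<F> \<subseteq> \<C>" for \<F>
      proof (cases "\<F> = {}")
        case False
        then have "\<Inter>\<F> \<in> \<F>" using finite_chain_Inter[OF that(1) False] lin that(2) by blast
        then show ?thesis using cl sub that(2) by blast
      qed auto
      moreover have "\<forall>C\<in>\<C>. closedin X C" using cl sub by blast
      ultimately show ?thesis using X[unfolded compact_space_fip, rule_format, of \<C>] by blast
    qed
    moreover have "closedin X (\<Inter>\<C>)" using False cl sub by (intro closedin_Inter) auto
    ultimately have "\<Inter>\<C> \<in> \<A>" using chain sub False by blast
    then show ?thesis by blast
  qed
qed

text \<open>Continuity is demanded only in the left factor. That is what composition of arbitrary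
  maps offers in the topology of pointwise convergence.\<close>

locale compact_semigroup =
  fixes X :: "'e topology" and m :: "'e \<Rightarrow> 'e \<Rightarrow> 'e" and E
  assumes E: "topspace X = E" and compact: "compact_space X" and Hausdorff: "Hausdorff_space X"
    and nonempty: "E \<noteq> {}"
    and closed: "\<And>x y. x \<in> E \<Longrightarrow> y \<in> E \<Longrightarrow> m x y \<in> E"
    and assoc: "\<And>x y z. x \<in> E \<Longrightarrow> y \<in> E \<Longrightarrow> z \<in> E \<Longrightarrow> m (m x y) z = m x (m y z)"
    and cont: "\<And>x. x \<in> E \<Longrightarrow> continuous_map X X (\<lambda>e. m e x)"
begin

lemma closed_image: "x \<in> E \<Longrightarrow> closedin X C \<Longrightarrow> closedin X ((\<lambda>e. m e x) ` C)"
  using image_compactin[OF closedin_compact_space[OF compact] cont]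
  by (intro compactin_imp_closedin[OF Hausdorff]) blast

lemma principal_left_ideal:
  assumes "x \<in> E"
  shows "left_ideal E m ((\<lambda>e. m e x) ` E)"
  unfolding left_ideal_def
proof (intro conjI ballI)
  fix e y assume "e \<in> E" "y \<in> (\<lambda>e. m e x) ` E"
  then obtain f where "f \<in> E" "y = m f x" by blast
  with \<open>e \<in> E\<close> assms have "m e y = m (m e f) x" "m e f \<in> E" by (simp_all add: assoc closed)
  then show "m e y \<in> (\<lambda>e. m e x) ` E" by blast
qed (use assms closed nonempty in auto)

lemma minimal_left_ideal_eq:
  assumes "minimal_left_ideal E m J" "x \<in> J"
  shows "J = (\<lambda>e. m e x) ` E"
proof -
  have J: "J \<subseteq> E" "\<And>e x. e \<in> E \<Longrightarrow> x \<in> J \<Longrightarrow> m e x \<in> J"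
    using assms(1) by (auto simp: minimal_left_ideal_def left_ideal_def)
  have "left_ideal E m ((\<lambda>e. m e x) ` E)" using J assms(2) by (intro principal_left_ideal) auto
  moreover have "(\<lambda>e. m e x) ` E \<subseteq> J" using J assms(2) by blast
  ultimately show ?thesis using assms(1) unfolding minimal_left_ideal_def by blast
qed

text \<open>Zorn among the closed left ideals inside \<open>J\<close>. A minimal closed one is
  minimal among all left ideals, since each left ideal contains a principal one, which is closed as
  a continuous image of a compact set.\<close>

lemma minimal_left_ideal_exists:
  assumes J: "left_ideal E m J"
  shows "\<exists>K\<subseteq>J. minimal_left_ideal E m K"
proof -
  let ?A = "{K. left_ideal E m K \<and> K \<subseteq> J \<and> closedin X K}"
  have prin: "(\<lambda>e. m e x) ` E \<in> ?A" if "x \<in> J" for x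
  proof -
    have "x \<in> E" using that J by (auto simp: left_ideal_def)
    then have "closedin X ((\<lambda>e. m e x) ` E)" using closed_image[of x E] E closedin_topspace[of X] by simp
    moreover have "(\<lambda>e. m e x) ` E \<subseteq> J" using J that by (auto simp: left_ideal_def)
    ultimately show ?thesis using principal_left_ideal[OF \<open>x \<in> E\<close>] by simp
  qed
  have "\<exists>K\<in>?A. \<forall>B\<in>?A. B \<subseteq> K \<longrightarrow> B = K"
  proof (rule compact_space_minimal_closed[OF compact])
    obtain x where "x \<in> J" using J by (auto simp: left_ideal_def)
    from prin[OF this] show "?A \<noteq> {}" by (metis empty_iff)
    show "closedin X A \<and> A \<noteq> {}" if "A \<in> ?A" for A using that by (auto simp: left_ideal_def)
    show "\<Inter>\<C> \<in> ?A" if C: "\<C> \<subseteq> ?A" "\<C> \<noteq> {}" "\<Inter>\<C> \<noteq> {}" "closedin X (\<Inter>\<C>)" for \<C>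
    proof -
      have D: "left_ideal E m D" "D \<subseteq> J" if "D \<in> \<C>" for D using subsetD[OF C(1) that] by auto
      obtain C0 where "C0 \<in> \<C>" using C(2) by blast
      then have "\<Inter>\<C> \<subseteq> E" "\<Inter>\<C> \<subseteq> J" using D[of C0] unfolding left_ideal_def by blast+
      moreover have "m e x \<in> \<Inter>\<C>" if x: "e \<in> E" "x \<in> \<Inter>\<C>" for e x
      proof
        fix B assume "B \<in> \<C>"
        then have "left_ideal E m B" "x \<in> B" using D(1) x(2) by blast+
        then show "m e x \<in> B" using x(1) by (auto simp: left_ideal_def)
      qed
      ultimately show ?thesis using C(3,4) by (simp add: left_ideal_def)
    qed
  qed
  then obtain K where K: "K \<in> ?A" "\<forall>B\<in>?A. B \<subseteq> K \<longrightarrow> B = K" by (rule bexE)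
  have "minimal_left_ideal E m K" unfolding minimal_left_ideal_def
  proof (intro conjI allI impI)
    show "left_ideal E m K" using K(1) by blast
    fix B assume B: "left_ideal E m B \<and> B \<subseteq> K"
    then obtain x where x: "x \<in> B" by (auto simp: left_ideal_def)
    have "x \<in> J" using x B K(1) by blast
    have sub: "(\<lambda>e. m e x) ` E \<subseteq> B" using B x by (auto simp: left_ideal_def)
    then have "(\<lambda>e. m e x) ` E = K" using K(2)[rule_format, OF prin[OF \<open>x \<in> J\<close>]] B by blast
    with sub B show "B = K" by blast
  qed
  then show ?thesis using K(1) by blast
qed

text \<open>The Ellis-Numakura argument. In a minimal closed subsemigroup \<open>A\<close> of
  \<open>J\<close> pick \<open>x\<close>. Then \<open>A x = A\<close> by minimality, so some
  \<open>a\<close> satisfies \<open>a x = x\<close>; the set of all such \<open>a\<close> is again a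
  closed subsemigroup, hence all of \<open>A\<close>, and \<open>x x = x\<close>.\<close>

lemma idempotent_exists:
  assumes J: "minimal_left_ideal E m J"
  shows "\<exists>u\<in>J. m u u = u"
proof -
  obtain y where y: "y \<in> J" using J by (auto simp: minimal_left_ideal_def left_ideal_def)
  have JE: "J \<subseteq> E" and Jm: "\<And>e x. e \<in> E \<Longrightarrow> x \<in> J \<Longrightarrow> m e x \<in> J"
    using J by (auto simp: minimal_left_ideal_def left_ideal_def)
  have "y \<in> E" using y JE by blast
  then have Jc: "closedin X J"
    using closed_image[of y E] E closedin_topspace[of X] minimal_left_ideal_eq[OF J y] by simp
  let ?A = "{A. A \<noteq> {} \<and> A \<subseteq> J \<and> closedin X A \<and> (\<forall>a\<in>A. \<forall>b\<in>A. m a b \<in> A)}"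
  have "\<exists>K\<in>?A. \<forall>B\<in>?A. B \<subseteq> K \<longrightarrow> B = K"
  proof (rule compact_space_minimal_closed[OF compact])
    have "J \<in> ?A" using y Jc JE Jm by blast
    then show "?A \<noteq> {}" by (metis empty_iff)
    show "closedin X A \<and> A \<noteq> {}" if "A \<in> ?A" for A using that by blast
    show "\<Inter>\<C> \<in> ?A" if "\<C> \<subseteq> ?A" "\<C> \<noteq> {}" "\<Inter>\<C> \<noteq> {}" "closedin X (\<Inter>\<C>)" for \<C>
    proof -
      have "\<Inter>\<C> \<subseteq> J" using that(1,2) by blast
      moreover have "m a b \<in> \<Inter>\<C>" if ab: "a \<in> \<Inter>\<C>" "b \<in> \<Inter>\<C>" for a b
      proof
        fix D assume "D \<in> \<C>"
        then show "m a b \<in> D" using \<open>\<C> \<subseteq> ?A\<close> ab by blast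
      qed
      ultimately show ?thesis using that(3,4) by blast
    qed
  qed
  then obtain A where A: "A \<in> ?A" and A2: "\<forall>B\<in>?A. B \<subseteq> A \<longrightarrow> B = A" by (rule bexE)
  note Amin = A2[rule_format]
  from A obtain x where x: "x \<in> A" by blast
  have AE: "A \<subseteq> E" using A JE by blast
  then have xE: "x \<in> E" using x by blast
  have Am: "\<And>a b. a \<in> A \<Longrightarrow> b \<in> A \<Longrightarrow> m a b \<in> A" using A by blast
  have "(\<lambda>e. m e x) ` A = A"
  proof (rule Amin)
    have "m (m a x) (m b x) = m (m (m a x) b) x" "m (m a x) b \<in> A" if "a \<in> A" "b \<in> A" for a b
      using that x AE Am assoc[of "m a x" b x] by (auto simp: subset_iff)
    then have "\<forall>a\<in>(\<lambda>e. m e x) ` A. \<forall>b\<in>(\<lambda>e. m e x) ` A. m a b \<in> (\<lambda>e. m e x) ` A" by auto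
    moreover have "closedin X ((\<lambda>e. m e x) ` A)" using closed_image[OF xE] A by blast
    moreover have "(\<lambda>e. m e x) ` A \<subseteq> J" using A Am x by blast
    ultimately show "(\<lambda>e. m e x) ` A \<in> ?A" using x by blast
    show "(\<lambda>e. m e x) ` A \<subseteq> A" using Am x by blast
  qed
  then obtain a where a: "a \<in> A" "m a x = x" using x by (metis imageE)
  let ?B = "{b \<in> A. m b x = x}"
  have "?B = A"
  proof (rule Amin)
    have "closedin X {b \<in> topspace X. m b x \<in> {x}}"
      using cont[OF xE] closedin_Hausdorff_singleton[OF Hausdorff, of x] xE E
      by (intro closedin_continuous_map_preimage) auto
    then have "closedin X (A \<inter> {b \<in> topspace X. m b x \<in> {x}})" using A by (intro closedin_Int) auto
    moreover have "A \<inter> {b \<in> topspace X. m b x \<in> {x}} = ?B" using AE E by auto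
    ultimately have "closedin X ?B" by simp
    moreover have "m (m b c) x = x" if "b \<in> A" "c \<in> A" "m b x = x" "m c x = x" for b c
      using that AE xE assoc[of b c x] by auto
    ultimately show "?B \<in> ?A" using a A Am by auto
  qed blast
  then have "m x x = x" using x by blast
  then show ?thesis using x A by blast
qed

end

section \<open>The type space and its Ellis semigroup\<close>

lemma type_space_Conj:
  assumes "p \<in> complete_types L S M" "\<phi> \<in> global_formulas L S M" "\<psi> \<in> global_formulas L S M"
  shows "Conj \<phi> \<psi> \<in> p \<longleftrightarrow> \<phi> \<in> p \<and> \<psi> \<in> p"
proof -
  note p = complete_typesD[OF assms(1)]
  have C: "Conj \<phi> \<psi> \<in> global_formulas L S M" using assms by simp
  have 1: "\<not> {Conj \<phi> \<psi>, Neg \<phi>} \<subseteq> p" using p(2)[of "{Conj \<phi> \<psi>, Neg \<phi>}"] by auto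
  have 2: "\<not> {Conj \<phi> \<psi>, Neg \<psi>} \<subseteq> p" using p(2)[of "{Conj \<phi> \<psi>, Neg \<psi>}"] by auto
  have 3: "\<not> {\<phi>, \<psi>, Neg (Conj \<phi> \<psi>)} \<subseteq> p" using p(2)[of "{\<phi>, \<psi>, Neg (Conj \<phi> \<psi>)}"] by auto
  show ?thesis using 1 2 3 p(3)[OF assms(2)] p(3)[OF assms(3)] p(3)[OF C] by auto
qed

lemma top_fm_type: "is_struct L M \<Longrightarrow> p \<in> complete_types L S M \<Longrightarrow> top_fm \<in> p"
  using complete_typesD(3)[of p L S M top_fm] complete_typesD(2)[of p L S M "{Neg top_fm}"]
  by (auto simp: top_fm)

lemma topspace_stone [simp]:
  "is_struct L M \<Longrightarrow> topspace (stone_topology L S X M) = type_space L S X M"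
proof -
  assume "is_struct L M"
  then have "top_fm \<in> p" if "p \<in> type_space L S X M" for p
    using that top_fm_type type_spaceD by blast
  then show ?thesis
    unfolding stone_topology_def formulas_over_univ topology_generated_by_topspace
    using top_fm(1) by blast
qed

lemma openin_stone_basic:
  "\<phi> \<in> global_formulas L S M \<Longrightarrow> openin (stone_topology L S X M) {p \<in> type_space L S X M. \<phi> \<in> p}"
  unfolding stone_topology_def formulas_over_univ by (rule topology_generated_by_Basis) blast

text \<open>The generating sets are closed under intersection, through conjunctions, so the subbase
  is a base.\<close>

lemma openin_stone_basis:
  assumes M: "is_struct L M" and "openin (stone_topology L S X M) W" "p \<in> W"
  shows "\<exists>\<phi>\<in>global_formulas L S M. \<phi> \<in> p \<and> {r \<in> type_space L S X M. \<phi> \<in> r} \<subseteq> W"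
proof -
  let ?b = "\<lambda>\<phi>. {r \<in> type_space L S X M. \<phi> \<in> r}"
  have "generate_topology_on (?b ` global_formulas L S M) W"
    using assms(2) unfolding stone_topology_def formulas_over_univ by (rule openin_topology_generated_by)
  then have "\<forall>p\<in>W. \<exists>\<phi>\<in>global_formulas L S M. p \<in> ?b \<phi> \<and> ?b \<phi> \<subseteq> W"
  proof induction
    case (Int V W)
    show ?case
    proof
      fix p assume "p \<in> V \<inter> W"
      then have "p \<in> V" "p \<in> W" by auto
      from Int.IH(1)[rule_format, OF this(1)] obtain \<phi> where
        \<phi>: "\<phi> \<in> global_formulas L S M" "p \<in> ?b \<phi> \<and> ?b \<phi> \<subseteq> V" by (rule bexE)
      from Int.IH(2)[rule_format, OF \<open>p \<in> W\<close>] obtain \<psi> where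
        \<psi>: "\<psi> \<in> global_formulas L S M" "p \<in> ?b \<psi> \<and> ?b \<psi> \<subseteq> W" by (rule bexE)
      have eq: "?b (Conj \<phi> \<psi>) = ?b \<phi> \<inter> ?b \<psi>"
        using type_space_Conj[OF type_spaceD \<phi>(1) \<psi>(1)] by blast
      show "\<exists>\<phi>\<in>global_formulas L S M. p \<in> ?b \<phi> \<and> ?b \<phi> \<subseteq> V \<inter> W"
      proof (rule bexI[of _ "Conj \<phi> \<psi>"])
        show "p \<in> ?b (Conj \<phi> \<psi>) \<and> ?b (Conj \<phi> \<psi>) \<subseteq> V \<inter> W"
          unfolding eq using \<phi>(2) \<psi>(2) by blast
      qed (use \<phi> \<psi> in simp)
    qed
  next
    case (UN K)
    show ?case
    proof
      fix p assume "p \<in> \<Union>K"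
      then obtain V where V: "V \<in> K" "p \<in> V" by blast
      from UN.IH[OF V(1), rule_format, OF V(2)] obtain \<phi> where
        \<phi>: "\<phi> \<in> global_formulas L S M" "p \<in> ?b \<phi> \<and> ?b \<phi> \<subseteq> V" by (rule bexE)
      have "V \<subseteq> \<Union>K" using V(1) by blast
      with \<phi>(2) have "p \<in> ?b \<phi> \<and> ?b \<phi> \<subseteq> \<Union>K" by (meson order.trans)
      with \<phi>(1) show "\<exists>\<phi>\<in>global_formulas L S M. p \<in> ?b \<phi> \<and> ?b \<phi> \<subseteq> \<Union>K" by (rule bexI[rotated])
    qed
  qed auto
  from this[rule_format, OF assms(3)] show ?thesis by auto
qed

lemma Hausdorff_stone:
  assumes M: "is_struct L M"
  shows "Hausdorff_space (stone_topology L S X M)"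
  unfolding Hausdorff_space_def topspace_stone[OF M]
proof (intro allI impI)
  fix p q assume pq: "p \<in> type_space L S X M \<and> q \<in> type_space L S X M \<and> p \<noteq> q"
  then have "p \<in> complete_types L S M" "q \<in> complete_types L S M" by (auto dest: type_spaceD)
  then obtain \<phi> where \<phi>: "\<phi> \<in> global_formulas L S M" "\<phi> \<in> p" "\<phi> \<notin> q"
    using complete_types_eqI pq by blast
  let ?b = "\<lambda>\<phi>. {r \<in> type_space L S X M. \<phi> \<in> r}"
  have "openin (stone_topology L S X M) (?b \<phi>)" "openin (stone_topology L S X M) (?b (Neg \<phi>))"
    using \<phi>(1) by (auto intro: openin_stone_basic)
  moreover have "p \<in> ?b \<phi>" "q \<in> ?b (Neg \<phi>)" "disjnt (?b \<phi>) (?b (Neg \<phi>))"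
    using pq \<phi> complete_typesD(3)[OF type_spaceD \<phi>(1)] by (auto simp: disjnt_def)
  ultimately show "\<exists>U V. openin (stone_topology L S X M) U \<and> openin (stone_topology L S X M) V \<and>
      p \<in> U \<and> q \<in> V \<and> disjnt U V" by blast
qed

text \<open>Choose for each type \<open>p\<close> a formula \<open>f p\<close> in it whose basic set
  lies inside a member of the cover. Without a finite subcover the formulas \<open>Neg (f p)\<close>
  together with \<open>X\<close> are finitely satisfiable; a completion \<open>q\<close> then
  contains both \<open>f q\<close> and its negation.\<close>

lemma compact_stone:
  fixes M :: "('f, 'r, 's, 'a) struct" and S :: "'i \<rightharpoonup> 's"
  assumes M: "is_struct L M" and X: "X \<subseteq> formulas L S"
  shows "compact_space (stone_topology L S X M)"
  unfolding compact_space_alt topspace_stone[OF M]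
proof (intro allI impI)
  let ?b = "\<lambda>\<phi>. {r \<in> type_space L S X M. \<phi> \<in> r}"
  fix \<U> assume U: "(\<forall>U\<in>\<U>. openin (stone_topology L S X M) U) \<and> type_space L S X M \<subseteq> \<Union>\<U>"
  have ex: "\<exists>\<phi>. \<phi> \<in> global_formulas L S M \<and> \<phi> \<in> p \<and> (\<exists>U\<in>\<U>. ?b \<phi> \<subseteq> U)" if "p \<in> type_space L S X M" for p
  proof -
    from U that obtain W where W: "W \<in> \<U>" "p \<in> W" by blast
    then have "openin (stone_topology L S X M) W" using U by blast
    from openin_stone_basis[OF M this W(2)] W(1) show ?thesis by blast
  qed
  define f where "f = (\<lambda>p. SOME \<phi>. \<phi> \<in> global_formulas L S M \<and> \<phi> \<in> p \<and> (\<exists>U\<in>\<U>. ?b \<phi> \<subseteq> U))"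
  define g where "g = (\<lambda>p. SOME U. U \<in> \<U> \<and> ?b (f p) \<subseteq> U)"
  have fg: "f p \<in> global_formulas L S M \<and> f p \<in> p \<and> ?b (f p) \<subseteq> g p \<and> g p \<in> \<U>"
    if "p \<in> type_space L S X M" for p
  proof -
    have 1: "f p \<in> global_formulas L S M \<and> f p \<in> p \<and> (\<exists>U\<in>\<U>. ?b (f p) \<subseteq> U)"
      unfolding f_def using ex[OF that] by (rule someI_ex)
    then have "\<exists>U. U \<in> \<U> \<and> ?b (f p) \<subseteq> U" by blast
    then have "g p \<in> \<U> \<and> ?b (f p) \<subseteq> g p" unfolding g_def by (rule someI_ex)
    with 1 show ?thesis by simp
  qed
  show "\<exists>\<F>. finite \<F> \<and> \<F> \<subseteq> \<U> \<and> type_space L S X M \<subseteq> \<Union>\<F>"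
  proof (rule ccontr)
    assume no: "\<not> ?thesis"
    let ?N = "(Neg \<circ> f) ` type_space L S X M"
    let ?p = "?N \<union> map_fm Inl ` X"
    have Xf: "map_fm Inl ` X \<subseteq> global_formulas L S M" using X by (auto simp: formulas_map o_def)
    have "\<exists>q\<in>complete_types L S M. ?p \<subseteq> q"
    proof (rule exists_complete_type)
      show "?p \<subseteq> global_formulas L S M" using fg Xf by auto
      fix \<Phi> assume \<Phi>: "\<Phi> \<subseteq> ?p" "finite \<Phi>"
      then have "finite (\<Phi> \<inter> ?N)" "\<Phi> \<inter> ?N \<subseteq> (Neg \<circ> f) ` type_space L S X M" by auto
      then obtain P where P: "P \<subseteq> type_space L S X M" "finite P" "\<Phi> \<inter> ?N = (Neg \<circ> f) ` P"
        by (meson finite_subset_image)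
      have "finite (g ` P)" "g ` P \<subseteq> \<U>" using P fg by auto
      then obtain r where r: "r \<in> type_space L S X M" "r \<notin> \<Union>(g ` P)" using no by blast
      have "Neg (f p) \<in> r" if "p \<in> P" for p
      proof -
        have p: "p \<in> type_space L S X M" using that P by blast
        then have "f p \<notin> r" using fg[OF p] r that by blast
        then show ?thesis using complete_typesD(3)[OF type_spaceD[OF r(1)]] fg[OF p] by blast
      qed
      then have "\<Phi> \<inter> ?N \<subseteq> r" unfolding P(3) by auto
      moreover have "map_fm Inl ` X \<subseteq> r" using r(1) by (simp add: type_space_def)
      ultimately have "\<Phi> \<subseteq> r" using \<Phi>(1)
      proof (intro subsetI)
        fix \<phi> assume N: "\<Phi> \<inter> ?N \<subseteq> r" "map_fm Inl ` X \<subseteq> r" and \<phi>: "\<phi> \<in> \<Phi>"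
        from \<Phi>(1) \<phi> have "\<phi> \<in> ?N \<or> \<phi> \<in> map_fm Inl ` X" by (rule subsetD[THEN UnE]) simp_all
        then show "\<phi> \<in> r"
        proof
          assume "\<phi> \<in> ?N"
          with \<phi> have "\<phi> \<in> \<Phi> \<inter> ?N" by (rule IntI)
          with N(1) show ?thesis by (rule subsetD)
        qed (rule subsetD[OF N(2)])
      qed
      then show "\<exists>v\<in>assigns M S. \<forall>\<phi>\<in>\<Phi>. sat M (case_sum v id) [] \<phi>"
        using complete_typesD(2)[OF type_spaceD[OF r(1)]] \<Phi>(2) by blast
    qed
    then obtain q where q0: "q \<in> complete_types L S M" "?p \<subseteq> q" by (rule bexE)
    from q0(2) have q: "?N \<subseteq> q" "map_fm Inl ` X \<subseteq> q" by (simp_all only: Un_subset_iff)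
    note q = q0(1) this
    then have qt: "q \<in> type_space L S X M" by (simp add: type_space_def)
    then have "Neg (f q) \<in> q" using q(2) by auto
    then show False using fg[OF qt] complete_typesD(3)[OF q(1)] by blast
  qed
qed

section \<open>The Ellis semigroup as the set of maps below the identity\<close>

context monster_model
begin

abbreviation TS where "TS S X \<equiv> type_space L S X M"
abbreviation EL where "EL S X \<equiv> ellis_semigroup L S X M"

text \<open>A basic neighbourhood of \<open>f\<close> prescribes finitely many formulas at finitely
  many types. An automorphism meeting this prescription yields, by its inverse, a finite elementary
  map copying the piece from the identity. Conversely homogeneity extends such a finite map to an
  automorphism.\<close>

lemma ellis_iff:
  fixes S :: "'i \<rightharpoonup> 's"
  shows "f \<in> EL S X \<longleftrightarrow> f \<in> TS S X \<rightarrow>\<^sub>E TS S X \<and> below L S (TS S X) M f M id"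
proof
  let ?ts = "TS S X" and ?T = "stone_topology L S X M"
  let ?PT = "product_topology (\<lambda>_. ?T) ?ts"
  assume f: "f \<in> EL S X"
  then have fE: "f \<in> ?ts \<rightarrow>\<^sub>E ?ts"
    by (simp add: ellis_semigroup_def in_closure_of topspace_stone[OF struct])
  have "below L S ?ts M f M id" unfolding below_def
  proof (intro allI impI)
    fix Z assume Z: "finite Z \<and> Z \<subseteq> ?ts \<times> global_formulas L S M"
    \<comment> \<open>The neighbourhood of \<open>f p\<close> given by the formulas that
      \<open>Z\<close> pairs with \<open>p\<close>; it is the whole space for all but finitely many
      \<open>p\<close>.\<close>
    define W where "W = (\<lambda>p. {r \<in> ?ts. \<forall>\<phi>. (p, \<phi>) \<in> Z \<longrightarrow> (\<phi> \<in> r \<longleftrightarrow> \<phi> \<in> f p)})"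
    have fp: "f p \<in> complete_types L S M" if "p \<in> ?ts" for p using fE that type_spaceD[of "f p"] by (auto simp: PiE_iff)
    have op: "openin ?T {r \<in> ?ts. \<forall>\<phi>\<in>F. (\<phi> \<in> r \<longleftrightarrow> \<phi> \<in> f p)}"
      if "finite F" "F \<subseteq> global_formulas L S M" "p \<in> ?ts" for F p
      using that
    proof (induction F)
      case empty
      then show ?case using openin_topspace[of ?T] by (simp add: topspace_stone[OF struct])
    next
      case (insert \<phi> F)
      let ?\<psi> = "if \<phi> \<in> f p then \<phi> else Neg \<phi>"
      have "openin ?T {r \<in> ?ts. ?\<psi> \<in> r}" using insert.prems by (intro openin_stone_basic) auto
      moreover have "{r \<in> ?ts. ?\<psi> \<in> r} = {r \<in> ?ts. \<phi> \<in> r \<longleftrightarrow> \<phi> \<in> f p}"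
      proof -
        have "\<phi> \<in> global_formulas L S M" using insert.prems(1) by blast
        from complete_typesD(3)[OF type_spaceD this] show ?thesis by auto
      qed
      ultimately have "openin ?T ({r \<in> ?ts. \<phi> \<in> r \<longleftrightarrow> \<phi> \<in> f p} \<inter> {r \<in> ?ts. \<forall>\<phi>\<in>F. (\<phi> \<in> r \<longleftrightarrow> \<phi> \<in> f p)})"
        using insert.IH insert.prems by (intro openin_Int) auto
      moreover have "{r \<in> ?ts. \<phi> \<in> r \<longleftrightarrow> \<phi> \<in> f p} \<inter> {r \<in> ?ts. \<forall>\<phi>\<in>F. (\<phi> \<in> r \<longleftrightarrow> \<phi> \<in> f p)} =
        {r \<in> ?ts. \<forall>\<phi>\<in>insert \<phi> F. (\<phi> \<in> r \<longleftrightarrow> \<phi> \<in> f p)}" by auto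
      ultimately show ?case by simp
    qed
    have "openin ?T (W p)" if "p \<in> ?ts" for p
    proof -
      have "finite (Z `` {p})" "Z `` {p} \<subseteq> global_formulas L S M" using Z by auto
      from op[OF this that] show ?thesis by (simp add: W_def Image_singleton_iff Ball_def)
    qed
    moreover have "{p \<in> ?ts. W p \<noteq> topspace ?T} \<subseteq> fst ` Z"
      by (force simp: W_def topspace_stone[OF struct])
    then have "finite {p \<in> ?ts. W p \<noteq> topspace ?T}" using Z finite_subset by blast
    ultimately have "openin ?PT (PiE ?ts W)" unfolding openin_PiE_gen by blast
    moreover have "f \<in> PiE ?ts W" using fE by (auto simp: W_def PiE_iff)
    ultimately obtain \<sigma> where \<sigma>: "\<sigma> \<in> automorphisms L M" "restrict (type_action \<sigma>) ?ts \<in> PiE ?ts W"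
      using f unfolding ellis_semigroup_def in_closure_of by blast
    \<comment> \<open>The inverse appears because a formula belongs to the translate of
      \<open>p\<close> by \<open>\<sigma>\<close> iff its preimage under \<open>\<sigma>\<close>
      belongs to \<open>p\<close>.\<close>
    let ?g = "inv_into (univ M) \<sigma>"
    have "\<phi> \<in> f p \<longleftrightarrow> inst ?g \<phi> \<in> p" if "(p, \<phi>) \<in> Z" for p \<phi>
    proof -
      have p: "p \<in> ?ts" "\<phi> \<in> global_formulas L S M" using that Z by auto
      then have "type_action \<sigma> p \<in> W p" using \<sigma>(2) by (auto simp: PiE_iff)
      then have "\<phi> \<in> f p \<longleftrightarrow> \<phi> \<in> type_action \<sigma> p" using that by (auto simp: W_def)
      then show ?thesis
        using type_action_iff[OF struct \<sigma>(1) p(2)] complete_typesD(1)[OF type_spaceD[OF p(1)]] by simp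
    qed
    moreover have "elem_map L M (\<Union>z\<in>Z. params (snd z)) ?g M"
      by (rule elem_map_aut[OF struct aut_inv[OF struct \<sigma>(1)]])
    ultimately show "\<exists>g. elem_map L M (\<Union>z\<in>Z. params (snd z)) g M \<and>
        (\<forall>(k, \<phi>)\<in>Z. \<phi> \<in> f k \<longleftrightarrow> inst g \<phi> \<in> id k)" by auto
  qed
  with fE show "f \<in> ?ts \<rightarrow>\<^sub>E ?ts \<and> below L S ?ts M f M id" ..
next
  let ?ts = "TS S X" and ?T = "stone_topology L S X M"
  let ?PT = "product_topology (\<lambda>_. ?T) ?ts"
  assume f: "f \<in> ?ts \<rightarrow>\<^sub>E ?ts \<and> below L S ?ts M f M id"
  show "f \<in> EL S X" unfolding ellis_semigroup_def in_closure_of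
  proof (intro conjI allI impI)
    show "f \<in> topspace ?PT" using f by (simp add: topspace_stone[OF struct])
    fix Q assume Q: "f \<in> Q \<and> openin ?PT Q"
    from conjunct2[OF Q, unfolded openin_product_topology_alt, rule_format, OF conjunct1[OF Q]]
    obtain U where U0: "finite {i \<in> ?ts. U i \<noteq> topspace ?T} \<and> (\<forall>i\<in>?ts. openin ?T (U i)) \<and>
      f \<in> PiE ?ts U \<and> PiE ?ts U \<subseteq> Q" by (rule exE)
    then have U: "finite {i \<in> ?ts. U i \<noteq> topspace ?T}" "\<And>i. i \<in> ?ts \<Longrightarrow> openin ?T (U i)"
      "f \<in> PiE ?ts U" "PiE ?ts U \<subseteq> Q" by simp_all
    let ?J = "{i \<in> ?ts. U i \<noteq> topspace ?T}"
    \<comment> \<open>Basic sets form a base, so one formula for each restricted coordinate is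
      enough to stay inside the open box.\<close>
    define F where "F = (\<lambda>i. SOME \<phi>. \<phi> \<in> global_formulas L S M \<and> \<phi> \<in> f i \<and> {r \<in> ?ts. \<phi> \<in> r} \<subseteq> U i)"
    have F: "F i \<in> global_formulas L S M \<and> F i \<in> f i \<and> {r \<in> ?ts. F i \<in> r} \<subseteq> U i" if "i \<in> ?ts" for i
      unfolding F_def
    proof (rule someI_ex)
      have "f i \<in> U i" using U(3) that by auto
      from openin_stone_basis[OF struct U(2)[OF that] this]
      show "\<exists>\<phi>. \<phi> \<in> global_formulas L S M \<and> \<phi> \<in> f i \<and> {r \<in> ?ts. \<phi> \<in> r} \<subseteq> U i" by (simp only: Bex_def)
    qed
    define Z where "Z = (\<lambda>i. (i, F i)) ` ?J"
    have Z: "finite Z" "Z \<subseteq> ?ts \<times> global_formulas L S M" using U(1) F by (auto simp: Z_def)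
    obtain g where g: "elem_map L M (\<Union>z\<in>Z. params (snd z)) g M"
      "\<And>k \<phi>. (k, \<phi>) \<in> Z \<Longrightarrow> \<phi> \<in> f k \<longleftrightarrow> inst g \<phi> \<in> id k"
      by (rule belowD[OF conjunct2[OF f] Z]) (rule that)
    define P where "P = (\<Union>z\<in>Z. params (snd z))"
    have "finite P" unfolding P_def using Z(1) finite_params by blast
    moreover have "P \<subseteq> univ M"
    proof -
      have "params (snd z) \<subseteq> univ M" if "z \<in> Z" for z
        using subsetD[OF Z(2) that] params_subset by (cases z) (simp only: mem_Times_iff snd_conv, blast)
      then show ?thesis unfolding P_def by blast
    qed
    ultimately have P: "finite P" "dom (sort_of M |` P) = P" by auto
    have "|dom (sort_of M |` P)| <o \<kappa>" unfolding P(2) by (rule finite_small[OF P(1)])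
    from homogeneous[OF g(1)[folded P_def] this]
    obtain \<sigma> where \<sigma>: "\<sigma> \<in> automorphisms L M" "\<And>a. a \<in> P \<Longrightarrow> \<sigma> a = g a"
      unfolding P(2) by auto
    let ?\<tau> = "inv_into (univ M) \<sigma>"
    have "restrict (type_action ?\<tau>) ?ts \<in> PiE ?ts U"
    proof (rule PiE_I)
      fix i assume i: "i \<in> ?ts"
      have ti: "type_action ?\<tau> i \<in> ?ts" by (rule type_action_type_space[OF struct aut_inv[OF struct \<sigma>(1)] i])
      show "restrict (type_action ?\<tau>) ?ts i \<in> U i"
      proof (cases "i \<in> ?J")
        case True
        then have z: "(i, F i) \<in> Z" unfolding Z_def by blast
        have "params (F i) \<subseteq> P" unfolding P_def using z by force
        then have "inst \<sigma> (F i) = inst g (F i)" using \<sigma>(2) by (intro inst_cong) blast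
        then have "inst \<sigma> (F i) \<in> i" using g(2)[OF z] F[OF i] by simp
        then have "F i \<in> type_action ?\<tau> i"
          using type_action_inv_iff[OF struct \<sigma>(1), of "F i" S i] F[OF i] complete_typesD(1)[OF type_spaceD[OF i]] by simp
        then show ?thesis using F[OF i] ti i by auto
      next
        case False
        then show ?thesis using i ti by (simp add: topspace_stone[OF struct])
      qed
    qed auto
    then show "\<exists>y. y \<in> (\<lambda>\<sigma>. restrict (type_action \<sigma>) ?ts) ` automorphisms L M \<and> y \<in> Q"
      using U(4) aut_inv[OF struct \<sigma>(1)] by blast
  qed
qed

lemma ellis_aut: "\<sigma> \<in> automorphisms L M \<Longrightarrow> restrict (type_action \<sigma>) (TS S X) \<in> EL S X"
proof -
  assume \<sigma>: "\<sigma> \<in> automorphisms L M"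
  let ?K = "(\<lambda>\<sigma>. restrict (type_action \<sigma>) (TS S X)) ` automorphisms L M"
  have "?K \<subseteq> topspace (product_topology (\<lambda>_. stone_topology L S X M) (TS S X))"
    using type_action_type_space[OF struct] by (auto simp: topspace_stone[OF struct])
  from closure_of_subset[OF this] \<sigma> show ?thesis unfolding ellis_semigroup_def by blast
qed

text \<open>Reindexing \<open>f\<close> by \<open>g\<close> shows that \<open>f \<circ> g\<close>
  lies below \<open>g\<close>, which lies below the identity.\<close>

lemma ellis_compose:
  assumes "f \<in> EL S X" "g \<in> EL S X"
  shows "compose (TS S X) f g \<in> EL S X"
proof -
  let ?ts = "TS S X"
  have f: "f \<in> ?ts \<rightarrow>\<^sub>E ?ts" "below L S ?ts M f M id" and g: "g \<in> ?ts \<rightarrow>\<^sub>E ?ts" "below L S ?ts M g M id"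
    using assms unfolding ellis_iff by auto
  have "below L S ?ts M (f \<circ> g) M (id \<circ> g)" using f(2) g(1) by (intro below_reindex[of L S ?ts]) auto
  then have "below L S ?ts M (f \<circ> g) M g" by simp
  from below_trans[OF this g(2)] have "below L S ?ts M (compose ?ts f g) M id"
    by (rule below_cong) (auto simp: compose_def)
  moreover have "compose ?ts f g \<in> ?ts \<rightarrow>\<^sub>E ?ts" using f(1) g(1) by (auto simp: compose_def PiE_iff)
  ultimately show ?thesis unfolding ellis_iff by blast
qed

lemma ellis_compact_semigroup:
  assumes X: "X \<subseteq> formulas L S"
  shows "compact_semigroup (subtopology (product_topology (\<lambda>_. stone_topology L S X M) (TS S X)) (EL S X))
    (compose (TS S X)) (EL S X)"
proof
  let ?ts = "TS S X" and ?T = "stone_topology L S X M"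
  let ?PT = "product_topology (\<lambda>_. ?T) ?ts"
  have sub: "EL S X \<subseteq> topspace ?PT" unfolding ellis_semigroup_def by (rule closure_of_subset_topspace)
  show "topspace (subtopology ?PT (EL S X)) = EL S X" using sub by auto
  have "compact_space ?PT"
    using compact_stone[OF struct X] by (simp add: compact_space_product_topology)
  moreover have "closedin ?PT (EL S X)" unfolding ellis_semigroup_def by (rule closedin_closure_of)
  ultimately have "compactin ?PT (EL S X)" by (rule closedin_compact_space)
  then show "compact_space (subtopology ?PT (EL S X))" by (rule compact_space_subtopology)
  show "Hausdorff_space (subtopology ?PT (EL S X))"
    using Hausdorff_stone[OF struct, of S X] by (intro Hausdorff_space_subtopology) (simp add: Hausdorff_space_product_topology)
  show "EL S X \<noteq> {}" using ellis_aut[OF id_aut] by blast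
  show "compose ?ts f g \<in> EL S X" if "f \<in> EL S X" "g \<in> EL S X" for f g
    using that by (rule ellis_compose)
  show "compose ?ts (compose ?ts f g) h = compose ?ts f (compose ?ts g h)"
    if "f \<in> EL S X" "g \<in> EL S X" "h \<in> EL S X" for f g h
    using that unfolding ellis_iff by (auto simp: compose_def PiE_iff fun_eq_iff)
  show "continuous_map (subtopology ?PT (EL S X)) (subtopology ?PT (EL S X)) (\<lambda>e. compose ?ts e g)"
    if g: "g \<in> EL S X" for g
  proof (rule continuous_map_into_subtopology)
    have gp: "g p \<in> ?ts" if "p \<in> ?ts" for p using g that unfolding ellis_iff by auto
    \<comment> \<open>The coordinate at \<open>p\<close> of the composite is the coordinate of
      \<open>e\<close> at \<open>g p\<close>, hence a projection.\<close>
    have "continuous_map ?PT ?T (\<lambda>e. compose ?ts e g p)" if p: "p \<in> ?ts" for p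
      using continuous_map_product_projection[OF gp[OF p], of "\<lambda>_. ?T"] p by (simp add: compose_def)
    then have "continuous_map ?PT ?PT (\<lambda>e. compose ?ts e g)"
      unfolding continuous_map_componentwise by (auto simp: compose_def)
    then show "continuous_map (subtopology ?PT (EL S X)) ?PT (\<lambda>e. compose ?ts e g)"
      by (rule continuous_map_from_subtopology)
    show "(\<lambda>e. compose ?ts e g) \<in> topspace (subtopology ?PT (EL S X)) \<rightarrow> EL S X"
      using ellis_compose g by auto
  qed
qed

end

section \<open>Types with a bounded orbit\<close>

text \<open>
  Relative to a small family \<open>h\<close>, these are the types fixed by every automorphism that fixes some
  conjugate of \<open>h\<close> pointwise. If \<open>h\<close> enumerates a small model, they are the Lascar invariant types.
\<close>

definition inv_types ::
  "('f, 'r, 's) lang \<Rightarrow> ('i \<rightharpoonup> 's) \<Rightarrow> ('f, 'r, 's, 'i) fm set \<Rightarrow> ('f, 'r, 's, 'a) struct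
     \<Rightarrow> 'n set \<Rightarrow> ('n \<Rightarrow> 'a) \<Rightarrow> ('f, 'r, 's, 'i + 'a) fm set set" where
  "inv_types L S X M D h = {p \<in> type_space L S X M.
     \<forall>\<sigma>\<in>automorphisms L M. \<forall>\<tau>\<in>automorphisms L M.
       (\<forall>x\<in>D. \<sigma> (\<tau> (h x)) = \<tau> (h x)) \<longrightarrow> type_action \<sigma> p = p}"

lemma inv_types_type_space: "p \<in> inv_types L S X M D h \<Longrightarrow> p \<in> type_space L S X M"
  by (simp add: inv_types_def)

lemma inv_types_inst_iff:
  assumes "p \<in> inv_types L S X M D h" "\<sigma> \<in> automorphisms L M" "\<tau> \<in> automorphisms L M"
    "\<And>x. x \<in> D \<Longrightarrow> \<sigma> (\<tau> (h x)) = \<tau> (h x)" "\<phi> \<in> global_formulas L S M"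
  shows "inst \<sigma> \<phi> \<in> p \<longleftrightarrow> \<phi> \<in> p"
proof -
  have p: "p \<subseteq> global_formulas L S M" using assms(1) inv_types_type_space type_spaceD complete_typesD(1) by metis
  have "type_action \<sigma> p = p" using assms(1-4) unfolding inv_types_def by blast
  then show ?thesis using type_action_inst_iff[OF assms(2,5) p] by simp
qed

context monster_model
begin

text \<open>Homogeneity turns the finite elementary map of \<open>ellis_iff\<close> into an
  automorphism. Mind the direction: it is the inverse of \<open>\<rho>\<close> whose action is close
  to \<open>f\<close>.\<close>

lemma ellis_approx:
  assumes f: "f \<in> EL S X" and Z: "finite Z" "Z \<subseteq> TS S X \<times> global_formulas L S M"
  obtains \<rho> where "\<rho> \<in> automorphisms L M" "\<And>p \<phi>. (p, \<phi>) \<in> Z \<Longrightarrow> \<phi> \<in> f p \<longleftrightarrow> inst \<rho> \<phi> \<in> p"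
proof -
  have "below L S (TS S X) M f M id" using f unfolding ellis_iff by blast
  then obtain g where g: "elem_map L M (\<Union>z\<in>Z. params (snd z)) g M"
    "\<And>k \<phi>. (k, \<phi>) \<in> Z \<Longrightarrow> \<phi> \<in> f k \<longleftrightarrow> inst g \<phi> \<in> id k"
    by (rule belowD[OF _ Z]) (rule that)
  define P where "P = (\<Union>z\<in>Z. params (snd z))"
  have "finite P" unfolding P_def using Z(1) finite_params by blast
  then have "|dom (sort_of M |` P)| <o \<kappa>" by (intro finite_small) auto
  from homogeneous[OF g(1)[folded P_def] this]
  obtain \<rho> where \<rho>: "\<rho> \<in> automorphisms L M" "\<And>a. a \<in> P \<Longrightarrow> a \<in> univ M \<Longrightarrow> \<rho> a = g a" by auto
  have "\<phi> \<in> f p \<longleftrightarrow> inst \<rho> \<phi> \<in> p" if "(p, \<phi>) \<in> Z" for p \<phi>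
  proof -
    have "params \<phi> \<subseteq> P" unfolding P_def using that by force
    moreover have "\<phi> \<in> global_formulas L S M" using Z(2) that by blast
    then have "params \<phi> \<subseteq> univ M" by (rule params_subset)
    ultimately have "inst \<rho> \<phi> = inst g \<phi>" using \<rho>(2) by (intro inst_cong) blast
    with g(2)[OF that] show ?thesis by simp
  qed
  with \<rho>(1) show ?thesis using that by blast
qed

lemma ellis_type_space: "f \<in> EL S X \<Longrightarrow> p \<in> TS S X \<Longrightarrow> f p \<in> TS S X"
  unfolding ellis_iff by (auto simp: PiE_iff)

text \<open>Approximate \<open>f\<close> by \<open>\<rho>\<close> at a formula and at its preimage
  under \<open>\<sigma>\<close>. Invariance of \<open>f p\<close> under \<open>\<sigma>\<close> then
  becomes invariance of \<open>p\<close> under the conjugate of \<open>\<sigma>\<close> by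
  \<open>\<rho>\<close>, which fixes the conjugate of \<open>h\<close> by
  \<open>\<rho> \<circ> \<tau>\<close>. This is why \<open>inv_types\<close> allows all
  conjugates.\<close>

lemma ellis_inv_types:
  assumes f: "f \<in> EL S X" and p: "p \<in> inv_types L S X M D h" and h: "h ` D \<subseteq> univ M"
  shows "f p \<in> inv_types L S X M D h"
proof -
  have pt: "p \<in> TS S X" using p by (rule inv_types_type_space)
  then have fp: "f p \<in> TS S X" by (rule ellis_type_space[OF f])
  have "type_action \<sigma> (f p) = f p" if \<sigma>: "\<sigma> \<in> automorphisms L M" and \<tau>: "\<tau> \<in> automorphisms L M"
    and fix_h: "\<forall>x\<in>D. \<sigma> (\<tau> (h x)) = \<tau> (h x)" for \<sigma> \<tau>
  proof (rule sym, rule complete_types_eqI)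
    show "f p \<in> complete_types L S M" using fp by (rule type_spaceD)
    then show "type_action \<sigma> (f p) \<in> complete_types L S M" by (rule type_action_complete_types[OF struct \<sigma>])
    fix \<phi> assume \<phi>: "\<phi> \<in> global_formulas L S M" "\<phi> \<in> f p"
    define \<psi> where "\<psi> = inst (inv_into (univ M) \<sigma>) \<phi>"
    have \<psi>: "\<psi> \<in> global_formulas L S M" "inst \<sigma> \<psi> = \<phi>"
      using aut_inst[OF aut_inv[OF struct \<sigma>] \<phi>(1)] inst_inv(2)[OF \<sigma> \<phi>(1)] by (auto simp: \<psi>_def)
    obtain \<rho> where \<rho>: "\<rho> \<in> automorphisms L M"
      "\<And>p' \<phi>'. (p', \<phi>') \<in> {(p, \<phi>), (p, \<psi>)} \<Longrightarrow> \<phi>' \<in> f p' \<longleftrightarrow> inst \<rho> \<phi>' \<in> p'"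
      proof (rule ellis_approx[OF f, of "{(p, \<phi>), (p, \<psi>)}"])
      show "{(p, \<phi>), (p, \<psi>)} \<subseteq> TS S X \<times> global_formulas L S M" using \<phi>(1) \<psi>(1) pt by simp
    qed (simp, rule that)
    let ?i = "inv_into (univ M) \<rho>"
    let ?s = "\<rho> \<circ> \<sigma> \<circ> ?i"
    have s: "?s \<in> automorphisms L M" by (intro aut_comp \<rho>(1) \<sigma> aut_inv struct)
    have fix_s: "?s ((\<rho> \<circ> \<tau>) (h x)) = (\<rho> \<circ> \<tau>) (h x)" if "x \<in> D" for x
    proof -
      have "h x \<in> univ M" using h that by blast
      then obtain s where "sort_of M (h x) = Some s" by blast
      from aut_sort[OF \<tau> this] have "\<tau> (h x) \<in> univ M" by blast
      from aut_inv_apply(1)[OF \<rho>(1) this] fix_h that show ?thesis by simp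
    qed
    have "?i (\<rho> a) = a" if "a \<in> params \<psi>" for a
      using params_subset[OF \<psi>(1)] aut_inv_apply(1)[OF \<rho>(1)] that by blast
    then have "inst ?s (inst \<rho> \<psi>) = inst (\<rho> \<circ> \<sigma>) \<psi>" unfolding inst_inst
      by (intro inst_cong) simp
    also have "\<dots> = inst \<rho> \<phi>" using \<psi>(2) inst_inst[of \<rho> \<sigma> \<psi>] by simp
    finally have eq: "inst ?s (inst \<rho> \<psi>) = inst \<rho> \<phi>" .
    have "inst ?s (inst \<rho> \<psi>) \<in> p \<longleftrightarrow> inst \<rho> \<psi> \<in> p"
      by (rule inv_types_inst_iff[OF p s aut_comp[OF \<rho>(1) \<tau>] fix_s aut_inst[OF \<rho>(1) \<psi>(1)]])
    then have "inst \<rho> \<phi> \<in> p \<longleftrightarrow> inst \<rho> \<psi> \<in> p" unfolding eq .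
    then have "\<psi> \<in> f p" using \<rho>(2)[of p \<phi>] \<rho>(2)[of p \<psi>] \<phi>(2) by simp
    then show "\<phi> \<in> type_action \<sigma> (f p)"
      using type_action_iff[OF struct \<sigma> \<phi>(1) complete_typesD(1)[OF type_spaceD[OF fp]]] by (simp add: \<psi>_def)
  qed
  with fp show ?thesis unfolding inv_types_def by blast
qed

text \<open>An invariant type sees of its parameters only their type over \<open>h\<close>:
  homogeneity supplies an automorphism that fixes \<open>h\<close> and carries one tuple of
  parameters to the other.\<close>

lemma inv_types_same_type:
  fixes Sg :: "'n \<rightharpoonup> 's" and N :: "('f, 'r, 's, 'b) struct"
  assumes p: "p \<in> inv_types L S X M (dom Sg) h"
    and st: "same_type L (case_sum Sg (sort_of N |` A)) M (case_sum h g) M (case_sum h g')"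
    and small: "|dom Sg| <o \<kappa>" "|A| <o \<kappa>"
    and \<psi>: "\<psi> \<in> global_formulas L S N" "params \<psi> \<subseteq> A"
  shows "inst g \<psi> \<in> p \<longleftrightarrow> inst g' \<psi> \<in> p"
proof -
  let ?Sg = "case_sum Sg (sort_of N |` A)"
  have dom: "z \<in> dom ?Sg \<longleftrightarrow> (case z of Inl x \<Rightarrow> x \<in> dom Sg | Inr a \<Rightarrow> a \<in> A \<and> a \<in> univ N)" for z
    by (cases z) (auto simp: restrict_map_def split: if_splits)
  have "dom ?Sg \<subseteq> dom Sg <+> A"
  proof
    fix z assume "z \<in> dom ?Sg"
    then show "z \<in> dom Sg <+> A" unfolding dom by (cases z) auto
  qed
  then have "|dom ?Sg| <o \<kappa>" using Plus_ordLess[OF Cinfinite small] card_subset_ordLess by blast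
  from homogeneous[OF st this] obtain \<sigma> where \<sigma>: "\<sigma> \<in> automorphisms L M"
    "\<And>z. z \<in> dom ?Sg \<Longrightarrow> \<sigma> (case_sum h g z) = case_sum h g' z" by blast
  have "\<sigma> (h x) = h x" if "x \<in> dom Sg" for x using \<sigma>(2)[of "Inl x"] that unfolding dom by simp
  moreover have g: "\<sigma> (g a) = g' a" if "a \<in> params \<psi>" for a
    using \<sigma>(2)[of "Inr a"] that \<psi> params_subset[OF \<psi>(1)] unfolding dom by auto
  moreover have "inst g \<psi> \<in> global_formulas L S M"
  proof (rule inst_global_formulas[OF \<psi>(1)])
    fix a assume "a \<in> params \<psi>"
    then have a: "a \<in> A" "a \<in> univ N" using \<psi> params_subset[OF \<psi>(1)] by auto
    then have "Inr a \<in> dom ?Sg" unfolding dom by simp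
    then have "sort_of M (case_sum h g (Inr a)) = ?Sg (Inr a)"
      using st unfolding same_type_def assigns_def by blast
    then show "sort_of M (g a) = sort_of N a" using a by simp
  qed
  ultimately have "inst \<sigma> (inst g \<psi>) \<in> p \<longleftrightarrow> inst g \<psi> \<in> p"
    using inv_types_inst_iff[OF p \<sigma>(1) id_aut] by simp
  moreover have "inst \<sigma> (inst g \<psi>) = inst g' \<psi>" unfolding inst_inst using g by (intro inst_cong) simp
  ultimately show ?thesis by simp
qed

end

section \<open>Transport between two monster models\<close>

text \<open>\<open>h1\<close> and \<open>h2\<close> enumerate copies of one small set in the two
  models. They are the only link between the models; no relation between the two cardinals is
  assumed.\<close>

locale monster_pair =
  M1: monster_model L T \<kappa>1 M1 + M2: monster_model L T \<kappa>2 M2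
  for L :: "('f, 'r, 's) lang" and T :: "('f, 'r, 's, unit) fm set"
    and \<kappa>1 :: "'k rel" and M1 :: "('f, 'r, 's, 'a) struct"
    and \<kappa>2 :: "'l rel" and M2 :: "('f, 'r, 's, 'b) struct" +
  fixes Sg :: "'n \<rightharpoonup> 's" and h1 :: "'n \<Rightarrow> 'a" and h2 :: "'n \<Rightarrow> 'b"
    and S :: "'i \<rightharpoonup> 's" and X :: "('f, 'r, 's, 'i) fm set"
  assumes X: "X \<subseteq> formulas L S" and base: "same_type L Sg M1 h1 M2 h2"
    and small1: "|dom Sg| <o \<kappa>1" and small2: "|dom Sg| <o \<kappa>2"
begin

text \<open>Transport is treated in one direction only; the other direction is read off through this
  symmetry.\<close>

lemma flip: "monster_pair L T \<kappa>2 M2 \<kappa>1 M1 Sg h2 h1 S X"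
  using X same_type_sym[OF base] small1 small2 M1.monster_model_axioms M2.monster_model_axioms
  by (simp add: monster_pair_def monster_pair_axioms_def)

abbreviation TS1 where "TS1 \<equiv> type_space L S X M1"
abbreviation TS2 where "TS2 \<equiv> type_space L S X M2"
abbreviation B1 where "B1 \<equiv> inv_types L S X M1 (dom Sg) h1"
abbreviation B2 where "B2 \<equiv> inv_types L S X M2 (dom Sg) h2"

text \<open>The map \<open>g\<close> on \<open>A\<close> is elementary jointly with sending
  \<open>h2 x\<close> to \<open>h1 x\<close>: a copy of \<open>A\<close> over the common
  base.\<close>

abbreviation base_map :: "'b set \<Rightarrow> ('b \<Rightarrow> 'a) \<Rightarrow> bool" where
  "base_map A g \<equiv> same_type L (case_sum Sg (sort_of M2 |` A)) M2 (case_sum h2 id) M1 (case_sum h1 g)"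

lemma sort_h: "x \<in> dom Sg \<Longrightarrow> sort_of M1 (h1 x) = Sg x" "x \<in> dom Sg \<Longrightarrow> sort_of M2 (h2 x) = Sg x"
  using base by (auto simp: same_type_def assigns_def)

lemma base_map_exists:
  assumes A: "|A| <o \<kappa>1"
  shows "\<exists>g. base_map A g"
proof -
  let ?Sg = "case_sum Sg (sort_of M2 |` A)"
  have dom: "dom ?Sg \<subseteq> dom Sg <+> A"
  proof
    fix z assume "z \<in> dom ?Sg"
    then show "z \<in> dom Sg <+> A" by (cases z) (auto simp: restrict_map_def split: if_splits)
  qed
  let ?V0 = "Inl ` dom Sg" and ?v0 = "case_sum h1 (\<lambda>_. undefined)"
  define j where "j = (\<lambda>z :: 'n + 'b. case z of Inl x \<Rightarrow> x | Inr _ \<Rightarrow> undefined)"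
  have "same_type L (?Sg |` ?V0) M2 (h2 \<circ> j) M1 (h1 \<circ> j)"
    using same_type_sym[OF base]
    by (rule same_type_comp) (auto simp: map_le_def j_def restrict_map_def split: sum.splits if_splits)
  then have V0: "same_type L (?Sg |` ?V0) M2 (case_sum h2 id) M1 ?v0"
    by (rule same_type_cong) (auto simp: j_def restrict_map_def split: if_splits)
  have "\<exists>v. same_type L ?Sg M2 (case_sum h2 id) M1 v \<and> (\<forall>x\<in>?V0. v x = ?v0 x)"
  proof (rule M1.realize_same_type[OF V0])
    show "case_sum h2 id \<in> assigns M2 ?Sg"
    using sort_h(2) by (auto simp: assigns_def restrict_map_def dom_def split: sum.splits if_splits)
    show "?V0 \<subseteq> dom ?Sg" by auto
    show "|dom ?Sg| <o \<kappa>1" using Plus_ordLess[OF M1.Cinfinite small1 A] dom card_subset_ordLess by blast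
  qed
  then obtain v where v: "same_type L ?Sg M2 (case_sum h2 id) M1 v" "\<forall>x\<in>?V0. v x = ?v0 x"
    by blast
  have "base_map A (v \<circ> Inr)"
    using v(1)
  proof (rule same_type_cong)
    fix z assume z: "z \<in> dom ?Sg"
    show "v z = case_sum h1 (v \<circ> Inr) z"
    proof (cases z)
      case (Inl x)
      then have "x \<in> dom Sg" using z by auto
      then show ?thesis using v(2) Inl by auto
    qed simp
  qed simp
  then show ?thesis by blast
qed

lemma base_map_subset:
  assumes "base_map A g" "B \<subseteq> A"
  shows "base_map B g"
proof (rule same_type_map_le[OF assms(1)], unfold map_le_def, rule ballI)
  fix z assume "z \<in> dom (case_sum Sg (sort_of M2 |` B))"
  then show "case_sum Sg (sort_of M2 |` B) z = case_sum Sg (sort_of M2 |` A) z"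
    using assms(2) by (cases z) (auto simp: restrict_map_def split: if_splits)
qed

lemma base_map_elem_map:
  assumes "base_map A g"
  shows "elem_map L M2 A g M1"
proof -
  have "same_type L (sort_of M2 |` A) M2 (case_sum h2 id \<circ> Inr) M1 (case_sum h1 g \<circ> Inr)"
    using assms by (rule same_type_comp) (auto simp: map_le_def)
  then show ?thesis by (simp add: o_def id_def)
qed

definition tr :: "('f, 'r, 's, 'i + 'a) fm set \<Rightarrow> ('f, 'r, 's, 'i + 'b) fm set" where
  "tr p = {\<psi> \<in> global_formulas L S M2. \<exists>g. base_map (params \<psi>) g \<and> inst g \<psi> \<in> p}"

text \<open>Two base maps send the parameters to tuples of the same type over \<open>h1\<close>,
  which an invariant type cannot distinguish. So the existential quantifier in \<open>tr\<close> may
  be read at any base map.\<close>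

lemma tr_iff:
  assumes p: "p \<in> B1" and g: "base_map A g" and \<psi>: "\<psi> \<in> global_formulas L S M2" "params \<psi> \<subseteq> A"
  shows "\<psi> \<in> tr p \<longleftrightarrow> inst g \<psi> \<in> p"
proof -
  have g': "base_map (params \<psi>) g" using g \<psi>(2) by (rule base_map_subset)
  have "inst g \<psi> \<in> p \<longleftrightarrow> inst g0 \<psi> \<in> p" if "base_map (params \<psi>) g0" for g0
  proof (rule M1.inv_types_same_type[OF p _ small1 M1.finite_small[OF finite_params] \<psi>(1) order.refl])
    show "same_type L (case_sum Sg (sort_of M2 |` params \<psi>)) M1 (case_sum h1 g) M1 (case_sum h1 g0)"
      using same_type_sym[OF g'] that by (rule same_type_trans)
  qed
  with g' \<psi>(1) show ?thesis unfolding tr_def by blast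
qed

lemma tr_type_space:
  assumes p: "p \<in> B1"
  shows "tr p \<in> TS2"
proof -
  have pt: "p \<in> complete_types L S M1" "map_fm Inl ` X \<subseteq> p"
    using inv_types_type_space[OF p] by (auto simp: type_space_def)
  note pc = complete_typesD[OF pt(1)]
  have "tr p \<in> complete_types L S M2"
  proof (rule complete_typesI)
    show "tr p \<subseteq> global_formulas L S M2" by (auto simp: tr_def)
    fix \<Phi> assume \<Phi>: "\<Phi> \<subseteq> tr p" "finite \<Phi>"
    define A where "A = (\<Union>\<phi>\<in>\<Phi>. params \<phi>)"
    have "finite A" unfolding A_def using \<Phi>(2) finite_params by blast
    then obtain g where g: "base_map A g" using base_map_exists M1.finite_small by blast
    have f: "\<phi> \<in> global_formulas L S M2" "params \<phi> \<subseteq> A" if "\<phi> \<in> \<Phi>" for \<phi>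
      using \<Phi>(1) that by (auto simp: tr_def A_def)
    have "inst g ` \<Phi> \<subseteq> p" using tr_iff[OF p g f] \<Phi>(1) by blast
    then obtain v where v: "v \<in> assigns M1 S" "\<forall>\<phi>\<in>\<Phi>. sat M1 (case_sum v g) [] \<phi>"
      using pc(2)[of "inst g ` \<Phi>"] \<Phi>(2) by (auto simp: sat_inst)
    have "\<Phi> \<subseteq> formulas L (case_sum S (sort_of M2 |` A))"
    proof
      fix \<phi> assume \<phi>: "\<phi> \<in> \<Phi>"
      show "\<phi> \<in> formulas L (case_sum S (sort_of M2 |` A))"
      proof (rule formulas_cong[OF f(1)[OF \<phi>]])
        fix z assume "z \<in> set_fm \<phi>"
        then show "case_sum S (sort_of M2) z = case_sum S (sort_of M2 |` A) z"
          using f(2)[OF \<phi>] by (cases z rule: sum.exhaust) (auto simp: params_def restrict_map_def)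
      qed
    qed
    from M2.transfer_solution[OF same_type_sym[OF base_map_elem_map[OF g]] \<Phi>(2) this v(1)] v(2)
    show "\<exists>v\<in>assigns M2 S. \<forall>\<phi>\<in>\<Phi>. sat M2 (case_sum v id) [] \<phi>" by blast
  next
    fix \<phi> assume \<phi>: "\<phi> \<in> global_formulas L S M2"
    obtain g where g: "base_map (params \<phi>) g" using base_map_exists M1.finite_small[OF finite_params] by blast
    have "inst g \<phi> \<in> global_formulas L S M1"
      using base_map_elem_map[OF g] \<phi> by (rule elem_map_inst) simp
    from pc(3)[OF this] show "\<phi> \<in> tr p \<or> Neg \<phi> \<in> tr p"
      using tr_iff[OF p g \<phi>] tr_iff[OF p g, of "Neg \<phi>"] \<phi> by simp
  qed
  moreover have "map_fm Inl ` X \<subseteq> tr p"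
  proof (rule image_subsetI)
    fix \<psi> assume \<psi>: "\<psi> \<in> X"
    let ?\<psi> = "map_fm Inl \<psi> :: ('f, 'r, 's, 'i + 'b) fm"
    have "?\<psi> \<in> global_formulas L S M2" using \<psi> X by (auto simp: formulas_map o_def)
    moreover obtain g where g: "base_map (params ?\<psi>) g" using base_map_exists M1.finite_small[OF finite_params] by blast
    moreover have "inst g ?\<psi> \<in> p" using pt(2) \<psi> by auto
    ultimately show "?\<psi> \<in> tr p" using tr_iff[OF p g] by simp
  qed
  ultimately show ?thesis by (simp add: type_space_def)
qed

text \<open>Both automorphisms of the second model are simulated in the first:
  \<open>\<tau>'\<close> realizes the copied conjugate of the base, and \<open>\<sigma>'\<close>
  fixes it and moves the copied parameters as \<open>\<sigma>\<close> does. Invariance of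
  \<open>p\<close> then applies.\<close>

lemma tr_inv_types:
  assumes p: "p \<in> B1"
  shows "tr p \<in> B2"
proof -
  have "type_action \<sigma> (tr p) = tr p" if \<sigma>: "\<sigma> \<in> automorphisms L M2" and \<tau>: "\<tau> \<in> automorphisms L M2"
    and fix_h: "\<forall>x\<in>dom Sg. \<sigma> (\<tau> (h2 x)) = \<tau> (h2 x)" for \<sigma> \<tau>
  proof (rule sym, rule complete_types_eqI)
    show tc: "tr p \<in> complete_types L S M2" using tr_type_space[OF p] by (rule type_spaceD)
    then show "type_action \<sigma> (tr p) \<in> complete_types L S M2" by (rule type_action_complete_types[OF M2.struct \<sigma>])
    fix \<phi> assume \<phi>: "\<phi> \<in> global_formulas L S M2" "\<phi> \<in> tr p"
    define \<psi> where "\<psi> = inst (inv_into (univ M2) \<sigma>) \<phi>"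
    have \<psi>: "\<psi> \<in> global_formulas L S M2" "inst \<sigma> \<psi> = \<phi>"
      using aut_inst[OF aut_inv[OF M2.struct \<sigma>] \<phi>(1)] inst_inv(2)[OF \<sigma> \<phi>(1)] by (auto simp: \<psi>_def)
    \<comment> \<open>One base map has to copy the parameters before and after
      \<open>\<sigma>\<close> as well as the conjugate base that \<open>\<sigma>\<close>
      fixes.\<close>
    define A where "A = params \<psi> \<union> params \<phi> \<union> (\<tau> \<circ> h2) ` dom Sg"
    have "|A| <o \<kappa>1" unfolding A_def
      by (intro M1.Un_small M1.finite_small finite_params card_image_ordLess small1)
    then obtain g where g: "base_map A g" using base_map_exists by blast
    note eg = base_map_elem_map[OF g]
    have h2: "h2 \<in> assigns M2 Sg" using sort_h(2) by (auto simp: assigns_def)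
    note t2 = same_type_aut[OF M2.struct h2 \<tau>]
    have st: "sort_of M2 (\<tau> (h2 x)) = Sg x" if "x \<in> dom Sg" for x
      using t2 that by (auto simp: same_type_def assigns_def)
    have "Sg \<subseteq>\<^sub>m (sort_of M2 |` A) \<circ> (\<tau> \<circ> h2)" using st by (auto simp: map_le_def A_def)
    from same_type_comp[OF eg this] have t3: "same_type L Sg M2 (\<tau> \<circ> h2) M1 (g \<circ> (\<tau> \<circ> h2))" by simp
    from M1.homogeneous[OF same_type_trans[OF base same_type_trans[OF t2 t3]] small1]
    obtain \<tau>' where \<tau>': "\<tau>' \<in> automorphisms L M1" "\<And>x. x \<in> dom Sg \<Longrightarrow> \<tau>' (h1 x) = g (\<tau> (h2 x))"
      by auto
    let ?Sg = "case_sum Sg (sort_of M2 |` params \<psi>)"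
    let ?v = "case_sum (\<tau> \<circ> h2) id :: 'n + 'b \<Rightarrow> 'b"
    have dom: "z \<in> dom ?Sg \<longleftrightarrow> (case z of Inl x \<Rightarrow> x \<in> dom Sg | Inr a \<Rightarrow> a \<in> params \<psi>)" for z
      using params_subset[OF \<psi>(1)] by (cases z) (auto simp: restrict_map_def dom_def split: if_splits)
    have va: "?v \<in> assigns M2 ?Sg"
      unfolding assigns_def
    proof (intro CollectI ballI)
      fix z assume "z \<in> dom ?Sg"
      then show "sort_of M2 (?v z) = ?Sg z" unfolding dom using st by (cases z) auto
    qed
    note sv = same_type_aut[OF M2.struct va \<sigma>]
    have \<sigma>\<psi>: "\<sigma> ` params \<psi> = params \<phi>" using params_inst[of \<sigma> \<psi>] \<psi>(2) by simp
    have Av: "?v z \<in> A" "(\<sigma> \<circ> ?v) z \<in> A" if "z \<in> dom ?Sg" for z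
    proof -
      show "?v z \<in> A" using that unfolding dom A_def by (cases z) auto
      show "(\<sigma> \<circ> ?v) z \<in> A"
      proof (cases z)
        case (Inl x) then show ?thesis using that fix_h unfolding dom A_def by auto
      next
        case (Inr a) then show ?thesis using that \<sigma>\<psi> unfolding dom A_def by auto
      qed
    qed
    have le: "?Sg \<subseteq>\<^sub>m (sort_of M2 |` A) \<circ> ?v" "?Sg \<subseteq>\<^sub>m (sort_of M2 |` A) \<circ> (\<sigma> \<circ> ?v)"
      using sv Av by (auto simp: map_le_def same_type_def assigns_def)
    have "same_type L ?Sg M1 (g \<circ> ?v) M1 (g \<circ> (\<sigma> \<circ> ?v))"
      using same_type_trans[OF same_type_trans[OF same_type_sym[OF same_type_comp[OF eg le(1)], simplified] sv]
        same_type_comp[OF eg le(2), simplified]] .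
    moreover have "|dom ?Sg| <o \<kappa>1"
    proof -
      have "dom ?Sg \<subseteq> dom Sg <+> params \<psi>"
      proof
        fix z assume "z \<in> dom ?Sg"
        then show "z \<in> dom Sg <+> params \<psi>" unfolding dom by (cases z) auto
      qed
      then show ?thesis
        using Plus_ordLess[OF M1.Cinfinite small1 M1.finite_small[OF finite_params]] card_subset_ordLess by blast
    qed
    ultimately obtain \<sigma>' where \<sigma>': "\<sigma>' \<in> automorphisms L M1"
      "\<And>z. z \<in> dom ?Sg \<Longrightarrow> \<sigma>' ((g \<circ> ?v) z) = (g \<circ> (\<sigma> \<circ> ?v)) z" using M1.homogeneous by blast
    have "\<sigma>' (\<tau>' (h1 x)) = \<tau>' (h1 x)" if "x \<in> dom Sg" for x
      using \<sigma>'(2)[of "Inl x"] that \<tau>'(2)[OF that] fix_h unfolding dom by simp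
    moreover have gf: "inst g \<psi> \<in> global_formulas L S M1"
      using eg \<psi>(1) by (rule elem_map_inst) (auto simp: A_def)
    ultimately have "inst \<sigma>' (inst g \<psi>) \<in> p \<longleftrightarrow> inst g \<psi> \<in> p"
      using inv_types_inst_iff[OF p \<sigma>'(1) \<tau>'(1)] by blast
    moreover have "inst \<sigma>' (inst g \<psi>) = inst g \<phi>" unfolding \<psi>(2)[symmetric] inst_inst
    proof (rule inst_cong)
      fix a assume "a \<in> params \<psi>"
      then show "(\<sigma>' \<circ> g) a = (g \<circ> \<sigma>) a" using \<sigma>'(2)[of "Inr a"] unfolding dom by simp
    qed
    ultimately have "\<psi> \<in> tr p"
      using tr_iff[OF p g \<phi>(1)] tr_iff[OF p g \<psi>(1)] \<phi>(2) by (auto simp: A_def)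
    then show "\<phi> \<in> type_action \<sigma> (tr p)"
      using type_action_iff[OF M2.struct \<sigma> \<phi>(1) complete_typesD(1)[OF tc]] by (simp add: \<psi>_def)
  qed
  with tr_type_space[OF p] show ?thesis unfolding inv_types_def by blast
qed

text \<open>A single base map serves all invariant types at once. Thus the contents of whole
  families are respected, not only those of single types.\<close>

lemma tr_below: "below L S B1 M2 tr M1 id"
  unfolding below_def
proof (intro allI impI)
  fix Z assume Z: "finite Z \<and> Z \<subseteq> B1 \<times> global_formulas L S M2"
  define A where "A = (\<Union>z\<in>Z. params (snd z))"
  have "finite A" unfolding A_def using Z finite_params by blast
  then obtain g where g: "base_map A g" using base_map_exists M1.finite_small by blast
  have "\<psi> \<in> tr p \<longleftrightarrow> inst g \<psi> \<in> p" if "(p, \<psi>) \<in> Z" for p \<psi>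
  proof (rule tr_iff[OF _ g])
    show "params \<psi> \<subseteq> A" unfolding A_def using that by force
  qed (use Z that in auto)
  with base_map_elem_map[OF g]
  show "\<exists>g. elem_map L M2 (\<Union>z\<in>Z. params (snd z)) g M1 \<and> (\<forall>(k, \<phi>)\<in>Z. \<phi> \<in> tr k \<longleftrightarrow> inst g \<phi> \<in> id k)"
    unfolding A_def by auto
qed

abbreviation rt where "rt \<equiv> monster_pair.tr L M2 M1 Sg h2 h1 S"

interpretation f: monster_pair L T \<kappa>2 M2 \<kappa>1 M1 Sg h2 h1 S X
  by (rule flip)

lemma rt_inv_types: "p \<in> B2 \<Longrightarrow> rt p \<in> B1"
  by (rule f.tr_inv_types)

text \<open>Two successive base maps compose to a map into \<open>M1\<close> that preserves types
  over \<open>h1\<close>, and \<open>p\<close> does not notice it.\<close>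

lemma rt_tr:
  assumes p: "p \<in> B1"
  shows "rt (tr p) = p"
proof (rule sym, rule complete_types_eqI)
  show "p \<in> complete_types L S M1" using type_spaceD[OF inv_types_type_space[OF p]] .
  show "rt (tr p) \<in> complete_types L S M1"
    using type_spaceD[OF inv_types_type_space[OF rt_inv_types[OF tr_inv_types[OF p]]]] .
  fix \<phi> assume \<phi>: "\<phi> \<in> global_formulas L S M1" "\<phi> \<in> p"
  let ?P = "params \<phi>"
  obtain g where g: "f.base_map ?P g" using f.base_map_exists M2.finite_small[OF finite_params] by blast
  obtain g2 where g2: "base_map (g ` ?P) g2" using base_map_exists M1.finite_small[OF finite_imageI[OF finite_params]] by blast
  have gf: "inst g \<phi> \<in> global_formulas L S M2" using f.base_map_elem_map[OF g] \<phi>(1) by (rule elem_map_inst) simp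
  let ?Sg = "case_sum Sg (sort_of M1 |` ?P)"
  have "?Sg \<subseteq>\<^sub>m case_sum Sg (sort_of M2 |` (g ` ?P)) \<circ> map_sum id g"
    unfolding map_le_def
  proof
    fix z assume z: "z \<in> dom ?Sg"
    show "?Sg z = (case_sum Sg (sort_of M2 |` (g ` ?P)) \<circ> map_sum id g) z"
    proof (cases z)
      case (Inr a)
      then have "a \<in> ?P" using z by (auto simp: restrict_map_def split: if_splits)
      moreover from this have "a \<in> univ M1" using params_subset[OF \<phi>(1)] by blast
      ultimately show ?thesis using elem_map_sort[OF f.base_map_elem_map[OF g], of a] Inr by simp
    qed simp
  qed
  from same_type_comp[OF g2 this]
  have "same_type L ?Sg M2 (case_sum h2 g) M1 (case_sum h1 (g2 \<circ> g))"
    by (simp add: case_sum_map_sum)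
  from same_type_trans[OF g this]
  have "inst id \<phi> \<in> p \<longleftrightarrow> inst (g2 \<circ> g) \<phi> \<in> p"
    by (rule M1.inv_types_same_type[OF p _ small1 M1.finite_small[OF finite_params] \<phi>(1) order.refl])
  then have "inst g2 (inst g \<phi>) \<in> p" using \<phi>(2) by (simp add: inst_inst inst_id)
  then have "inst g \<phi> \<in> tr p" using tr_iff[OF p g2 gf] by (simp add: params_inst)
  then show "\<phi> \<in> rt (tr p)" using f.tr_iff[OF tr_inv_types[OF p] g \<phi>(1)] by simp
qed

lemma rt_below: "below L S B2 M1 rt M2 id"
  by (rule f.tr_below)

lemma tr_rt: "p \<in> B2 \<Longrightarrow> tr (rt p) = p"
  by (rule monster_pair.rt_tr[OF flip])

end

section \<open>Small orbits and coheirs\<close>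

context monster_model
begin

text \<open>Choose a formula separating each pair of distinct types in \<open>Q\<close> and collect
  all parameters. An automorphism fixing them keeps each type inside \<open>Q\<close> and cannot
  move it to a different one.\<close>

lemma separating_params:
  assumes O: "Q \<subseteq> TS S X" "|Q| <o \<kappa>" "\<And>\<rho> q. \<rho> \<in> automorphisms L M \<Longrightarrow> q \<in> Q \<Longrightarrow> type_action \<rho> q \<in> Q"
  obtains D where "D \<subseteq> univ M" "|D| <o \<kappa>"
    "\<And>\<rho> q. \<rho> \<in> automorphisms L M \<Longrightarrow> \<forall>d\<in>D. \<rho> d = d \<Longrightarrow> q \<in> Q \<Longrightarrow> type_action \<rho> q = q"
proof -
  define sep where "sep = (\<lambda>(q1, q2). SOME \<psi>. \<psi> \<in> global_formulas L S M \<and> \<psi> \<in> q1 \<and> \<psi> \<notin> q2)"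
  have ct: "q \<in> complete_types L S M" if "q \<in> Q" for q using O(1) that type_spaceD by blast
  have sep: "sep (q1, q2) \<in> global_formulas L S M \<and> sep (q1, q2) \<in> q1 \<and> sep (q1, q2) \<notin> q2"
    if "q1 \<in> Q" "q2 \<in> Q" "q1 \<noteq> q2" for q1 q2
  proof -
    have "\<exists>\<psi>. \<psi> \<in> global_formulas L S M \<and> \<psi> \<in> q1 \<and> \<psi> \<notin> q2"
      using complete_types_eqI[OF ct[OF that(1)] ct[OF that(2)]] that(3) by blast
    then show ?thesis unfolding sep_def prod.case by (rule someI_ex)
  qed
  define D where "D = (\<Union>z\<in>Q \<times> Q. params (sep z)) \<inter> univ M"
  have "|\<Union>z\<in>Q \<times> Q. params (sep z)| <o \<kappa>"
    by (rule UNION_finite_ordLess[OF natLeq_lt Cinfinite Times_ordLess[OF Cinfinite O(2) O(2)] finite_params])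
  then have "|D| <o \<kappa>" unfolding D_def by (rule card_subset_ordLess) blast
  moreover have "type_action \<rho> q = q" if \<rho>: "\<rho> \<in> automorphisms L M" "\<forall>d\<in>D. \<rho> d = d" and q: "q \<in> Q" for \<rho> q
  proof (rule ccontr)
    assume ne: "type_action \<rho> q \<noteq> q"
    let ?\<psi> = "sep (type_action \<rho> q, q)"
    have \<psi>: "?\<psi> \<in> global_formulas L S M" "?\<psi> \<in> type_action \<rho> q" "?\<psi> \<notin> q"
      using sep[OF O(3)[OF \<rho>(1) q] q ne] by auto
    have "params ?\<psi> \<subseteq> D" using O(3)[OF \<rho>(1) q] q params_subset[OF \<psi>(1)] unfolding D_def by blast
    then have "inst \<rho> ?\<psi> = ?\<psi>" using \<rho>(2) by (intro inst_id) blast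
    then show False
      using type_action_inst_iff[OF \<rho>(1) \<psi>(1) complete_typesD(1)[OF ct[OF q]]] \<psi> by simp
  qed
  ultimately show ?thesis using that[of D] by (simp add: D_def)
qed

text \<open>
  An ultrafilter on maps \<open>A \<rightarrow> N\<close> that concentrates on the type of \<open>A\<close> over the elementary
  substructure \<open>N\<close>: its average over any parameter set is a coheir of that type.
\<close>

definition coheir :: "'a set \<Rightarrow> 'a set \<Rightarrow> ('a \<Rightarrow> 'a) filter \<Rightarrow> bool" where
  "coheir N A U \<longleftrightarrow> ultrafilter U \<and>
     eventually (\<lambda>n. n \<in> assigns M (sort_of M |` (A \<union> N)) \<and> n ` A \<subseteq> N \<and> (\<forall>d\<in>N. n d = d)) U \<and>
     (\<forall>\<psi>\<in>formulas L (sort_of M |` (A \<union> N)). eventually (\<lambda>n. sat M n [] \<psi>) U \<longleftrightarrow> sat M id [] \<psi>)"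

text \<open>A true formula over \<open>A \<union> N\<close> can be satisfied by values in
  \<open>N\<close> with \<open>N\<close> itself kept fixed. That is the finite intersection property
  needed for the ultrafilter.\<close>

lemma coheir_exists:
  assumes N: "elem_sub N" and A: "finite A" "A \<subseteq> univ M"
  shows "\<exists>U. coheir N A U"
proof -
  let ?Sg = "sort_of M |` (A \<union> N)"
  let ?B = "\<lambda>\<psi>. {n\<in>assigns M ?Sg. (\<forall>a\<in>set_fm \<psi>. n a \<in> N) \<and> (\<forall>d\<in>N. n d = d) \<and> sat M n [] \<psi>}"
  let ?\<Psi> = "{\<psi> \<in> formulas L ?Sg. sat M id [] \<psi>}"
  have "\<exists>U. ultrafilter U \<and> (\<forall>B\<in>?B ` ?\<Psi>. eventually (\<lambda>n. n \<in> B) U)"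
  proof (rule ultrafilter_of_fip)
    fix \<F>' assume "finite \<F>'" "\<F>' \<subseteq> ?B ` ?\<Psi>"
    then obtain F where F: "F \<subseteq> ?\<Psi>" "finite F" "\<F>' = ?B ` F" by (meson finite_subset_image)
    then obtain \<psi>s where \<psi>s: "set \<psi>s = F" using finite_list by blast
    let ?\<chi> = "conj_fm top_fm \<psi>s"
    have "?\<chi> \<in> formulas L ?Sg" "sat M id [] ?\<chi>"
      using F(1) \<psi>s struct by (auto simp: conj_fm_formulas sat_conj_fm)
    moreover have "id \<in> assigns M ?Sg" by (auto simp: assigns_def)
    ultimately obtain n where n: "n \<in> assigns M ?Sg" "\<forall>x\<in>set_fm ?\<chi>. n x \<in> N"
      "\<forall>x. id x \<in> N \<longrightarrow> n x = id x" "sat M n [] ?\<chi>"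
      using elem_sub_realize[OF N] by blast
    have "n \<in> ?B \<psi>" if "\<psi> \<in> F" for \<psi>
      using n that \<psi>s by (auto simp: set_conj_fm sat_conj_fm)
    then show "\<Inter>\<F>' \<noteq> {}" unfolding F(3) by blast
  qed
  then obtain U where U: "ultrafilter U" "\<And>\<psi>. \<psi> \<in> ?\<Psi> \<Longrightarrow> eventually (\<lambda>n. n \<in> ?B \<psi>) U" by blast
  have "eventually (\<lambda>n. sat M n [] \<psi>) U \<longleftrightarrow> sat M id [] \<psi>" if \<psi>: "\<psi> \<in> formulas L ?Sg" for \<psi>
  proof (cases "sat M id [] \<psi>")
    case True
    then have "eventually (\<lambda>n. n \<in> ?B \<psi>) U" using U(2) \<psi> by blast
    then show ?thesis using True by (auto elim: eventually_mono)
  next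
    case False
    then have "Neg \<psi> \<in> ?\<Psi>" using \<psi> by simp
    then have "eventually (\<lambda>n. n \<in> ?B (Neg \<psi>)) U" by (rule U(2))
    then have "eventually (\<lambda>n. \<not> sat M n [] \<psi>) U" by (auto elim: eventually_mono)
    then show ?thesis using False ultrafilter_Not[OF U(1)] by blast
  qed
  moreover have "eventually (\<lambda>n. n \<in> assigns M ?Sg \<and> n ` A \<subseteq> N \<and> (\<forall>d\<in>N. n d = d)) U"
  proof -
    obtain as where as: "set as = A" using A(1) finite_list by blast
    \<comment> \<open>The sets \<open>?B \<psi>\<close> force values into \<open>N\<close> only for
      names occurring in \<open>\<psi>\<close>; trivial equations make all of \<open>A\<close>
      occur.\<close>
    let ?\<chi> = "conj_fm top_fm (map (\<lambda>a. Eq (Free a) (Free a)) as)"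
    have "Eq (Free a) (Free a) \<in> formulas L ?Sg" if a: "a \<in> A" for a
    proof -
      obtain s where "sort_of M a = Some s" using a A(2) by blast
      then show ?thesis using a by (simp add: formulas_def)
    qed
    then have "?\<chi> \<in> formulas L ?Sg" using as by (auto simp: conj_fm_formulas)
    moreover have "sat M id [] ?\<chi>" using struct by (auto simp: sat_conj_fm)
    ultimately have "eventually (\<lambda>n. n \<in> ?B ?\<chi>) U" using U(2) by blast
    then show ?thesis by (rule eventually_mono) (use as in \<open>auto simp: set_conj_fm\<close>)
  qed
  ultimately show ?thesis using U(1) unfolding coheir_def by blast
qed

definition realizes_coheir :: "('a \<Rightarrow> 'a) filter \<Rightarrow> 'a set \<Rightarrow> 'a set \<Rightarrow> ('a \<Rightarrow> 'a) \<Rightarrow> bool" where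
  "realizes_coheir U A P c \<longleftrightarrow> c \<in> assigns M (sort_of M |` A) \<and>
     (\<forall>\<psi>\<in>formulas L (case_sum (sort_of M |` A) (sort_of M |` P)).
        sat M (case_sum c id) [] \<psi> \<longleftrightarrow> eventually (\<lambda>n. sat M (case_sum n id) [] \<psi>) U)"

text \<open>The average of the formulas along \<open>U\<close> is a complete type. It agrees with
  the truth on formulas over \<open>P\<close>, so \<open>realize_type\<close> can keep
  \<open>P\<close> in place.\<close>

lemma realizes_coheir_exists:
  assumes U: "coheir N A U" and A: "finite A" "A \<subseteq> univ M" and P: "P \<subseteq> univ M" "|P| <o \<kappa>"
  shows "\<exists>c. realizes_coheir U A P c"
proof -
  let ?Sg = "case_sum (sort_of M |` A) (sort_of M |` P)"
  let ?Th = "{\<psi> \<in> formulas L ?Sg. eventually (\<lambda>n. sat M (case_sum n id) [] \<psi>) U}"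
  have ult: "ultrafilter U" using U by (simp add: coheir_def)
  have dom: "dom ?Sg = A <+> P"
  proof (rule set_eqI)
    fix z show "z \<in> dom ?Sg \<longleftrightarrow> z \<in> A <+> P"
      using A(2) P(1) by (cases z) (auto simp: restrict_map_def dom_def split: if_splits)
  qed
  have ass: "eventually (\<lambda>n. case_sum n id \<in> assigns M ?Sg) U"
  proof (rule eventually_mono)
    show "eventually (\<lambda>n. n \<in> assigns M (sort_of M |` (A \<union> N)) \<and> n ` A \<subseteq> N \<and> (\<forall>d\<in>N. n d = d)) U"
      using U by (simp add: coheir_def)
    fix n assume n: "n \<in> assigns M (sort_of M |` (A \<union> N)) \<and> n ` A \<subseteq> N \<and> (\<forall>d\<in>N. n d = d)"
    have "sort_of M (n a) = sort_of M a" if "a \<in> A" for a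
    proof -
      have "a \<in> dom (sort_of M |` (A \<union> N))" using that A(2) by auto
      then have "sort_of M (n a) = (sort_of M |` (A \<union> N)) a" using n unfolding assigns_def by blast
      then show ?thesis using that by simp
    qed
    then show "case_sum n id \<in> assigns M ?Sg"
      unfolding assigns_def dom by auto
  qed
  have "\<exists>v\<in>assigns M ?Sg. (\<forall>x\<in>Inr ` P. v x = case_sum (\<lambda>_. undefined) id x) \<and>
      (\<forall>\<phi>\<in>formulas L ?Sg. \<phi> \<in> ?Th \<longleftrightarrow> sat M v [] \<phi>)"
  proof (rule realize_type)
    show "?Th \<subseteq> formulas L ?Sg" by blast
    show "\<phi> \<in> ?Th \<or> Neg \<phi> \<in> ?Th" if "\<phi> \<in> formulas L ?Sg" for \<phi>
      using that ult by (auto simp: ultrafilter_def)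
    show "\<exists>v\<in>assigns M ?Sg. \<forall>\<phi>\<in>F. sat M v [] \<phi>" if "F \<subseteq> ?Th" "finite F" for F
    proof -
      have "eventually (\<lambda>n. \<forall>\<phi>\<in>F. sat M (case_sum n id) [] \<phi>) U"
        using that by (intro eventually_ball_finite) auto
      from eventually_conj[OF ass this]
      obtain n where "case_sum n id \<in> assigns M ?Sg" "\<forall>\<phi>\<in>F. sat M (case_sum n id) [] \<phi>"
        using ult eventually_happens' unfolding ultrafilter_def by blast
      then show ?thesis by blast
    qed
    show "|dom ?Sg| <o \<kappa>" unfolding dom by (rule Plus_ordLess[OF Cinfinite finite_small[OF A(1)] P(2)])
    show "Inr ` P \<subseteq> dom ?Sg" unfolding dom by blast
    show "case_sum (\<lambda>_. undefined) id \<in> assigns M (?Sg |` (Inr ` P))"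
      by (auto simp: assigns_def restrict_map_def split: if_splits)
    show "\<phi> \<in> ?Th \<longleftrightarrow> sat M (case_sum (\<lambda>_. undefined) id) [] \<phi>" if "\<phi> \<in> formulas L (?Sg |` (Inr ` P))" for \<phi>
    proof -
      have f: "\<phi> \<in> formulas L ?Sg" "set_fm \<phi> \<subseteq> Inr ` P" using that by (auto simp: formulas_restrict_iff)
      \<comment> \<open>The truth value does not depend on \<open>n\<close>, because the formula
        mentions parameters from \<open>P\<close> only; so its average is its truth value.\<close>
      define b where "b \<longleftrightarrow> sat M (case_sum (\<lambda>_. undefined) id) [] \<phi>"
      have "sat M (case_sum n id) [] \<phi> \<longleftrightarrow> b" for n
        unfolding b_def using f(2) by (intro sat_cong) auto
      then have "eventually (\<lambda>n. sat M (case_sum n id) [] \<phi>) U \<longleftrightarrow> b"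
        using ult by (simp add: ultrafilter_def)
      then show ?thesis using f(1) unfolding b_def by simp
    qed
  qed
  then obtain v where v0: "v \<in> assigns M ?Sg" "\<forall>x\<in>Inr ` P. v x = case_sum (\<lambda>_. undefined) id x"
    "\<forall>\<phi>\<in>formulas L ?Sg. \<phi> \<in> ?Th \<longleftrightarrow> sat M v [] \<phi>" by (elim bexE conjE) (rule that)
  have v: "v \<in> assigns M ?Sg" "\<And>d. d \<in> P \<Longrightarrow> v (Inr d) = d"
    "\<And>\<psi>. \<psi> \<in> formulas L ?Sg \<Longrightarrow>
      eventually (\<lambda>n. sat M (case_sum n id) [] \<psi>) U \<longleftrightarrow> sat M v [] \<psi>"
    using v0(1,2) bspec[OF v0(3)] by simp_all
  have vc: "sat M v [] \<psi> \<longleftrightarrow> sat M (case_sum (v \<circ> Inl) id) [] \<psi>" if "\<psi> \<in> formulas L ?Sg" for \<psi>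
    using that
  proof (rule sat_formulas_cong)
    fix z assume "z \<in> dom ?Sg"
    then show "v z = case_sum (v \<circ> Inl) id z" unfolding dom using v(2) by (cases z) auto
  qed
  have "v \<circ> Inl \<in> assigns M (sort_of M |` A)"
    using v(1) by (rule assigns_comp) (auto simp: map_le_def)
  then have "realizes_coheir U A P (v \<circ> Inl)" unfolding realizes_coheir_def using v(3) vc by blast
  then show ?thesis by (rule exI[of _ "v \<circ> Inl"])
qed

definition same_type_over :: "'a set \<Rightarrow> 'a set \<Rightarrow> ('a \<Rightarrow> 'a) \<Rightarrow> bool" where
  "same_type_over N A e \<longleftrightarrow>
     same_type L (case_sum (sort_of M |` A) (sort_of M |` N)) M (case_sum id id) M (case_sum e id)"

lemma assigns_case_sum_id: "case_sum id id \<in> assigns M (case_sum (sort_of M |` A) (sort_of M |` N))"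
  unfolding assigns_def
proof (intro CollectI ballI)
  fix z assume "z \<in> dom (case_sum (sort_of M |` A) (sort_of M |` N))"
  then show "sort_of M (case_sum id id z) = case_sum (sort_of M |` A) (sort_of M |` N) z"
    by (cases z) (auto simp: restrict_map_def split: if_splits)
qed

lemma same_type_over_id: "same_type_over N A id"
  unfolding same_type_over_def by (rule same_type_refl[OF assigns_case_sum_id])

lemma same_type_over_aut:
  assumes "\<sigma> \<in> automorphisms L M" "\<forall>d\<in>N. \<sigma> d = d"
  shows "same_type_over N A \<sigma>"
proof -
  from same_type_aut[OF struct assigns_case_sum_id assms(1)] show ?thesis unfolding same_type_over_def
  proof (rule same_type_cong)
    fix z assume z: "z \<in> dom (case_sum (sort_of M |` A) (sort_of M |` N))"
    show "(\<sigma> \<circ> case_sum id id) z = case_sum \<sigma> id z"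
      using z assms(2) by (cases z) (auto simp: restrict_map_def split: if_splits)
  qed simp
qed

lemma same_type_over_sort:
  assumes "same_type_over N A e" "a \<in> A" "a \<in> univ M"
  shows "sort_of M (e a) = sort_of M a"
proof -
  let ?Sg = "case_sum (sort_of M |` A) (sort_of M |` N)"
  have "Inl a \<in> dom ?Sg" using assms(2,3) by auto
  then have "sort_of M (case_sum e id (Inl a)) = ?Sg (Inl a)"
    using assms(1) unfolding same_type_over_def same_type_def assigns_def by blast
  with assms(2) show ?thesis by simp
qed

text \<open>The coheir extends the type of \<open>A\<close> over \<open>N\<close>: almost every
  \<open>n\<close> fixes \<open>N\<close>, so averaging a formula over \<open>N\<close> gives its
  value at \<open>A\<close>.\<close>

lemma realizes_coheir_same_type_over:
  assumes U: "coheir N A U" and c: "realizes_coheir U A P c" and N: "N \<subseteq> P" "N \<subseteq> univ M" and A: "A \<subseteq> univ M"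
  shows "same_type_over N A c"
  unfolding same_type_over_def same_type_def
proof (intro conjI ballI)
  let ?Sg = "case_sum (sort_of M |` A) (sort_of M |` N)"
  show "case_sum id id \<in> assigns M ?Sg" by (rule assigns_case_sum_id)
  have cA: "c \<in> assigns M (sort_of M |` A)" using c by (simp add: realizes_coheir_def)
  show "case_sum c id \<in> assigns M ?Sg"
    unfolding assigns_def
  proof (intro CollectI ballI)
    fix z assume z: "z \<in> dom ?Sg"
    show "sort_of M (case_sum c id z) = ?Sg z"
    proof (cases z)
      case (Inl a)
      then have "a \<in> dom (sort_of M |` A)" using z by (simp add: dom_def)
      then show ?thesis using cA Inl unfolding assigns_def by auto
    next
      case (Inr d) then show ?thesis using z by (auto simp: restrict_map_def split: if_splits)
    qed
  qed
  fix \<psi> assume \<psi>: "\<psi> \<in> formulas L ?Sg"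
  let ?\<chi> = "map_fm (case_sum id id) \<psi>"
  have le: "?Sg \<subseteq>\<^sub>m sort_of M |` (A \<union> N) \<circ> case_sum id id" unfolding map_le_def
  proof
    fix z assume "z \<in> dom ?Sg"
    then show "?Sg z = (sort_of M |` (A \<union> N) \<circ> case_sum id id) z"
      by (cases z) (auto simp: restrict_map_def split: if_splits)
  qed
  have \<chi>: "?\<chi> \<in> formulas L (sort_of M |` (A \<union> N))"
    using formulas_map_le[OF \<psi> le] by (simp add: formulas_map)
  have "?Sg \<subseteq>\<^sub>m case_sum (sort_of M |` A) (sort_of M |` P)" unfolding map_le_def
  proof
    fix z assume "z \<in> dom ?Sg"
    then show "?Sg z = case_sum (sort_of M |` A) (sort_of M |` P) z"
      using N by (cases z) (auto simp: restrict_map_def split: if_splits)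
  qed
  from formulas_map_le[OF \<psi> this]
  have "sat M (case_sum c id) [] \<psi> \<longleftrightarrow> eventually (\<lambda>n. sat M (case_sum n id) [] \<psi>) U"
    using c by (simp add: realizes_coheir_def)
  also have "\<dots> \<longleftrightarrow> eventually (\<lambda>n. sat M n [] ?\<chi>) U"
  proof (rule eventually_cong)
    show "eventually (\<lambda>n. \<forall>d\<in>N. n d = d) U" using U unfolding coheir_def by (auto elim: eventually_mono)
    fix n :: "'a \<Rightarrow> 'a" assume n: "\<forall>d\<in>N. n d = d"
    have "sat M (case_sum n id) [] \<psi> \<longleftrightarrow> sat M (n \<circ> case_sum id id) [] \<psi>" using \<psi>
    proof (rule sat_formulas_cong)
      fix z assume "z \<in> dom ?Sg"
      then show "case_sum n id z = (n \<circ> case_sum id id) z"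
        using n by (cases z) (auto simp: restrict_map_def split: if_splits)
    qed
    then show "sat M (case_sum n id) [] \<psi> \<longleftrightarrow> sat M n [] ?\<chi>" by (simp add: sat_map)
  qed
  also have "\<dots> \<longleftrightarrow> sat M id [] ?\<chi>" using U \<chi> by (simp add: coheir_def)
  also have "\<dots> \<longleftrightarrow> sat M (case_sum id id) [] \<psi>" by (simp add: sat_map)
  finally show "sat M (case_sum id id) [] \<psi> \<longleftrightarrow> sat M (case_sum c id) [] \<psi>" by simp
qed

text \<open>
  A realization of the coheir over parameters containing \<open>e ` A\<close> has, jointly with \<open>e\<close>, a type that
  does not depend on \<open>e\<close>, as long as \<open>e\<close> has the type of \<open>A\<close> over \<open>N\<close>.
\<close>

lemma realizes_coheir_pair:
  assumes U: "coheir N A U" and c: "realizes_coheir U A P c" and e: "same_type_over N A e" "e ` A \<subseteq> P"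
    and A: "A \<subseteq> univ M" and N: "N \<subseteq> univ M"
    and \<psi>: "\<psi> \<in> formulas L (case_sum (sort_of M |` A) (sort_of M |` A))"
  shows "sat M (case_sum c e) [] \<psi> \<longleftrightarrow> eventually (\<lambda>n. sat M (case_sum n id) [] \<psi>) U"
proof -
  let ?Sg = "case_sum (sort_of M |` A) (sort_of M |` A)"
  have "?Sg \<subseteq>\<^sub>m case_sum (sort_of M |` A) (sort_of M |` P) \<circ> map_sum id e" unfolding map_le_def
  proof
    fix z assume z: "z \<in> dom ?Sg"
    show "?Sg z = (case_sum (sort_of M |` A) (sort_of M |` P) \<circ> map_sum id e) z"
    proof (cases z)
      case (Inr a)
      then have "a \<in> A" using z by (auto simp: restrict_map_def split: if_splits)
      moreover from this have "a \<in> univ M" "e a \<in> P" using A e(2) by blast+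
      ultimately show ?thesis using same_type_over_sort[OF e(1), of a] Inr by simp
    qed simp
  qed
  from formulas_map_le[OF \<psi> this]
  have "map_fm (map_sum id e) \<psi> \<in> formulas L (case_sum (sort_of M |` A) (sort_of M |` P))"
    by (simp add: formulas_map)
  then have "sat M (case_sum c id) [] (map_fm (map_sum id e) \<psi>) \<longleftrightarrow>
      eventually (\<lambda>n. sat M (case_sum n id) [] (map_fm (map_sum id e) \<psi>)) U"
    using c by (simp add: realizes_coheir_def)
  then have "sat M (case_sum c e) [] \<psi> \<longleftrightarrow> eventually (\<lambda>n. sat M (case_sum n e) [] \<psi>) U"
    by (simp add: sat_map case_sum_map_sum)
  also have "\<dots> \<longleftrightarrow> eventually (\<lambda>n. sat M (case_sum n id) [] \<psi>) U"
  proof (rule eventually_cong)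
    show "eventually (\<lambda>n. n \<in> assigns M (sort_of M |` (A \<union> N)) \<and> n ` A \<subseteq> N \<and> (\<forall>d\<in>N. n d = d)) U"
      using U by (simp add: coheir_def)
    fix n assume n: "n \<in> assigns M (sort_of M |` (A \<union> N)) \<and> n ` A \<subseteq> N \<and> (\<forall>d\<in>N. n d = d)"
    \<comment> \<open>Since \<open>n\<close> takes values in \<open>N\<close>, putting
      \<open>n\<close> for the left names yields a formula with parameters in \<open>N\<close> about
      the right names, and there \<open>e\<close> and the identity agree.\<close>
    define j where "j = case_sum (\<lambda>a. Inr (n a)) (Inl :: 'a \<Rightarrow> 'a + 'a)"
    have "?Sg \<subseteq>\<^sub>m case_sum (sort_of M |` A) (sort_of M |` N) \<circ> j" unfolding map_le_def
    proof
      fix z assume z: "z \<in> dom ?Sg"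
      show "?Sg z = (case_sum (sort_of M |` A) (sort_of M |` N) \<circ> j) z"
      proof (cases z)
        case (Inl a)
        then have a: "a \<in> A" using z by (auto simp: restrict_map_def split: if_splits)
        then have "a \<in> dom (sort_of M |` (A \<union> N))" using A by auto
        then have "sort_of M (n a) = (sort_of M |` (A \<union> N)) a" using n unfolding assigns_def by blast
        then show ?thesis using a n Inl by (auto simp: j_def)
      qed (simp add: j_def)
    qed
    from same_type_sat[OF same_type_comp[OF e(1)[unfolded same_type_over_def] this] \<psi>]
    have "sat M (case_sum id id \<circ> j) [] \<psi> \<longleftrightarrow> sat M (case_sum e id \<circ> j) [] \<psi>" .
    moreover have "case_sum id id \<circ> j = case_sum n id" "case_sum e id \<circ> j = case_sum n e"
      by (auto simp: j_def fun_eq_iff split: sum.splits)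
    ultimately show "sat M (case_sum n e) [] \<psi> \<longleftrightarrow> sat M (case_sum n id) [] \<psi>" by simp
  qed
  finally show ?thesis .
qed

text \<open>Suppose that \<open>q\<close> contains an instance of \<open>\<phi>\<close> at a tuple
  \<open>a\<close> but not at \<open>\<sigma> a\<close>. Let \<open>c\<close> realize the coheir of
  \<open>a\<close> over everything relevant, and \<open>c'\<close> realize it over that and
  \<open>c\<close>. Types in \<open>Q\<close> cannot separate \<open>c\<close> from
  \<open>c'\<close>. As \<open>(c, a)\<close>, \<open>(c, \<sigma> a)\<close> and
  \<open>(c', c)\<close> have the same type, the instances of \<open>\<phi>\<close> at
  \<open>a\<close> and at \<open>\<sigma> a\<close> are both equivalent, modulo membership in
  \<open>q\<close>, to the instance at \<open>c\<close>.\<close>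

lemma small_orbit_fixed:
  assumes N: "elem_sub N" "|N| <o \<kappa>"
    and Q: "Q \<subseteq> TS S X" "|Q| <o \<kappa>" "\<And>\<rho> q. \<rho> \<in> automorphisms L M \<Longrightarrow> q \<in> Q \<Longrightarrow> type_action \<rho> q \<in> Q"
    and q: "q \<in> Q" and \<sigma>: "\<sigma> \<in> automorphisms L M" "\<forall>d\<in>N. \<sigma> d = d"
  shows "type_action \<sigma> q = q"
proof (rule ccontr)
  assume ne: "type_action \<sigma> q \<noteq> q"
  let ?i = "inv_into (univ M) \<sigma>"
  have i: "?i \<in> automorphisms L M" by (rule aut_inv[OF struct \<sigma>(1)])
  have ct: "r \<in> complete_types L S M" if "r \<in> Q" for r using Q(1) that type_spaceD by blast
  have qf: "r \<subseteq> global_formulas L S M" if "r \<in> Q" for r using complete_typesD(1)[OF ct[OF that]] .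
  have "type_action ?i q \<noteq> q"
    using ne type_action_inv(2)[OF \<sigma>(1) qf[OF q]] by metis
  then obtain \<phi> where \<phi>: "\<phi> \<in> global_formulas L S M" "\<phi> \<in> q" "\<phi> \<notin> type_action ?i q"
    using complete_types_eqI[OF ct[OF q] ct[OF Q(3)[OF i q]]] by metis
  then have \<phi>\<sigma>: "inst \<sigma> \<phi> \<notin> q" using type_action_inv_iff[OF struct \<sigma>(1) \<phi>(1) qf[OF q]] by simp
  let ?A = "params \<phi>"
  have A: "finite ?A" "?A \<subseteq> univ M" using finite_params params_subset[OF \<phi>(1)] by auto
  have Nu: "N \<subseteq> univ M" using N(1) by (simp add: elem_sub_def)
  obtain D where D: "D \<subseteq> univ M" "|D| <o \<kappa>"
    "\<And>\<rho> q. \<rho> \<in> automorphisms L M \<Longrightarrow> \<forall>d\<in>D. \<rho> d = d \<Longrightarrow> q \<in> Q \<Longrightarrow> type_action \<rho> q = q"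
    using separating_params[OF Q] by blast
  obtain U where U: "coheir N ?A U" using coheir_exists[OF N(1) A] by blast
  \<comment> \<open>\<open>N\<close> makes \<open>c\<close> have the type of the tuple over
    \<open>N\<close>, both tuples are included for \<open>realizes_coheir_pair\<close>, and
    \<open>D\<close> makes the types in \<open>Q\<close> blind to the choice of realization.\<close>
  define P where "P = N \<union> ?A \<union> \<sigma> ` ?A \<union> D"
  have \<sigma>A: "\<sigma> ` ?A \<subseteq> univ M"
    using A(2) bij_betw_imp_surj_on[OF aut_bij[OF \<sigma>(1)]] by blast
  have P: "P \<subseteq> univ M" "|P| <o \<kappa>"
    unfolding P_def using Nu A(2) \<sigma>A D(1)
    by (blast, intro Un_small N(2) D(2) finite_small finite_imageI A(1))
  obtain c where c: "realizes_coheir U ?A P c" using realizes_coheir_exists[OF U A P] by blast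
  have stc: "same_type_over N ?A c"
    by (rule realizes_coheir_same_type_over[OF U c _ Nu A(2)]) (auto simp: P_def)
  have cA: "c ` ?A \<subseteq> univ M"
  proof
    fix b assume "b \<in> c ` ?A"
    then obtain a where a: "a \<in> ?A" "b = c a" by blast
    then have au: "a \<in> univ M" using A(2) by blast
    from same_type_over_sort[OF stc a(1) au] au a(2) show "b \<in> univ M" by (metis domIff)
  qed
  \<comment> \<open>Adding \<open>c\<close> makes the pair \<open>(c', c)\<close> another instance
    of a realization over an earlier tuple.\<close>
  define P' where "P' = P \<union> c ` ?A"
  have P': "P' \<subseteq> univ M" "|P'| <o \<kappa>"
    unfolding P'_def using P(1) cA by (blast, intro Un_small P(2) finite_small finite_imageI A(1))
  obtain c' where c': "realizes_coheir U ?A P' c'" using realizes_coheir_exists[OF U A P'] by blast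
  have stc': "same_type_over N ?A c'"
    by (rule realizes_coheir_same_type_over[OF U c' _ Nu A(2)]) (auto simp: P'_def P_def)
  have gf: "inst e \<phi> \<in> global_formulas L S M" if "same_type_over N ?A e" for e
    using same_type_over_sort[OF that] A(2) by (intro inst_global_formulas[OF \<phi>(1)]) blast
  have "\<exists>\<rho>\<in>automorphisms L M. (\<forall>a\<in>?A. \<rho> (c a) = c' a) \<and> (\<forall>d\<in>P. \<rho> d = d)"
  proof -
    let ?Sg = "case_sum (sort_of M |` ?A) (sort_of M |` P)"
    have dom: "z \<in> dom ?Sg \<longleftrightarrow> z \<in> ?A <+> P" for z
      using A(2) P(1) by (cases z) (auto simp: restrict_map_def dom_def split: if_splits)
    have le: "?Sg \<subseteq>\<^sub>m case_sum (sort_of M |` ?A) (sort_of M |` P')" unfolding map_le_def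
    proof
      fix z assume "z \<in> dom ?Sg"
      then show "?Sg z = case_sum (sort_of M |` ?A) (sort_of M |` P') z"
        by (cases z) (auto simp: P'_def restrict_map_def split: if_splits)
    qed
    have ass: "case_sum e id \<in> assigns M ?Sg" if "same_type_over N ?A e" for e
      unfolding assigns_def
    proof (intro CollectI ballI)
      fix z assume "z \<in> dom ?Sg"
      then have z: "z \<in> ?A <+> P" unfolding dom .
      have "sort_of M (e a) = sort_of M a" if "a \<in> ?A" for a
        using same_type_over_sort[OF \<open>same_type_over N ?A e\<close> that] A(2) that by blast
      with z show "sort_of M (case_sum e id z) = ?Sg z" by (cases z) auto
    qed
    have st: "same_type L ?Sg M (case_sum c id) M (case_sum c' id)"
      unfolding same_type_def
    proof (intro conjI ballI ass stc stc')
      fix \<psi> assume \<psi>: "\<psi> \<in> formulas L ?Sg"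
      from \<psi> formulas_map_le[OF \<psi> le] c c'
      show "sat M (case_sum c id) [] \<psi> \<longleftrightarrow> sat M (case_sum c' id) [] \<psi>"
        by (simp add: realizes_coheir_def)
    qed
    have "dom ?Sg = ?A <+> P" using dom by (rule set_eqI)
    then have "|dom ?Sg| <o \<kappa>" using Plus_ordLess[OF Cinfinite finite_small[OF A(1)] P(2)] by simp
    from homogeneous[OF st this] obtain \<rho> where \<rho>: "\<rho> \<in> automorphisms L M"
      "\<And>z. z \<in> dom ?Sg \<Longrightarrow> \<rho> (case_sum c id z) = case_sum c' id z" by (elim bexE) (rule that, assumption, rule bspec)
    have "\<rho> (c a) = c' a" if "a \<in> ?A" for a using \<rho>(2)[of "Inl a"] that unfolding dom by (simp add: InlI)
    moreover have "\<rho> d = d" if "d \<in> P" for d using \<rho>(2)[of "Inr d"] that unfolding dom by (simp add: InrI)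
    ultimately show ?thesis using \<rho>(1) by blast
  qed
  then obtain \<rho> where \<rho>: "\<rho> \<in> automorphisms L M" "\<forall>a\<in>?A. \<rho> (c a) = c' a" "\<forall>d\<in>P. \<rho> d = d" by blast
  \<comment> \<open>Both \<open>c\<close> and \<open>c'\<close> realize the coheir over
    \<open>P\<close>, so \<open>\<rho>\<close> can fix \<open>P\<close> and in particular the
    separating parameters \<open>D\<close>.\<close>
  have fixQ: "type_action \<rho> r = r" if "r \<in> Q" for r
    using D(3)[OF \<rho>(1) _ that] \<rho>(3) by (auto simp: P_def)
  have agree: "inst c \<phi> \<in> r \<longleftrightarrow> inst c' \<phi> \<in> r" if "r \<in> Q" for r
  proof -
    have "inst \<rho> (inst c \<phi>) = inst c' \<phi>" unfolding inst_inst using \<rho>(2) by (intro inst_cong) simp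
    with type_action_inst_iff[OF \<rho>(1) gf[OF stc] qf[OF that]] fixQ[OF that] show ?thesis by simp
  qed
  \<comment> \<open>An automorphism \<open>\<tau>\<close> takes \<open>(c, e)\<close> to
    \<open>(c', c)\<close>. Apply it to \<open>q\<close>, exchange \<open>c\<close> and
    \<open>c'\<close> inside the translated type, which is still in \<open>Q\<close>, and come
    back.\<close>
  have move: "inst e \<phi> \<in> q \<longleftrightarrow> inst c \<phi> \<in> q" if e: "same_type_over N ?A e" "e ` ?A \<subseteq> P" for e
  proof -
    let ?Sg = "case_sum (sort_of M |` ?A) (sort_of M |` ?A)"
    have dom: "z \<in> dom ?Sg \<longleftrightarrow> z \<in> ?A <+> ?A" for z
      using A(2) by (cases z) (auto simp: restrict_map_def dom_def split: if_splits)
    have ass: "case_sum u w \<in> assigns M ?Sg" if "same_type_over N ?A u" "same_type_over N ?A w" for u w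
      unfolding assigns_def
    proof (intro CollectI ballI)
      fix z assume "z \<in> dom ?Sg"
      then have z: "z \<in> ?A <+> ?A" unfolding dom .
      have "sort_of M (u a) = sort_of M a" "sort_of M (w a) = sort_of M a" if "a \<in> ?A" for a
        using same_type_over_sort[OF \<open>same_type_over N ?A u\<close> that]
          same_type_over_sort[OF \<open>same_type_over N ?A w\<close> that] A(2) that by blast+
      with z show "sort_of M (case_sum u w z) = ?Sg z" by (cases z) auto
    qed
    have st: "same_type L ?Sg M (case_sum c e) M (case_sum c' c)"
      unfolding same_type_def
    proof (intro conjI ballI ass stc stc' e(1))
      fix \<psi> assume \<psi>: "\<psi> \<in> formulas L ?Sg"
      have "c ` ?A \<subseteq> P'" by (simp add: P'_def)
      from realizes_coheir_pair[OF U c e A(2) Nu \<psi>] realizes_coheir_pair[OF U c' stc this A(2) Nu \<psi>]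
      show "sat M (case_sum c e) [] \<psi> \<longleftrightarrow> sat M (case_sum c' c) [] \<psi>" by simp
    qed
    have "dom ?Sg = ?A <+> ?A" using dom by (rule set_eqI)
    then have "|dom ?Sg| <o \<kappa>" using A(1) by (intro finite_small) simp
    from homogeneous[OF st this] obtain \<tau> where \<tau>: "\<tau> \<in> automorphisms L M"
      "\<And>z. z \<in> dom ?Sg \<Longrightarrow> \<tau> (case_sum c e z) = case_sum c' c z" by (elim bexE) (rule that, assumption, rule bspec)
    have "\<tau> (c a) = c' a" "\<tau> (e a) = c a" if "a \<in> ?A" for a
      using \<tau>(2)[of "Inl a"] \<tau>(2)[of "Inr a"] that unfolding dom by auto
    then have "inst \<tau> (inst c \<phi>) = inst c' \<phi>" "inst \<tau> (inst e \<phi>) = inst c \<phi>"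
      unfolding inst_inst by (intro inst_cong; simp)+
    with type_action_inst_iff[OF \<tau>(1) gf[OF stc] qf[OF q]] type_action_inst_iff[OF \<tau>(1) gf[OF e(1)] qf[OF q]]
      agree[OF Q(3)[OF \<tau>(1) q]]
    show ?thesis by simp
  qed
  have "inst id \<phi> \<in> q \<longleftrightarrow> inst c \<phi> \<in> q"
    by (rule move[OF same_type_over_id]) (auto simp: P_def)
  moreover have "inst \<sigma> \<phi> \<in> q \<longleftrightarrow> inst c \<phi> \<in> q"
    by (rule move[OF same_type_over_aut[OF \<sigma>]]) (auto simp: P_def)
  moreover have "inst id \<phi> = \<phi>" by (rule inst_id) simp
  ultimately show False using \<phi>(2) \<phi>\<sigma> by simp
qed

text \<open>Invariance over the conjugate of \<open>N\<close> by \<open>\<tau>\<close> is invariance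
  of the translate of \<open>q\<close> by the inverse of \<open>\<tau>\<close> over \<open>N\<close>
  itself, and that translate lies in the same small orbit.\<close>

lemma small_orbit_inv_types:
  assumes N: "elem_sub N" "|N| <o \<kappa>" and q: "q \<in> TS S X"
    and small: "|(\<lambda>\<tau>. type_action \<tau> q) ` automorphisms L M| <o \<kappa>"
  shows "q \<in> inv_types L S X M N id"
proof -
  let ?Q = "(\<lambda>\<tau>. type_action \<tau> q) ` automorphisms L M"
  have qf: "q \<subseteq> global_formulas L S M" using complete_typesD(1)[OF type_spaceD[OF q]] .
  have Q: "?Q \<subseteq> TS S X" using type_action_type_space[OF struct _ q] by blast
  have cl: "type_action \<rho> r \<in> ?Q" if "\<rho> \<in> automorphisms L M" "r \<in> ?Q" for \<rho> r
  proof -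
    from that(2) obtain \<tau> where \<tau>: "\<tau> \<in> automorphisms L M" "r = type_action \<tau> q" by blast
    show ?thesis unfolding \<tau>(2) type_action_comp using aut_comp[OF that(1) \<tau>(1)] by blast
  qed
  have "type_action \<sigma> q = q" if \<sigma>: "\<sigma> \<in> automorphisms L M" and \<tau>: "\<tau> \<in> automorphisms L M"
    and fixes_N: "\<forall>x\<in>N. \<sigma> (\<tau> (id x)) = \<tau> (id x)" for \<sigma> \<tau>
  proof -
    let ?i = "inv_into (univ M) \<tau>"
    have i: "?i \<in> automorphisms L M" by (rule aut_inv[OF struct \<tau>])
    let ?s = "?i \<circ> \<sigma> \<circ> \<tau>"
    have s: "?s \<in> automorphisms L M" by (intro aut_comp i \<sigma> \<tau>)
    have "?s d = d" if "d \<in> N" for d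
      using fixes_N that aut_inv_apply(1)[OF \<tau>, of d] N(1) by (auto simp: elem_sub_def)
    moreover have iq: "type_action ?i q \<in> ?Q" using i by blast
    ultimately have "type_action ?s (type_action ?i q) = type_action ?i q"
      using small_orbit_fixed[OF N Q small cl _ s] by blast
    then have "type_action \<tau> (type_action ?s (type_action ?i q)) = q"
      using type_action_inv(2)[OF \<tau> qf] by simp
    moreover have "type_action \<tau> (type_action ?s (type_action ?i q)) = type_action \<sigma> q"
    proof -
      have 1: "type_action ?s (type_action ?i q) = type_action ?i (type_action \<sigma> (type_action \<tau> (type_action ?i q)))"
        by (simp add: type_action_comp o_assoc)
      have 2: "type_action \<sigma> q \<subseteq> global_formulas L S M" using type_action_formulas[OF \<sigma> qf] .
      show ?thesis unfolding 1 type_action_inv(2)[OF \<tau> qf] type_action_inv(2)[OF \<tau> 2] ..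
    qed
    ultimately show ?thesis by simp
  qed
  with q show ?thesis unfolding inv_types_def by blast
qed

section \<open>Bounding minimal left ideals\<close>

text \<open>
  The parameters at which an instance of \<open>\<phi>\<close> belongs to \<open>p\<close>. An element of the Ellis semigroup
  acts on these sets, and there are few of them even if there are many variables \<open>x\<^sub>i\<close>.
\<close>

definition defset :: "('f, 'r, 's, 'i + nat) fm \<Rightarrow> ('f, 'r, 's, 'i + 'a) fm set \<Rightarrow> 'a list set" where
  "defset \<phi> p = {b. set b \<subseteq> univ M \<and> params \<phi> \<subseteq> {..<length b} \<and> inst ((!) b) \<phi> \<in> p}"

lemma inst_nth_map: "params \<phi> \<subseteq> {..<length b} \<Longrightarrow> inst \<rho> (inst ((!) b) \<phi>) = inst ((!) (map \<rho> b)) \<phi>"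
  unfolding inst_inst by (rule inst_cong) auto

lemma params_inst_nth: "params \<phi> \<subseteq> {..<length b} \<Longrightarrow> params (inst ((!) b) \<phi>) \<subseteq> set b"
  unfolding params_inst by auto

lemma aut_univ: "\<sigma> \<in> automorphisms L M \<Longrightarrow> set b \<subseteq> univ M \<Longrightarrow> set (map \<sigma> b) \<subseteq> univ M"
  using bij_betw_apply[OF aut_bij, of \<sigma> L M] unfolding set_map by blast

text \<open>By approximation, \<open>b\<close> lies in the set of \<open>e p\<close> iff
  \<open>map \<rho> b\<close> lies in that of \<open>p\<close>. The latter set alone matters, so the
  image does not depend on which \<open>\<phi>\<close> and \<open>p\<close> define it.\<close>

lemma defset_action_subset:
  assumes e: "e \<in> EL S X" and p: "p \<in> TS S X" "p' \<in> TS S X" and eq: "defset \<phi> p = defset \<phi>' p'"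
  shows "defset \<phi> (e p) \<subseteq> defset \<phi>' (e p')"
proof
  fix b assume "b \<in> defset \<phi> (e p)"
  then have b: "set b \<subseteq> univ M" "params \<phi> \<subseteq> {..<length b}" "inst ((!) b) \<phi> \<in> e p" by (auto simp: defset_def)
  note ct = complete_typesD(1)[OF type_spaceD]
  have gf: "inst ((!) b) \<phi> \<in> global_formulas L S M"
    using b(3) ct[OF ellis_type_space[OF e p(1)]] by blast
  \<comment> \<open>The instance of \<open>\<phi>'\<close> at \<open>b\<close> is not yet known to
    be well-sorted. The intersection leaves it out if it is not; its well-sortedness is recovered
    below by undoing \<open>\<rho>\<close>.\<close>
  let ?Z = "{(p, inst ((!) b) \<phi>), (p', inst ((!) b) \<phi>')} \<inter> TS S X \<times> global_formulas L S M"
  obtain \<rho> where \<rho>: "\<rho> \<in> automorphisms L M" "\<And>q \<psi>. (q, \<psi>) \<in> ?Z \<Longrightarrow> \<psi> \<in> e q \<longleftrightarrow> inst \<rho> \<psi> \<in> q"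
    by (rule ellis_approx[OF e, of ?Z]) (simp, blast, rule that)
  have "inst \<rho> (inst ((!) b) \<phi>) \<in> p" using \<rho>(2)[of p "inst ((!) b) \<phi>"] gf p b(3) by simp
  then have "map \<rho> b \<in> defset \<phi> p"
    using b(2) aut_univ[OF \<rho>(1) b(1)] by (simp add: defset_def inst_nth_map)
  then have b': "params \<phi>' \<subseteq> {..<length b}" "inst ((!) (map \<rho> b)) \<phi>' \<in> p'"
    unfolding eq by (auto simp: defset_def)
  let ?\<psi> = "inst ((!) b) \<phi>'"
  have in_p': "inst \<rho> ?\<psi> \<in> p'" using b' by (simp add: inst_nth_map)
  then have "inst \<rho> ?\<psi> \<in> global_formulas L S M" using ct[OF p(2)] by blast
  then have "inst (inv_into (univ M) \<rho>) (inst \<rho> ?\<psi>) \<in> global_formulas L S M"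
    by (rule aut_inst[OF aut_inv[OF struct \<rho>(1)]])
  moreover have "inst (inv_into (univ M) \<rho>) (inst \<rho> ?\<psi>) = ?\<psi>"
  proof -
    have "inv_into (univ M) \<rho> (\<rho> a) = a" if "a \<in> params ?\<psi>" for a
      using params_inst_nth[OF b'(1)] b(1) aut_inv_apply(1)[OF \<rho>(1)] that by blast
    then show ?thesis unfolding inst_inst[of "inv_into (univ M) \<rho>" \<rho>] by (intro inst_id) simp
  qed
  ultimately have "?\<psi> \<in> global_formulas L S M" by simp
  then have "?\<psi> \<in> e p'" using \<rho>(2)[of p' ?\<psi>] p in_p' by simp
  then show "b \<in> defset \<phi>' (e p')" using b(1) b'(1) by (simp add: defset_def)
qed

lemma defset_action:
  assumes "e \<in> EL S X" "p \<in> TS S X" "p' \<in> TS S X" "defset \<phi> p = defset \<phi>' p'"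
  shows "defset \<phi> (e p) = defset \<phi>' (e p')"
  by (rule equalityI[OF defset_action_subset[OF assms] defset_action_subset[OF assms(1,3,2) assms(4)[symmetric]]])

text \<open>Every formula over the model is an instance of one with numbered parameters: list its
  parameters and replace each by a position in the list.\<close>

lemma defset_subset_imp:
  assumes p: "p \<in> complete_types L S M" and q: "q \<in> complete_types L S M" and eq: "\<And>\<phi>. defset \<phi> p = defset \<phi> q"
  shows "p = q"
proof (rule complete_types_eqI[OF p q])
  fix \<psi> assume \<psi>: "\<psi> \<in> global_formulas L S M" "\<psi> \<in> p"
  from finite_list[OF finite_params] obtain b where b: "set b = params \<psi>" by (rule exE)
  define i where "i = (\<lambda>a. SOME k. k < length b \<and> b ! k = a)"
  have i: "i a < length b \<and> b ! i a = a" if "a \<in> params \<psi>" for a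
  proof -
    have "\<exists>k. k < length b \<and> b ! k = a" using that b by (metis in_set_conv_nth)
    then show ?thesis unfolding i_def by (rule someI_ex)
  qed
  let ?\<phi> = "inst i \<psi>"
  have recover: "inst ((!) b) ?\<phi> = \<psi>" unfolding inst_inst by (rule inst_id) (simp add: i)
  have "params ?\<phi> \<subseteq> {..<length b}" unfolding params_inst using i by auto
  then have "b \<in> defset ?\<phi> p" using \<psi> params_subset[OF \<psi>(1)] b by (simp add: defset_def recover)
  then have "b \<in> defset ?\<phi> q" by (simp only: eq)
  then show "\<psi> \<in> q" by (simp add: defset_def recover)
qed

text \<open>For an invariant \<open>p\<close>, membership of \<open>b\<close> depends only on the
  type of \<open>b\<close> over \<open>h\<close>. The set is thus determined by a set of such types,
  whatever the number of variables in \<open>\<phi>\<close>; strong limitness bounds the number of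
  possibilities.\<close>

lemma small_defsets:
  fixes Sg :: "'n \<rightharpoonup> 's" and S :: "'i \<rightharpoonup> 's"
  assumes small: "|dom Sg| \<le>o card_lang" and h: "h \<in> assigns M Sg"
  shows "|{defset \<phi> p | \<phi> p. p \<in> inv_types L S X M (dom Sg) h}| <o \<kappa>"
proof -
  let ?Loc = "{defset \<phi> p | \<phi> p. p \<in> inv_types L S X M (dom Sg) h}"
  let ?V = "(UNIV :: nat set) <+> dom Sg"
  have nat: "|UNIV :: nat set| \<le>o card_lang"
    using natLeq_ordLeq_cinfinite[OF Cinfinite_lt] card_of_nat ordIso_ordLeq_trans by blast
  have V: "|?V| \<le>o card_lang"
    using nat small Cinfinite_lt by (intro card_of_Plus_ordLeq_infinite_Field) (auto simp: cinfinite_def)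
  obtain D :: "('f, 'r, 's, nat + 'n) fm set" where
    D: "|D| \<le>o card_lang" "\<And>S. dom S \<subseteq> ?V \<Longrightarrow> formulas L S \<subseteq> D"
    using formulas_bound[OF V] by blast
  define Sb where "Sb = (\<lambda>b. case_sum (\<lambda>k. if k < length b then sort_of M (b ! k) else None) Sg)"
  define tp where "tp = (\<lambda>b. {\<psi> \<in> formulas L (Sb b). sat M (case_sum ((!) b) h) [] \<psi>})"
  define code where "code = (\<lambda>b. (map (\<lambda>a. the (sort_of M a)) b, tp b))"
  have tpD: "tp b \<subseteq> D" for b
  proof -
    have "dom (Sb b) \<subseteq> ?V"
    proof
      fix z assume "z \<in> dom (Sb b)"
      then show "z \<in> ?V" by (cases z) (auto simp: Sb_def)
    qed
    from D(2)[OF this] show ?thesis by (auto simp: tp_def)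
  qed
  \<comment> \<open>Lists with equal codes are conjugate over \<open>h\<close>, so a set in
    \<open>?Loc\<close> contains with a list all lists of the same code.\<close>
  have closed: "d' \<subseteq> d" if d: "d \<in> ?Loc" "d' \<in> ?Loc" and eq: "code ` d = code ` d'" for d d'
  proof
    fix b' assume b': "b' \<in> d'"
    obtain \<phi> :: "('f, 'r, 's, 'i + nat) fm" and p where \<phi>: "d = defset \<phi> p" "p \<in> inv_types L S X M (dom Sg) h" using d(1) by blast
    obtain \<phi>' :: "('f, 'r, 's, 'i + nat) fm" and p' where \<phi>': "d' = defset \<phi>' p'" using d(2) by blast
    have "code b' \<in> code ` d" unfolding eq using b' by (rule imageI)
    then obtain b where b: "b \<in> d" "code b' = code b" by (rule imageE)
    have u: "set b \<subseteq> univ M" "set b' \<subseteq> univ M" using b(1) b' unfolding \<phi> \<phi>' by (auto simp: defset_def)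
    have m: "map (\<lambda>a. the (sort_of M a)) b = map (\<lambda>a. the (sort_of M a)) b'" "tp b = tp b'"
      using b(2) by (auto simp: code_def)
    then have len: "length b = length b'" by (metis length_map)
    have so: "sort_of M (b ! k) = sort_of M (b' ! k)" if "k < length b" for k
    proof -
      have "the (sort_of M (b ! k)) = the (sort_of M (b' ! k))"
        using m(1) that len by (metis nth_map)
      moreover have "b ! k \<in> univ M" "b' ! k \<in> univ M" using u that len nth_mem by (metis subsetD)+
      ultimately show ?thesis by (auto simp: dom_def)
    qed
    have Sbeq: "Sb b' = Sb b" using so len by (auto simp: Sb_def fun_eq_iff split: sum.splits)
    have ass: "case_sum ((!) c) h \<in> assigns M (Sb c)" if "set c \<subseteq> univ M" for c
      unfolding assigns_def
    proof (intro CollectI ballI)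
      fix z assume "z \<in> dom (Sb c)"
      then show "sort_of M (case_sum ((!) c) h z) = Sb c z"
        using h by (cases z) (auto simp: Sb_def assigns_def split: if_splits)
    qed
    have st: "same_type L (Sb b) M (case_sum ((!) b) h) M (case_sum ((!) b') h)"
      unfolding same_type_def
    proof (intro conjI ballI)
      show "case_sum ((!) b) h \<in> assigns M (Sb b)" by (rule ass[OF u(1)])
      show "case_sum ((!) b') h \<in> assigns M (Sb b)" using ass[OF u(2)] unfolding Sbeq .
      fix \<psi> assume "\<psi> \<in> formulas L (Sb b)"
      then have "\<psi> \<in> tp b \<longleftrightarrow> sat M (case_sum ((!) b) h) [] \<psi>" "\<psi> \<in> tp b' \<longleftrightarrow> sat M (case_sum ((!) b') h) [] \<psi>"
        unfolding tp_def Sbeq by simp_all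
      then show "sat M (case_sum ((!) b) h) [] \<psi> \<longleftrightarrow> sat M (case_sum ((!) b') h) [] \<psi>" using m(2) by simp
    qed
    have dom: "z \<in> dom (Sb b) \<longleftrightarrow> (case z of Inl k \<Rightarrow> k < length b | Inr x \<Rightarrow> x \<in> dom Sg)" for z
    proof (cases z)
      case (Inl k)
      have "b ! k \<in> univ M" if "k < length b" using that u(1) nth_mem by (metis subsetD)
      then show ?thesis using Inl by (auto simp: Sb_def dom_def)
    qed (auto simp: Sb_def dom_def)
    have "|dom (Sb b)| <o \<kappa>"
    proof -
      have "dom (Sb b) \<subseteq> ?V"
      proof
        fix z assume "z \<in> dom (Sb b)"
        then show "z \<in> ?V" unfolding dom by (cases z) auto
      qed
      then show ?thesis using card_subset_ordLess[OF ordLeq_ordLess_trans[OF V lt]] by blast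
    qed
    from homogeneous[OF st this] obtain \<sigma> where \<sigma>: "\<sigma> \<in> automorphisms L M"
      "\<And>z. z \<in> dom (Sb b) \<Longrightarrow> \<sigma> (case_sum ((!) b) h z) = case_sum ((!) b') h z"
      by (elim bexE) (rule that, assumption, rule bspec)
    have \<sigma>b: "map \<sigma> b = b'"
      using \<sigma>(2)[of "Inl _"] len unfolding dom by (intro nth_equalityI) auto
    have \<sigma>h: "\<sigma> (id (h x)) = id (h x)" if "x \<in> dom Sg" for x
      using \<sigma>(2)[of "Inr x"] that unfolding dom by simp
    have bd: "params \<phi> \<subseteq> {..<length b}" "inst ((!) b) \<phi> \<in> p" using b(1) unfolding \<phi> by (auto simp: defset_def)
    have "inst ((!) b) \<phi> \<in> global_formulas L S M"
      using bd(2) complete_typesD(1)[OF type_spaceD[OF inv_types_type_space[OF \<phi>(2)]]] by blast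
    from inv_types_inst_iff[OF \<phi>(2) \<sigma>(1) id_aut \<sigma>h this] bd(2)
    have "inst \<sigma> (inst ((!) b) \<phi>) \<in> p" by simp
    then have "inst ((!) b') \<phi> \<in> p" using inst_nth_map[OF bd(1), of \<sigma>] \<sigma>b by simp
    then show "b' \<in> d" unfolding \<phi> defset_def using u(2) bd(1) len by simp
  qed
  have inj: "inj_on (image code) ?Loc"
  proof (rule inj_onI)
    fix d d' assume "d \<in> ?Loc" "d' \<in> ?Loc" "code ` d = code ` d'"
    then show "d = d'" using closed[of d d'] closed[of d' d] by (intro equalityI) simp_all
  qed
  let ?T = "lists (UNIV :: 's set) \<times> Pow D"
  have "image code ` ?Loc \<subseteq> Pow ?T" using tpD by (auto simp: code_def)
  with inj have "|?Loc| \<le>o |Pow ?T|" by (rule card_of_ordLeq[THEN iffD1, OF exI, OF conjI])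
  moreover have "|Pow ?T| <o \<kappa>"
  proof (rule strong_limit_Pow[OF strong Times_ordLess[OF Cinfinite]])
    show "|lists (UNIV :: 's set)| <o \<kappa>"
      using lists_Cinfinite_bound[OF Cinfinite_lt lt_components(1)] lt by (rule ordLeq_ordLess_trans)
    show "|Pow D| <o \<kappa>" using D(1) lt by (intro strong_limit_Pow[OF strong]) (rule ordLeq_ordLess_trans)
  qed
  ultimately show ?thesis by (rule ordLeq_ordLess_trans)
qed

text \<open>Values of \<open>w\<close> are invariant, so \<open>e\<close> composed with
  \<open>w\<close> depends only on \<open>e\<close> at invariant types; this in turn is determined
  by the action of \<open>e\<close> on the few sets bounded in \<open>small_defsets\<close>.\<close>

lemma small_principal_ideal:
  fixes Sg :: "'n \<rightharpoonup> 's" and S :: "'i \<rightharpoonup> 's"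
  assumes small: "|dom Sg| \<le>o card_lang" and h: "h \<in> assigns M Sg"
    and w: "\<And>p. p \<in> TS S X \<Longrightarrow> w p \<in> inv_types L S X M (dom Sg) h"
  shows "|(\<lambda>e. compose (TS S X) e w) ` EL S X| <o \<kappa>"
proof -
  let ?B = "inv_types L S X M (dom Sg) h"
  let ?Loc = "{defset \<phi> p | (\<phi> :: ('f, 'r, 's, 'i + nat) fm) p. p \<in> ?B}"
  have hD: "h ` dom Sg \<subseteq> univ M"
  proof (rule image_subsetI)
    fix x assume x: "x \<in> dom Sg"
    then have "sort_of M (h x) = Sg x" using h unfolding assigns_def by blast
    with x show "h x \<in> univ M" by (auto simp: dom_def)
  qed
  \<comment> \<open>The action of \<open>e\<close> recorded as a relation between parameter sets;
    \<open>defset_action\<close> makes it single-valued, so it determines \<open>e\<close> on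
    \<open>?B\<close>.\<close>
  define G where "G = (\<lambda>e. {(defset \<phi> p, defset \<phi> (e p)) | (\<phi> :: ('f, 'r, 's, 'i + nat) fm) p. p \<in> ?B})"
  have agree: "e p = e' p" if e: "e \<in> EL S X" "e' \<in> EL S X" "G e = G e'" and p: "p \<in> ?B" for e e' p
  proof (rule defset_subset_imp)
    have pt: "p \<in> TS S X" using p by (rule inv_types_type_space)
    show "e p \<in> complete_types L S M" "e' p \<in> complete_types L S M"
      using e pt by (auto intro: type_spaceD ellis_type_space)
    fix \<phi> :: "('f, 'r, 's, 'i + nat) fm"
    have "(defset \<phi> p, defset \<phi> (e p)) \<in> G e'" unfolding e(3)[symmetric] using p by (auto simp: G_def)
    then obtain \<phi>' p' where *: "defset \<phi> p = defset \<phi>' p'" "defset \<phi> (e p) = defset \<phi>' (e' p')" "p' \<in> ?B"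
      by (auto simp: G_def)
    from defset_action[OF e(2) pt inv_types_type_space[OF *(3)] *(1)] *(2)
    show "defset \<phi> (e p) = defset \<phi> (e' p)" by simp
  qed
  have "G e \<subseteq> ?Loc \<times> ?Loc" if "e \<in> EL S X" for e
    using ellis_inv_types[OF that _ hD] by (auto simp: G_def)
  then have "G ` EL S X \<subseteq> Pow (?Loc \<times> ?Loc)" by blast
  moreover have "|Pow (?Loc \<times> ?Loc)| <o \<kappa>"
    by (intro strong_limit_Pow[OF strong] Times_ordLess[OF Cinfinite] small_defsets small h)
  ultimately have GE: "|G ` EL S X| <o \<kappa>" using card_subset_ordLess by blast
  \<comment> \<open>The composite is recovered from the record alone by choosing any element of the
    semigroup with that record.\<close>
  define F where "F = (\<lambda>g. compose (TS S X) (SOME e. e \<in> EL S X \<and> G e = g) w)"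
  have "compose (TS S X) e w = F (G e)" if e: "e \<in> EL S X" for e
  proof -
    let ?e = "SOME e'. e' \<in> EL S X \<and> G e' = G e"
    have E: "?e \<in> EL S X \<and> G ?e = G e" by (rule someI[of _ e]) (use e in simp)
    have "e (w p) = ?e (w p)" if "p \<in> TS S X" for p
      by (rule agree[OF e conjunct1[OF E] conjunct2[OF E, symmetric] w[OF that]])
    then show ?thesis unfolding F_def by (auto simp: compose_def fun_eq_iff)
  qed
  then have "(\<lambda>e. compose (TS S X) e w) ` EL S X = F ` G ` EL S X" unfolding image_image by (rule image_cong[OF refl])
  then show ?thesis using card_image_ordLess[OF GE] by simp
qed

section \<open>Absoluteness\<close>

lemma minimal_ellis_idealsD:
  assumes "J \<in> minimal_ellis_ideals L S X M"
  shows "minimal_left_ideal (EL S X) (compose (TS S X)) J" "J \<subseteq> EL S X" "J \<noteq> {}"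
    "\<And>e x. e \<in> EL S X \<Longrightarrow> x \<in> J \<Longrightarrow> compose (TS S X) e x \<in> J"
  using assms by (auto simp: minimal_ellis_ideals_def minimal_left_ideal_def left_ideal_def)

text \<open>Automorphisms act on \<open>J\<close> from the left, so the orbit of
  \<open>\<eta> p\<close> consists of values at \<open>p\<close> of elements of \<open>J\<close> and
  is no larger than \<open>J\<close>.\<close>

lemma bounded_ideal_image:
  assumes J: "J \<in> minimal_ellis_ideals L S X M" "|J| <o \<kappa>" and N: "elem_sub N" "|N| <o \<kappa>"
    and \<eta>: "\<eta> \<in> J" and p: "p \<in> TS S X"
  shows "\<eta> p \<in> inv_types L S X M N id"
proof (rule small_orbit_inv_types[OF N])
  note Jd = minimal_ellis_idealsD[OF J(1)]
  have \<eta>E: "\<eta> \<in> EL S X" using Jd(2) \<eta> by blast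
  show \<eta>p: "\<eta> p \<in> TS S X" by (rule ellis_type_space[OF \<eta>E p])
  have "(\<lambda>\<tau>. type_action \<tau> (\<eta> p)) ` automorphisms L M \<subseteq> (\<lambda>f. f p) ` J"
  proof (rule image_subsetI)
    fix \<tau> assume "\<tau> \<in> automorphisms L M"
    then have "compose (TS S X) (restrict (type_action \<tau>) (TS S X)) \<eta> \<in> J"
      by (intro Jd(4) ellis_aut \<eta>)
    moreover have "type_action \<tau> (\<eta> p) = compose (TS S X) (restrict (type_action \<tau>) (TS S X)) \<eta> p"
      using p \<eta>p by (simp add: compose_def)
    ultimately show "type_action \<tau> (\<eta> p) \<in> (\<lambda>f. f p) ` J" by (metis imageI)
  qed
  then show "|(\<lambda>\<tau>. type_action \<tau> (\<eta> p)) ` automorphisms L M| <o \<kappa>"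
    using card_image_ordLess[OF J(2)] card_subset_ordLess by blast
qed

text \<open>Minimality lets \<open>x\<close> be recovered from \<open>\<eta>\<close> composed with
  \<open>x\<close> by some \<open>e\<close> of the semigroup, so each value of \<open>x\<close> is
  the \<open>e\<close>-image of an invariant type. One such \<open>\<eta>\<close> thus controls
  every minimal left ideal.\<close>

lemma image_of_all_ideals:
  assumes X: "X \<subseteq> formulas L S" and h: "h ` D \<subseteq> univ M"
    and \<eta>: "\<eta> \<in> EL S X" "\<And>p. p \<in> TS S X \<Longrightarrow> \<eta> p \<in> inv_types L S X M D h"
    and J: "J \<in> minimal_ellis_ideals L S X M" and x: "x \<in> J" and p: "p \<in> TS S X"
  shows "x p \<in> inv_types L S X M D h"
proof -
  interpret E: compact_semigroup "subtopology (product_topology (\<lambda>_. stone_topology L S X M) (TS S X)) (EL S X)"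
    "compose (TS S X)" "EL S X" by (rule ellis_compact_semigroup[OF X])
  note Jd = minimal_ellis_idealsD[OF J]
  have "compose (TS S X) \<eta> x \<in> J" by (rule Jd(4)[OF \<eta>(1) x])
  from E.minimal_left_ideal_eq[OF Jd(1) this] x
  obtain e where e: "e \<in> EL S X" "x = compose (TS S X) e (compose (TS S X) \<eta> x)" by blast
  have xp: "x p \<in> TS S X" using Jd(2) x p ellis_type_space by blast
  have "x p = e (\<eta> (x p))" using arg_cong[OF e(2), of "\<lambda>f. f p"] p by (simp add: compose_def)
  then show ?thesis using ellis_inv_types[OF e(1) \<eta>(2)[OF xp] h] by simp
qed

text \<open>A minimal left ideal is the principal ideal of any of its elements.\<close>

lemma bounded_of_image:
  fixes Sg :: "'n \<rightharpoonup> 's"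
  assumes X: "X \<subseteq> formulas L S" and small: "|dom Sg| \<le>o card_lang" and h: "h \<in> assigns M Sg"
    and J: "J \<in> minimal_ellis_ideals L S X M"
    and im: "\<And>x p. x \<in> J \<Longrightarrow> p \<in> TS S X \<Longrightarrow> x p \<in> inv_types L S X M (dom Sg) h"
  shows "|J| <o \<kappa>"
proof -
  interpret E: compact_semigroup "subtopology (product_topology (\<lambda>_. stone_topology L S X M) (TS S X)) (EL S X)"
    "compose (TS S X)" "EL S X" by (rule ellis_compact_semigroup[OF X])
  note Jd = minimal_ellis_idealsD[OF J]
  obtain w where w: "w \<in> J" using Jd(3) by blast
  show ?thesis
    unfolding E.minimal_left_ideal_eq[OF Jd(1) w] by (rule small_principal_ideal[OF small h im[OF w]])
qed

text \<open>An idempotent \<open>u\<close> of \<open>J\<close> is a right identity there, so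
  \<open>x p = x (u p)\<close> with \<open>u p\<close> in \<open>B\<close>: elements of
  \<open>J\<close> are determined by their restrictions to \<open>B\<close>.\<close>

lemma ideal_eqI:
  assumes X: "X \<subseteq> formulas L S" and J: "J \<in> minimal_ellis_ideals L S X M"
    and im: "\<And>x p. x \<in> J \<Longrightarrow> p \<in> TS S X \<Longrightarrow> x p \<in> B"
    and xy: "x \<in> J" "y \<in> J" "\<And>p. p \<in> B \<Longrightarrow> x p = y p"
  shows "x = y"
proof -
  interpret E: compact_semigroup "subtopology (product_topology (\<lambda>_. stone_topology L S X M) (TS S X)) (EL S X)"
    "compose (TS S X)" "EL S X" by (rule ellis_compact_semigroup[OF X])
  note Jd = minimal_ellis_idealsD[OF J]
  obtain u where u: "u \<in> J" "compose (TS S X) u u = u" using E.idempotent_exists[OF Jd(1)] by blast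
  have right_id: "z p = z (u p)" if z: "z \<in> J" and p: "p \<in> TS S X" for z p
  proof -
    obtain e where e: "e \<in> EL S X" "z = compose (TS S X) e u"
      using E.minimal_left_ideal_eq[OF Jd(1) u(1)] z by blast
    have "u p \<in> TS S X" using Jd(2) u(1) p ellis_type_space by blast
    moreover have "u (u p) = u p" using arg_cong[OF u(2), of "\<lambda>f. f p"] p by (simp add: compose_def)
    ultimately show ?thesis using p by (simp add: e(2) compose_def)
  qed
  have ext: "x \<in> extensional (TS S X)" "y \<in> extensional (TS S X)"
    using xy(1,2) Jd(2) unfolding ellis_iff[abs_def] by (auto simp: ellis_iff PiE_iff subset_iff)
  show ?thesis
  proof (rule extensionalityI[OF ext])
    fix p assume p: "p \<in> TS S X"
    show "x p = y p" using right_id[OF xy(1) p] right_id[OF xy(2) p] xy(3)[OF im[OF u(1) p]] by simp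
  qed
qed

end

section \<open>Moving elements and ideals between the two models\<close>

context monster_pair
begin

abbreviation E1 where "E1 \<equiv> ellis_semigroup L S X M1"
abbreviation E2 where "E2 \<equiv> ellis_semigroup L S X M2"

lemma h_univ: "h1 ` dom Sg \<subseteq> univ M1" "h2 ` dom Sg \<subseteq> univ M2"
  using sort_h by (auto simp: dom_def)

lemma ellis_of_below:
  assumes "q \<in> TS2 \<rightarrow> TS2" "below L S TS2 M2 q M2 id"
  shows "restrict q TS2 \<in> E2"
  unfolding M2.ellis_iff
proof
  show "restrict q TS2 \<in> TS2 \<rightarrow>\<^sub>E TS2" using assms(1) by auto
  show "below L S TS2 M2 (restrict q TS2) M2 id" using assms(2) by (rule below_cong) auto
qed

text \<open>Compactness, started from the empty family, gives some map \<open>q\<close> from types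
  over \<open>M2\<close> to types over \<open>M1\<close> that lies below the identity. Going over by
  \<open>q\<close>, making types invariant by \<open>\<eta>\<close> and returning by
  \<open>tr\<close> stays below the identity, hence in the Ellis semigroup.\<close>

lemma transfer_witness:
  assumes \<eta>: "\<eta> \<in> E1" "\<And>p. p \<in> TS1 \<Longrightarrow> \<eta> p \<in> B1"
  shows "\<exists>\<eta>'\<in>E2. \<forall>p\<in>TS2. \<eta>' p \<in> B2"
proof -
  have "\<exists>q'\<in>TS2 \<rightarrow> TS1. (\<forall>k\<in>{}. q' k = undefined k) \<and> below L S TS2 M1 q' M2 id"
    by (rule M1.extend_below[OF M2.monster_model_axioms X])
      (use inv_types_type_space in \<open>auto simp: below_def same_type_empty[OF M1.complete M1.model M2.model]\<close>)
  then obtain q where q: "q \<in> TS2 \<rightarrow> TS1" "below L S TS2 M1 q M2 id" by blast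
  have "below L S TS1 M1 \<eta> M1 id" using \<eta>(1) unfolding M1.ellis_iff by blast
  then have "below L S TS2 M1 (\<eta> \<circ> q) M1 (id \<circ> q)" using q(1) by (intro below_reindex[of L S TS1]) auto
  from below_trans[OF this[unfolded id_comp] q(2)] have 1: "below L S TS2 M1 (\<eta> \<circ> q) M2 id" .
  have B: "\<eta> (q p) \<in> B1" if "p \<in> TS2" for p using \<eta>(2) q(1) that by blast
  then have "below L S TS2 M2 (tr \<circ> (\<eta> \<circ> q)) M1 (id \<circ> (\<eta> \<circ> q))"
    by (intro below_reindex[OF tr_below]) auto
  from below_trans[OF this[unfolded id_comp] 1] have 2: "below L S TS2 M2 (tr \<circ> (\<eta> \<circ> q)) M2 id" .
  have B2: "tr (\<eta> (q p)) \<in> B2" if "p \<in> TS2" for p using tr_inv_types[OF B[OF that]] .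
  have "restrict (tr \<circ> (\<eta> \<circ> q)) TS2 \<in> E2"
    using B2 inv_types_type_space by (intro ellis_of_below 2) fastforce
  moreover have "\<forall>p\<in>TS2. restrict (tr \<circ> (\<eta> \<circ> q)) TS2 p \<in> B2" using B2 by simp
  ultimately show ?thesis by blast
qed

text \<open>Conjugating \<open>f\<close> by the correspondence of invariant types prescribes a map
  on \<open>B2\<close> below the identity, and compactness extends it to all types.\<close>

lemma lift_ellis:
  assumes f: "f \<in> E1"
  shows "\<exists>f'\<in>E2. \<forall>p\<in>B2. f' p = tr (f (rt p))"
proof -
  have fB: "f (rt p) \<in> B1" if "p \<in> B2" for p
    by (rule M1.ellis_inv_types[OF f rt_inv_types[OF that] h_univ(1)])
  have "below L S TS1 M1 f M1 id" using f unfolding M1.ellis_iff by blast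
  then have "below L S B2 M1 (f \<circ> rt) M1 (id \<circ> rt)"
    using inv_types_type_space[OF rt_inv_types] by (intro below_reindex[of L S TS1]) auto
  from below_trans[OF this[unfolded id_comp] rt_below] have 1: "below L S B2 M1 (f \<circ> rt) M2 id" .
  have "below L S B2 M2 (tr \<circ> (f \<circ> rt)) M1 (id \<circ> (f \<circ> rt))"
    using fB by (intro below_reindex[OF tr_below]) auto
  from below_trans[OF this[unfolded id_comp] 1] have 2: "below L S B2 M2 (tr \<circ> (f \<circ> rt)) M2 id" .
  have "\<exists>q'\<in>TS2 \<rightarrow> TS2. (\<forall>k\<in>B2. q' k = (tr \<circ> (f \<circ> rt)) k) \<and> below L S TS2 M2 q' M2 id"
  proof (rule M2.extend_below[OF M2.monster_model_axioms X _ _ _ 2])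
    show "B2 \<subseteq> TS2" using inv_types_type_space by blast
    show "tr \<circ> (f \<circ> rt) \<in> B2 \<rightarrow> TS2" using tr_type_space[OF fB] by simp
  qed simp
  then obtain q where q: "q \<in> TS2 \<rightarrow> TS2" "\<forall>k\<in>B2. q k = tr (f (rt k))" "below L S TS2 M2 q M2 id"
    by (auto simp: o_def)
  have "restrict q TS2 p = tr (f (rt p))" if "p \<in> B2" for p
    using q(2) that inv_types_type_space[OF that] by simp
  with ellis_of_below[OF q(1,3)] show ?thesis by blast
qed

text \<open>The relation \<open>rel\<close> is multiplicative, and on \<open>J1\<close> the element
  being lifted is determined by its lift. Reading lifts back therefore gives a homomorphism
  \<open>\<theta>\<close> from a minimal ideal of lifts to \<open>J1\<close>, whose inverse is the
  required isomorphism.\<close>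

lemma isomorphic_ideal:
  assumes J1: "J1 \<in> minimal_ellis_ideals L S X M1" "\<And>x p. x \<in> J1 \<Longrightarrow> p \<in> TS1 \<Longrightarrow> x p \<in> B1"
    and im2: "\<And>J x p. J \<in> minimal_ellis_ideals L S X M2 \<Longrightarrow> x \<in> J \<Longrightarrow> p \<in> TS2 \<Longrightarrow> x p \<in> B2"
  shows "\<exists>J2\<in>minimal_ellis_ideals L S X M2. semigroup_isomorphic J1 (compose TS1) J2 (compose TS2)"
proof -
  interpret S2: compact_semigroup "subtopology (product_topology (\<lambda>_. stone_topology L S X M2) TS2) E2"
    "compose TS2" E2 by (rule M2.ellis_compact_semigroup[OF X])
  note Jd = M1.minimal_ellis_idealsD[OF J1(1)]
  define rel where "rel = (\<lambda>x f. \<forall>p\<in>B2. f p = tr (x (rt p)))"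
  have xB: "x (rt p) \<in> B1" if "x \<in> E1" "p \<in> B2" for x p
    by (rule M1.ellis_inv_types[OF that(1) rt_inv_types[OF that(2)] h_univ(1)])
  have relc: "rel (compose TS1 x y) (compose TS2 f g)" if "rel x f" "rel y g" "x \<in> E1" "y \<in> E1" for x y f g
    unfolding rel_def
  proof
    fix p assume p: "p \<in> B2"
    have pt: "p \<in> TS2" "rt p \<in> TS1" using p rt_inv_types inv_types_type_space by blast+
    have gp: "g p = tr (y (rt p))" using that(2) p by (simp add: rel_def)
    have yB: "y (rt p) \<in> B1" by (rule xB[OF that(4) p])
    then have "g p \<in> B2" unfolding gp by (rule tr_inv_types)
    then have "f (g p) = tr (x (rt (g p)))" using that(1) by (simp add: rel_def)
    also have "rt (g p) = y (rt p)" unfolding gp by (rule rt_tr[OF yB])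
    finally show "compose TS2 f g p = tr (compose TS1 x y (rt p))" using pt by (simp add: compose_def)
  qed
  have uniq: "x = y" if "rel x f" "rel y f" "x \<in> J1" "y \<in> J1" for x y f
  proof (rule M1.ideal_eqI[OF X J1(1), where B = B1])
    show "z p \<in> B1" if "z \<in> J1" "p \<in> TS1" for z p using that by (rule J1(2))
    show "x \<in> J1" "y \<in> J1" by (rule that)+
    fix q assume q: "q \<in> B1"
    have t: "tr q \<in> B2" by (rule tr_inv_types[OF q])
    have r: "rt (tr q) = q" by (rule rt_tr[OF q])
    have qt: "q \<in> TS1" using q by (rule inv_types_type_space)
    have "f (tr q) = tr (x (rt (tr q)))" "f (tr q) = tr (y (rt (tr q)))"
      using that(1,2) t unfolding rel_def by blast+
    then have "tr (x q) = tr (y q)" unfolding r by (rule trans[OF sym])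
    then have "rt (tr (x q)) = rt (tr (y q))" by simp
    then show "x q = y q" using rt_tr[OF J1(2)[OF that(3) qt]] rt_tr[OF J1(2)[OF that(4) qt]] by simp
  qed
  \<comment> \<open>All lifts are taken together, since a lift is prescribed on \<open>B2\<close>
    only. A minimal ideal inside contains at most one lift of each element, by
    \<open>ideal_eqI\<close> in the second model.\<close>
  let ?J = "{f \<in> E2. \<exists>x\<in>J1. rel x f}"
  have "left_ideal E2 (compose TS2) ?J" unfolding left_ideal_def
  proof (intro conjI ballI)
    obtain x where x: "x \<in> J1" using Jd(3) by blast
    then have "x \<in> E1" using Jd(2) by blast
    from lift_ellis[OF this] obtain f where "f \<in> E2" "rel x f" unfolding rel_def by (rule bexE)
    with x have "f \<in> ?J" by blast
    then show "?J \<noteq> {}" by (metis empty_iff)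
    fix e f assume e: "e \<in> E2" and f: "f \<in> ?J"
    from f obtain y where y: "y \<in> J1" "rel y f" "f \<in> E2" by blast
    obtain e' where e': "e' \<in> E1" "\<forall>p\<in>B1. e' p = rt (e (tr p))"
      using monster_pair.lift_ellis[OF flip e] by blast
    have "rel e' e" unfolding rel_def
    proof
      fix p assume p: "p \<in> B2"
      have "e' (rt p) = rt (e p)" using e'(2) rt_inv_types[OF p] tr_rt[OF p] by simp
      moreover have "e p \<in> B2" by (rule M2.ellis_inv_types[OF e p h_univ(2)])
      ultimately show "e p = tr (e' (rt p))" by (simp add: tr_rt)
    qed
    then have "rel (compose TS1 e' y) (compose TS2 e f)" using relc e'(1) y(1,2) Jd(2) by blast
    moreover have "compose TS1 e' y \<in> J1" by (rule Jd(4)[OF e'(1) y(1)])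
    moreover have "compose TS2 e f \<in> E2" by (rule M2.ellis_compose[OF e y(3)])
    ultimately show "compose TS2 e f \<in> ?J" by blast
  qed blast
  from S2.minimal_left_ideal_exists[OF this] obtain J2 where
    J2: "J2 \<subseteq> ?J" "minimal_left_ideal E2 (compose TS2) J2" by blast
  then have J2m: "J2 \<in> minimal_ellis_ideals L S X M2" by (simp add: minimal_ellis_ideals_def)
  note J2d = M2.minimal_ellis_idealsD[OF J2m]
  define \<theta> where "\<theta> = (\<lambda>f. SOME x. x \<in> J1 \<and> rel x f)"
  have \<theta>: "\<theta> f \<in> J1" "rel (\<theta> f) f" if "f \<in> J2" for f
  proof -
    have "\<exists>x. x \<in> J1 \<and> rel x f" using J2(1) that by blast
    then have "\<theta> f \<in> J1 \<and> rel (\<theta> f) f" unfolding \<theta>_def by (rule someI_ex)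
    then show "\<theta> f \<in> J1" "rel (\<theta> f) f" by auto
  qed
  have \<theta>_eq: "\<theta> f = x" if "f \<in> J2" "x \<in> J1" "rel x f" for f x
    by (rule uniq[OF \<theta>(2)[OF that(1)] that(3) \<theta>(1)[OF that(1)] that(2)])
  have inj: "inj_on \<theta> J2"
  proof (rule inj_onI)
    fix f g assume fg: "f \<in> J2" "g \<in> J2" "\<theta> f = \<theta> g"
    show "f = g"
    proof (rule M2.ideal_eqI[OF X J2m, where B = B2])
      show "z p \<in> B2" if "z \<in> J2" "p \<in> TS2" for z p using J2m that by (rule im2)
      show "f \<in> J2" "g \<in> J2" by (rule fg)+
      fix p assume "p \<in> B2"
      then show "f p = g p" using \<theta>(2)[OF fg(1)] \<theta>(2)[OF fg(2)] fg(3) by (simp add: rel_def)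
    qed
  qed
  \<comment> \<open>Surjectivity comes from minimality of \<open>J1\<close>: the image of
    \<open>J2\<close> absorbs \<open>E1\<close> from the left, because elements of \<open>E1\<close>
    lift to \<open>E2\<close>.\<close>
  have "left_ideal E1 (compose TS1) (\<theta> ` J2)" unfolding left_ideal_def
  proof (intro conjI ballI)
    show "\<theta> ` J2 \<subseteq> E1" using \<theta>(1) Jd(2) by blast
    show "\<theta> ` J2 \<noteq> {}" using J2d(3) by blast
    fix e y assume e: "e \<in> E1" and "y \<in> \<theta> ` J2"
    then obtain f where f: "f \<in> J2" "y = \<theta> f" by blast
    obtain e' where e': "e' \<in> E2" "rel e e'" using lift_ellis[OF e] unfolding rel_def by blast
    have c: "compose TS2 e' f \<in> J2" by (rule J2d(4)[OF e'(1) f(1)])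
    have "rel (compose TS1 e y) (compose TS2 e' f)" unfolding f(2)
      using relc[OF e'(2) \<theta>(2)[OF f(1)] e] \<theta>(1)[OF f(1)] Jd(2) by blast
    moreover have "compose TS1 e y \<in> J1" unfolding f(2) by (rule Jd(4)[OF e \<theta>(1)[OF f(1)]])
    ultimately have "\<theta> (compose TS2 e' f) = compose TS1 e y" using \<theta>_eq[OF c] by blast
    then show "compose TS1 e y \<in> \<theta> ` J2" using c by (metis imageI)
  qed
  moreover have "\<theta> ` J2 \<subseteq> J1" using \<theta>(1) by blast
  ultimately have surj: "\<theta> ` J2 = J1" using Jd(1) unfolding minimal_left_ideal_def by blast
  have bij: "bij_betw \<theta> J2 J1" using inj surj by (simp add: bij_betw_def)
  have hom: "\<theta> (compose TS2 f g) = compose TS1 (\<theta> f) (\<theta> g)" if fg: "f \<in> J2" "g \<in> J2" for f g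
  proof (rule \<theta>_eq)
    have E: "f \<in> E2" "\<theta> f \<in> E1" "\<theta> g \<in> E1" using fg J2d(2) \<theta>(1) Jd(2) by blast+
    show "compose TS2 f g \<in> J2" by (rule J2d(4)[OF E(1) fg(2)])
    show "compose TS1 (\<theta> f) (\<theta> g) \<in> J1" by (rule Jd(4)[OF E(2) \<theta>(1)[OF fg(2)]])
    show "rel (compose TS1 (\<theta> f) (\<theta> g)) (compose TS2 f g)"
      by (rule relc[OF \<theta>(2)[OF fg(1)] \<theta>(2)[OF fg(2)] E(2,3)])
  qed
  have "semigroup_isomorphic J1 (compose TS1) J2 (compose TS2)"
    unfolding semigroup_isomorphic_def
  proof (intro exI conjI ballI)
    let ?h = "inv_into J2 \<theta>"
    show "bij_betw ?h J1 J2" using bij by (rule bij_betw_inv_into)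
    fix x y assume "x \<in> J1" "y \<in> J1"
    then have "x \<in> \<theta> ` J2" "y \<in> \<theta> ` J2" unfolding surj .
    then obtain f g where fg: "f \<in> J2" "g \<in> J2" "x = \<theta> f" "y = \<theta> g" by (elim imageE) (rule that)
    have "f \<in> E2" using fg(1) J2d(2) by blast
    from J2d(4)[OF this fg(2)] show "?h (compose TS1 x y) = compose TS2 (?h x) (?h y)"
      unfolding fg(3,4) hom[OF fg(1,2), symmetric] by (simp add: inv_into_f_f[OF inj] fg(1,2))
  qed
  with J2m show ?thesis by blast
qed

end

lemma minimal_ellis_ideals_nonempty:
  assumes "complete_theory L T" "X \<subseteq> formulas L S" "monster L T \<kappa> M"
  shows "minimal_ellis_ideals L S X M \<noteq> {}"
proof -
  interpret monster_model L T \<kappa> M by unfold_locales (rule assms)+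
  interpret E: compact_semigroup "subtopology (product_topology (\<lambda>_. stone_topology L S X M) (TS S X)) (EL S X)"
    "compose (TS S X)" "EL S X" by (rule ellis_compact_semigroup[OF assms(2)])
  have "left_ideal (EL S X) (compose (TS S X)) (EL S X)"
    using E.closed E.nonempty by (simp add: left_ideal_def)
  then show ?thesis using E.minimal_left_ideal_exists unfolding minimal_ellis_ideals_def by blast
qed

text \<open>The size of \<open>N\<close> is bounded by \<open>card_lang\<close>, which depends on
  the language only and is below both cardinals. So \<open>N\<close> has a copy \<open>h\<close> in
  the second model, and the pair is a common base for transport.\<close>

lemma boundedness_transfer:
  fixes L :: "('f, 'r, 's) lang" and S :: "'i \<rightharpoonup> 's"
    and M1 :: "('f, 'r, 's, 'a) struct" and M2 :: "('f, 'r, 's, 'b) struct"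
  assumes T: "complete_theory L T" and X: "X \<subseteq> formulas L S"
    and M1: "monster L T \<kappa>1 M1" and M2: "monster L T \<kappa>2 M2"
    and J: "J \<in> minimal_ellis_ideals L S X M1" "|J| <o \<kappa>1"
  shows "\<forall>J2\<in>minimal_ellis_ideals L S X M2. |J2| <o \<kappa>2"
    and "\<forall>J1\<in>minimal_ellis_ideals L S X M1. \<exists>J2\<in>minimal_ellis_ideals L S X M2.
      semigroup_isomorphic J1 (ellis_mult L S X M1) J2 (ellis_mult L S X M2)"
proof -
  interpret M1: monster_model L T \<kappa>1 M1 by unfold_locales (rule T M1)+
  interpret M2: monster_model L T \<kappa>2 M2 by unfold_locales (rule T M2)+
  obtain N where N: "M1.elem_sub N" "|N| \<le>o M1.card_lang" using M1.Lowenheim_Skolem by blast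
  let ?Sg = "sort_of M1 |` N"
  have domN: "dom ?Sg = N" using N(1) by (auto simp: M1.elem_sub_def)
  have small: "|dom ?Sg| <o \<kappa>1" "|dom ?Sg| <o \<kappa>2"
    unfolding domN using ordLeq_ordLess_trans[OF N(2) M1.lt] ordLeq_ordLess_trans[OF N(2) M2.lt] by auto
  have b: "same_type L (?Sg |` {}) M1 id M2 (\<lambda>_. undefined)"
    using same_type_empty[OF T M1.model M2.model] by simp
  have i: "id \<in> assigns M1 ?Sg" by (auto simp: assigns_def)
  from M2.realize_same_type[OF b i empty_subsetI small(2)]
  obtain h where h: "same_type L ?Sg M1 id M2 h" by (elim exE conjE) (rule that)
  interpret P: monster_pair L T \<kappa>1 M1 \<kappa>2 M2 ?Sg id h S X
    by unfold_locales (rule X h small)+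
  obtain \<eta> where \<eta>: "\<eta> \<in> J" using M1.minimal_ellis_idealsD(3)[OF J(1)] by blast
  have \<eta>E: "\<eta> \<in> P.E1" using \<eta> M1.minimal_ellis_idealsD(2)[OF J(1)] by blast
  have \<eta>B: "\<eta> p \<in> P.B1" if "p \<in> P.TS1" for p
    using M1.bounded_ideal_image[OF J N(1) small(1)[unfolded domN] \<eta> that] unfolding domN .
  have im1: "x p \<in> P.B1" if "J1 \<in> minimal_ellis_ideals L S X M1" "x \<in> J1" "p \<in> P.TS1" for J1 x p
    by (rule M1.image_of_all_ideals[OF X P.h_univ(1) \<eta>E \<eta>B that])
  obtain \<eta>' where \<eta>': "\<eta>' \<in> P.E2" "\<And>p. p \<in> P.TS2 \<Longrightarrow> \<eta>' p \<in> P.B2"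
    using P.transfer_witness[OF \<eta>E \<eta>B] by blast
  have im2: "x p \<in> P.B2" if "J2 \<in> minimal_ellis_ideals L S X M2" "x \<in> J2" "p \<in> P.TS2" for J2 x p
    by (rule M2.image_of_all_ideals[OF X P.h_univ(2) \<eta>' that])
  have N2: "|dom ?Sg| \<le>o M2.card_lang" unfolding domN by (rule N(2))
  have ha: "h \<in> assigns M2 ?Sg" using h by (simp add: same_type_def)
  show "\<forall>J2\<in>minimal_ellis_ideals L S X M2. |J2| <o \<kappa>2"
  proof
    fix J2 assume J2: "J2 \<in> minimal_ellis_ideals L S X M2"
    show "|J2| <o \<kappa>2"
      by (rule M2.bounded_of_image[OF X N2 ha J2]) (rule im2[OF J2])
  qed
  show "\<forall>J1\<in>minimal_ellis_ideals L S X M1. \<exists>J2\<in>minimal_ellis_ideals L S X M2.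
      semigroup_isomorphic J1 (ellis_mult L S X M1) J2 (ellis_mult L S X M2)"
  proof
    fix J1 assume J1: "J1 \<in> minimal_ellis_ideals L S X M1"
    show "\<exists>J2\<in>minimal_ellis_ideals L S X M2.
        semigroup_isomorphic J1 (ellis_mult L S X M1) J2 (ellis_mult L S X M2)"
      by (rule P.isomorphic_ideal[OF J1]) (rule im1[OF J1], assumption+, rule im2)
  qed
qed

section \<open>Conclusion for arbitrary pairs of monster models\<close>

theorem theorem1p4:
  fixes L :: "('f, 'r, 's) lang"
    and T :: "('f, 'r, 's, unit) fm set"
    and S :: "'i \<rightharpoonup> 's"
    and X :: "('f, 'r, 's, 'i) fm set"
    and C\<^sub>1 :: "('f, 'r, 's, 'a) struct" and \<kappa>\<^sub>1 :: "'k rel"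
    and C\<^sub>2 :: "('f, 'r, 's, 'b) struct" and \<kappa>\<^sub>2 :: "'l rel"
  assumes "complete_theory L T"
    and "X \<subseteq> formulas L S"
    and "monster L T \<kappa>\<^sub>1 C\<^sub>1"
    and "monster L T \<kappa>\<^sub>2 C\<^sub>2"
  shows "((\<forall>J\<in>minimal_ellis_ideals L S X C\<^sub>1. |J| <o \<kappa>\<^sub>1) \<longleftrightarrow>
          (\<forall>J\<in>minimal_ellis_ideals L S X C\<^sub>2. |J| <o \<kappa>\<^sub>2)) \<and>
         (\<forall>(C :: ('f, 'r, 's, 'c) struct) (\<kappa> :: 'm rel).
            monster L T \<kappa> C \<and> (\<exists>J\<in>minimal_ellis_ideals L S X C. |J| <o \<kappa>) \<longrightarrow>
            (\<forall>J\<^sub>1\<in>minimal_ellis_ideals L S X C\<^sub>1. \<exists>J\<^sub>2\<in>minimal_ellis_ideals L S X C\<^sub>2.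
               semigroup_isomorphic J\<^sub>1 (ellis_mult L S X C\<^sub>1) J\<^sub>2 (ellis_mult L S X C\<^sub>2)))"
proof (intro conjI iffI allI impI)
  \<comment> \<open>Boundedness is stated for all minimal left ideals, while \<open>transfer\<close>
    starts from one bounded ideal; so existence of minimal left ideals is needed to leave the
    universal quantifier.\<close>
  note transfer = boundedness_transfer[OF assms(1,2)]
  obtain K\<^sub>1 where K1: "K\<^sub>1 \<in> minimal_ellis_ideals L S X C\<^sub>1"
    using minimal_ellis_ideals_nonempty[OF assms(1,2,3)] by blast
  obtain K\<^sub>2 where K2: "K\<^sub>2 \<in> minimal_ellis_ideals L S X C\<^sub>2"
    using minimal_ellis_ideals_nonempty[OF assms(1,2,4)] by blast
  {
    assume "\<forall>J\<in>minimal_ellis_ideals L S X C\<^sub>1. |J| <o \<kappa>\<^sub>1"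
    with K1 show "\<forall>J\<in>minimal_ellis_ideals L S X C\<^sub>2. |J| <o \<kappa>\<^sub>2"
      using transfer(1)[OF assms(3,4) K1] by blast
  next
    assume "\<forall>J\<in>minimal_ellis_ideals L S X C\<^sub>2. |J| <o \<kappa>\<^sub>2"
    with K2 show "\<forall>J\<in>minimal_ellis_ideals L S X C\<^sub>1. |J| <o \<kappa>\<^sub>1"
      using transfer(1)[OF assms(4,3) K2] by blast
  next
    \<comment> \<open>The model \<open>C\<close> with a bounded ideal may be a third one, so
      boundedness is first moved from \<open>C\<close> to \<open>C\<^sub>1\<close>.\<close>
    fix C :: "('f, 'r, 's, 'c) struct" and \<kappa> :: "'m rel"
    assume "monster L T \<kappa> C \<and> (\<exists>J\<in>minimal_ellis_ideals L S X C. |J| <o \<kappa>)"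
    then obtain J where J: "monster L T \<kappa> C" "J \<in> minimal_ellis_ideals L S X C" "|J| <o \<kappa>" by blast
    have "|K\<^sub>1| <o \<kappa>\<^sub>1" using transfer(1)[OF J(1) assms(3) J(2,3)] K1 by blast
    from transfer(2)[OF assms(3,4) K1 this]
    show "\<forall>J\<^sub>1\<in>minimal_ellis_ideals L S X C\<^sub>1. \<exists>J\<^sub>2\<in>minimal_ellis_ideals L S X C\<^sub>2.
        semigroup_isomorphic J\<^sub>1 (ellis_mult L S X C\<^sub>1) J\<^sub>2 (ellis_mult L S X C\<^sub>2)" .
  }
qed

end
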